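(* Consider the controlled Hamiltonian system $$(\Sigma)\qquad \dot q = \partial_p H,\qquad \dot p = -\partial_q H + G(q)u,\qquad H(q,p)=\tfrac12p^TM^{-1}(q)p+V(q),$$ with $q,p\in\mathbb R^n$, $u\in\mathbb R^m$ and one degree of underactuation, i.e. $n-m=1$, where $M(q)$ is a symmetric positive definite $n\times n$ matrix, $V(q)$ is a real-valued function, $G(q)$ is an $n\times m$ matrix of rank $m$ for each $q$, everything is smooth, and $(q,p)=(0,0)$ is an equilibrium point of the system. Let $\Sigma^\ell$ denote the linearization of $(\Sigma)$ at $(q,p)=(0,0)$. Then $(\Sigma)$ can be transformed by a feedback law $u=u(q,p)$ (locally around the origin) to the form $$(\widehat\Sigma)\qquad \begin{bmatrix}\dot q\\ \dot p\end{bmatrix}=\begin{bmatrix}0 & M^{-1}\widehat M\\ -\widehat MM^{-1} & -GK_{\rm d}G^T\end{bmatrix}\begin{bmatrix}\partial_q\widehat H\\ \partial_p\widehat H\end{bmatrix}+\begin{bmatrix}0\\ F_C(q,p)\end{bmatrix},\qquad \widehat H(q,p)=\tfrac12p^T\widehat M^{-1}(q)p+\widehat V(q),$$ with $\widehat M(q)$ symmetric positive definite, $\widehat H$ having a non-degenerate local minimum at $(q,p)=(0,0)$, $K_{\rm d}(q)=K_{\rm d}(q)^T$ a positive definite $m\times m$ matrix, and $C\in\mathcal C(\mathbb R^n)$, if and only if $\Sigma^\ell$ is controllable or the uncontrollable part of $\Sigma^\ell$ is oscillatory. Moreover, the closed-loop system $(\widehat\Sigma)$ is (locally) exponentially stable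 (at the origin) if and only if $\Sigma^\ell$ is controllable.
   Context: All functions are smooth. $\{e_i\}$ is the standard basis of $\mathbb R^n$ and $\{e^i\}$ its dual basis; repeated indices are summed. "Transformed by feedback" means that substituting $u=u(q,p)$ into $(\Sigma)$ gives exactly the vector field of $(\widehat\Sigma)$ on a neighborhood of the origin. $\mathcal C(\mathbb R^n)$ is the set of gyroscopic $(0,3)$-tensor fields $C=C_{ijk}(q)\,e^i\otimes e^j\otimes e^k$ on $\mathbb R^n$, i.e. those satisfying at each $q$ and for all $i,j,k$: $C_{ijk}=C_{jik}$ and $C_{ijk}+C_{jki}+C_{kij}=0$. The gyroscopic force $F_C$ is $F_C(q,p)=C_{ijk}\widehat M^{i\ell}\widehat M^{jr}p_\ell p_r\,e^k$, where $\widehat M^{ij}$ is the $(i,j)$ entry of $\widehat M^{-1}$. The origin is an equilibrium of the uncontrolled system ($u=0$), i.e. $\partial_qV(0)=0$. The linearization $\Sigma^\ell$ is the linear control system $\dot q=M^{-1}(0)p$, $\dot p=-D^2V(0)q+G(0)u$, where $D^2V$ is the Hessian matrix of $V$. Controllability is the usual Kalman controllability. The uncontrollable part of a linear control system $\dot x=Ax+Bu$ is the autonomous linear dynamics induced by $A$ on the quotient of the state space by the controllable subspace. A linear dynamics $\dot x=Ax$ is called oscillatory if $A$ is diagonalizable (over $\mathbb C$) and each eigenvalue of $A$ is a nonzero purely imaginary number. *)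

theory Defs
  imports "HOL-Analysis.Analysis" "Jordan_Normal_Form.Char_Poly"
begin

(* Both matrix libraries are used: fixed-size matrices (real^'n^'n) for the mechanical data, and
   Jordan_Normal_Form matrices for the uncontrollable part, whose dimension depends on the
   system. The clashing infix symbols are kept for the former. *)
no_notation vec_index (infixl \<open>$\<close> 100)
no_notation scalar_prod (infix \<open>\<bullet>\<close> 70)

(* Smooth functions. On an open set S of a finite-dimensional space, C_k_on k S f says that all
   iterated directional derivatives of f up to order k exist and are continuous. *)

primrec C_k_on :: "nat \<Rightarrow> 'a::real_normed_vector set \<Rightarrow> ('a \<Rightarrow> 'b::real_normed_vector) \<Rightarrow> bool" where
  "C_k_on 0 S f \<longleftrightarrow> continuous_on S f"
| "C_k_on (Suc k) S f \<longleftrightarrow> (\<forall>x\<in>S. f differentiable (at x)) \<and>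
     (\<forall>v. C_k_on k S (\<lambda>x. frechet_derivative f (at x) v))"

definition smooth_on :: "'a::real_normed_vector set \<Rightarrow> ('a \<Rightarrow> 'b::real_normed_vector) \<Rightarrow> bool" where
  "smooth_on S f \<longleftrightarrow> (\<forall>k. C_k_on k S f)"

definition grad :: "(real^'n \<Rightarrow> real) \<Rightarrow> real^'n \<Rightarrow> real^'n" where
  "grad f x = (\<chi> i. frechet_derivative f (at x) (axis i 1))"

definition hessian :: "(real^'n \<Rightarrow> real) \<Rightarrow> real^'n \<Rightarrow> real^'n^'n" where
  "hessian f x = jacobian (grad f) (at x)"

(* D2 f x v w is the second derivative (Hessian form) of f at x in the directions v and w. *)
definition D2 :: "('a::real_normed_vector \<Rightarrow> real) \<Rightarrow> 'a \<Rightarrow> 'a \<Rightarrow> 'a \<Rightarrow> real" where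
  "D2 f x v w = frechet_derivative (\<lambda>y. frechet_derivative f (at y) v) (at x) w"

definition nondegenerate_local_min :: "('a::real_normed_vector \<Rightarrow> real) \<Rightarrow> 'a \<Rightarrow> bool" where
  "nondegenerate_local_min f x \<longleftrightarrow>
     (\<forall>\<^sub>F y in nhds x. f x \<le> f y) \<and> (\<forall>v. (\<forall>w. D2 f x v w = 0) \<longrightarrow> v = 0)"

definition sym_pos_def :: "real^'n^'n \<Rightarrow> bool" where
  "sym_pos_def A \<longleftrightarrow> transpose A = A \<and> (\<forall>x. x \<noteq> 0 \<longrightarrow> 0 < x \<bullet> (A *v x))"

(* Linear control systems x' = A x + B u. The controllable subspace is the column space of the
   Kalman matrix [B, A B, ..., A^(N-1) B], where N is the dimension of the state space. *)

definition controllable_subspace ::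
    "('x::euclidean_space \<Rightarrow> 'x) \<Rightarrow> ('u::euclidean_space \<Rightarrow> 'x) \<Rightarrow> 'x set" where
  "controllable_subspace A B = span (\<Union>k<DIM('x). range (\<lambda>u. (A ^^ k) (B u)))"

definition controllable ::
    "('x::euclidean_space \<Rightarrow> 'x) \<Rightarrow> ('u::euclidean_space \<Rightarrow> 'x) \<Rightarrow> bool" where
  "controllable A B \<longleftrightarrow> dim (controllable_subspace A B) = DIM('x)"

(* The quotient of the state space by a subspace S, presented in coordinates: \<pi> is the quotient
   map followed by a linear isomorphism onto k-dimensional coordinate space, i.e. a linear
   surjection with kernel S. *)
definition quotient_map ::
    "'x::real_vector set \<Rightarrow> nat \<Rightarrow> ('x \<Rightarrow> real Matrix.vec) \<Rightarrow> bool" where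
  "quotient_map S k \<pi> \<longleftrightarrow>
     (\<forall>x y. \<pi> (x + y) = \<pi> x + \<pi> y) \<and> (\<forall>c x. \<pi> (c *\<^sub>R x) = c \<cdot>\<^sub>v \<pi> x) \<and>
     range \<pi> = carrier_vec k \<and> {x. \<pi> x = 0\<^sub>v k} = S"

(* N is the matrix, in some basis, of the linear map induced by A on the quotient of the state
   space by the controllable subspace. N is unique up to similarity; it is the 0 x 0 matrix if
   the system is controllable. *)
definition is_uncontrollable_part ::
    "('x::euclidean_space \<Rightarrow> 'x) \<Rightarrow> ('u::euclidean_space \<Rightarrow> 'x) \<Rightarrow> real Matrix.mat \<Rightarrow> bool" where
  "is_uncontrollable_part A B N \<longleftrightarrow>
     (\<exists>k \<pi>. quotient_map (controllable_subspace A B) k \<pi> \<and> N \<in> carrier_mat k k \<and>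
            (\<forall>x. \<pi> (A x) = N *\<^sub>v \<pi> x))"

definition oscillatory :: "real Matrix.mat \<Rightarrow> bool" where
  "oscillatory N \<longleftrightarrow>
     (let N' = map_mat complex_of_real N in
       (\<exists>D. similar_mat N' D \<and> diagonal_mat D) \<and>
       (\<forall>z. eigenvalue N' z \<longrightarrow> z \<noteq> 0 \<and> Re z = 0))"

definition uncontrollable_part_oscillatory ::
    "('x::euclidean_space \<Rightarrow> 'x) \<Rightarrow> ('u::euclidean_space \<Rightarrow> 'x) \<Rightarrow> bool" where
  "uncontrollable_part_oscillatory A B \<longleftrightarrow>
     (\<exists>N. is_uncontrollable_part A B N \<and> oscillatory N)"

(* Local exponential stability of the origin for the autonomous system x' = f x. *)

definition solves :: "('x::real_normed_vector \<Rightarrow> 'x) \<Rightarrow> (real \<Rightarrow> 'x) \<Rightarrow> bool" where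
  "solves f x \<longleftrightarrow> (\<forall>t\<ge>0. (x has_vector_derivative f (x t)) (at t within {0..}))"

definition exponentially_stable :: "('x::real_normed_vector \<Rightarrow> 'x) \<Rightarrow> bool" where
  "exponentially_stable f \<longleftrightarrow>
     (\<exists>\<delta>>0. \<exists>c>0. \<exists>r>0. \<forall>x0. norm x0 < \<delta> \<longrightarrow>
        (\<exists>x. solves f x \<and> x 0 = x0) \<and>
        (\<forall>x. solves f x \<and> x 0 = x0 \<longrightarrow> (\<forall>t\<ge>0. norm (x t) \<le> c * exp (- r * t) * norm x0)))"

(* Mechanical systems on the phase space of pairs (q, p). *)

definition hamiltonian ::
    "(real^'n \<Rightarrow> real^'n^'n) \<Rightarrow> (real^'n \<Rightarrow> real) \<Rightarrow> (real^'n) \<times> (real^'n) \<Rightarrow> real" where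
  "hamiltonian M V = (\<lambda>(q, p). 1/2 * (p \<bullet> (matrix_inv (M q) *v p)) + V q)"

definition grad_q :: "((real^'n) \<times> (real^'n) \<Rightarrow> real) \<Rightarrow> (real^'n) \<times> (real^'n) \<Rightarrow> real^'n" where
  "grad_q H = (\<lambda>(q, p). grad (\<lambda>q'. H (q', p)) q)"

definition grad_p :: "((real^'n) \<times> (real^'n) \<Rightarrow> real) \<Rightarrow> (real^'n) \<times> (real^'n) \<Rightarrow> real^'n" where
  "grad_p H = (\<lambda>(q, p). grad (\<lambda>p'. H (q, p')) p)"

definition controlled_field ::
    "(real^'n \<Rightarrow> real^'n^'n) \<Rightarrow> (real^'n \<Rightarrow> real) \<Rightarrow> (real^'n \<Rightarrow> real^'m^'n) \<Rightarrow>
     (real^'n) \<times> (real^'n) \<Rightarrow> real^'m \<Rightarrow> (real^'n) \<times> (real^'n)" where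
  "controlled_field M V G = (\<lambda>(q, p) u. let H = hamiltonian M V in
     (grad_p H (q, p), - grad_q H (q, p) + G q *v u))"

definition linearization_A ::
    "(real^'n \<Rightarrow> real^'n^'n) \<Rightarrow> (real^'n \<Rightarrow> real) \<Rightarrow>
     (real^'n) \<times> (real^'n) \<Rightarrow> (real^'n) \<times> (real^'n)" where
  "linearization_A M V = (\<lambda>(q, p). (matrix_inv (M 0) *v p, - (hessian V 0 *v q)))"

definition linearization_B ::
    "(real^'n \<Rightarrow> real^'m^'n) \<Rightarrow> real^'m \<Rightarrow> (real^'n) \<times> (real^'n)" where
  "linearization_B G = (\<lambda>u. (0, G 0 *v u))"

(* A (0,3)-tensor field C is given by its components C_ijk(q) = C q $ i $ j $ k. *)
definition gyroscopic_tensor_fields :: "(real^'n \<Rightarrow> real^'n^'n^'n) set" where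
  "gyroscopic_tensor_fields = {C. smooth_on UNIV C \<and>
     (\<forall>q i j k. C q $ i $ j $ k = C q $ j $ i $ k) \<and>
     (\<forall>q i j k. C q $ i $ j $ k + C q $ j $ k $ i + C q $ k $ i $ j = 0)}"

definition gyroscopic_force ::
    "(real^'n \<Rightarrow> real^'n^'n) \<Rightarrow> (real^'n \<Rightarrow> real^'n^'n^'n) \<Rightarrow> (real^'n) \<times> (real^'n) \<Rightarrow> real^'n" where
  "gyroscopic_force Mh C = (\<lambda>(q, p). \<chi> k. \<Sum>i\<in>UNIV. \<Sum>j\<in>UNIV. \<Sum>l\<in>UNIV. \<Sum>r\<in>UNIV.
     C q $ i $ j $ k * matrix_inv (Mh q) $ i $ l * matrix_inv (Mh q) $ j $ r * p $ l * p $ r)"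

definition closed_loop_field ::
    "(real^'n \<Rightarrow> real^'n^'n) \<Rightarrow> (real^'n \<Rightarrow> real^'m^'n) \<Rightarrow>
     (real^'n \<Rightarrow> real^'n^'n) \<Rightarrow> (real^'n \<Rightarrow> real) \<Rightarrow> (real^'n \<Rightarrow> real^'m^'m) \<Rightarrow>
     (real^'n \<Rightarrow> real^'n^'n^'n) \<Rightarrow> (real^'n) \<times> (real^'n) \<Rightarrow> (real^'n) \<times> (real^'n)" where
  "closed_loop_field M G Mh Vh Kd C = (\<lambda>(q, p). let H = hamiltonian Mh Vh in
     ((matrix_inv (M q) ** Mh q) *v grad_p H (q, p),
      - ((Mh q ** matrix_inv (M q)) *v grad_q H (q, p))
      - (G q ** Kd q ** transpose (G q)) *v grad_p H (q, p)
      + gyroscopic_force Mh C (q, p)))"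

(* x' = F x u becomes x' = f x near the origin under some smooth feedback law u = u(x). *)
definition transformed_by_feedback ::
    "('x::real_normed_vector \<Rightarrow> 'u::real_normed_vector \<Rightarrow> 'x) \<Rightarrow> ('x \<Rightarrow> 'x) \<Rightarrow> bool" where
  "transformed_by_feedback F f \<longleftrightarrow>
     (\<exists>U u. open U \<and> 0 \<in> U \<and> smooth_on U u \<and> (\<forall>x\<in>U. F x (u x) = f x))"

(* The controlled system with data M, V, G can be brought by feedback to the closed-loop form with
   data Mh, Vh, Kd, C. The latter live on the whole space, as C does; only the
   identity of the two vector fields is local. *)
definition energy_shaping ::
    "(real^'n \<Rightarrow> real^'n^'n) \<Rightarrow> (real^'n \<Rightarrow> real) \<Rightarrow> (real^'n \<Rightarrow> real^'m^'n) \<Rightarrow>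
     (real^'n \<Rightarrow> real^'n^'n) \<Rightarrow> (real^'n \<Rightarrow> real) \<Rightarrow> (real^'n \<Rightarrow> real^'m^'m) \<Rightarrow>
     (real^'n \<Rightarrow> real^'n^'n^'n) \<Rightarrow> bool" where
  "energy_shaping M V G Mh Vh Kd C \<longleftrightarrow>
     smooth_on UNIV Mh \<and> (\<forall>q. sym_pos_def (Mh q)) \<and>
     smooth_on UNIV Vh \<and> nondegenerate_local_min (hamiltonian Mh Vh) (0, 0) \<and>
     smooth_on UNIV Kd \<and> (\<forall>q. sym_pos_def (Kd q)) \<and>
     C \<in> gyroscopic_tensor_fields \<and>
     transformed_by_feedback (controlled_field M V G) (closed_loop_field M G Mh Vh Kd C)"

end

theory Submission
  imports Defs
begin

text \<open>
  Let \<open>g0\<close> span the annihilator of the range of \<open>G(0)\<close>, and write \<open>m = M(0)\<close> and \<open>P = D\<^sup>2V(0)\<close>.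
  The whole theorem is decided by the relative position of the two vectors \<open>m g0\<close> and \<open>P g0\<close>.

  \<^emph>\<open>The linear dichotomy.\<close> Multiplying the linearized equation \<open>m q'' = - P q + G u\<close> by \<open>g0\<close> removes the
  input. If \<open>P g0 = \<mu> m g0\<close>, what remains is the scalar equation \<open>y'' = - \<mu> y\<close> for \<open>y = g0 \<bullet> m q\<close>. It is the
  whole uncontrollable part, and it is oscillatory exactly if \<open>\<mu> > 0\<close>. If \<open>P g0\<close> and \<open>m g0\<close> are not
  parallel, the linearization is controllable (\<open>controllable_iff_not_parallel\<close>, \<open>oscillatory_iff_positive\<close>).

  \<^emph>\<open>Necessity.\<close> Feedback cannot change the component of the force along the annihilator. Comparing the two
  vector fields at \<open>p = 0\<close> to first order in \<open>q\<close> gives \<open>P g0 = D\<^sup>2Vh(0) w\<close> with \<open>w = m\<^sup>-\<^sup>1 Mh(0) g0\<close>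
  (\<open>matching_at_origin\<close>). Hence \<open>w\<close> has a positive inner product both with \<open>P g0\<close> and with \<open>m g0\<close>, which is
  impossible if \<open>P g0 = \<mu> m g0\<close> with \<open>\<mu> \<le> 0\<close>.

  \<^emph>\<open>Sufficiency.\<close> If \<open>P g0\<close> is not such a multiple, some vector \<open>w\<close> has a positive inner product with both. The
  construction keeps this \<open>w\<close> as a constant vector field, requires \<open>Mh g = M w\<close> for an annihilator field
  \<open>g\<close>, and uses the freedom to rescale \<open>g\<close>. Matching the potential energies then means that the
  derivative of \<open>Vh\<close> along \<open>w\<close> is \<open>g \<bullet> grad V\<close>. Matching the kinetic energies means that a certain quadratic
  form in the velocity equals the \<open>g\<close>-component of a gyroscopic force. Such a force does no
  work, so the form must vanish at the velocity \<open>g\<close>, and this is the only obstruction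
  (\<open>gyroscopic_field_exists\<close>). After substituting \<open>Mh g = M w\<close>, that scalar condition contains no derivative
  of \<open>Mh\<close> and becomes a linear first-order equation, along \<open>w\<close>, for the logarithm of the scaling factor of \<open>g\<close>
  (\<open>annihilator_without_kinetic_defect\<close>). Because \<open>w\<close> is constant, both differential equations are solved by
  integration along straight lines (\<open>line_integral\<close>). The matrix \<open>Mh\<close> and the tensor \<open>C\<close> are explicit
  formulas near the origin, extended to the whole space with bump functions.

  \<^emph>\<open>Stability.\<close> The Hessian of the shaped energy is a Lyapunov function of the linearized closed loop, and it
  decreases at a rate controlled by the output \<open>G\<^sup>T Mh\<^sup>-\<^sup>1 p\<close>. If \<open>P g0\<close> and \<open>m g0\<close> are not parallel, this output
  determines the state, so the energy can be corrected to a strict Lyapunov function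
  (\<open>strict_lyapunov_function_exists\<close>), which yields exponential stability of the nonlinear system. If they are
  parallel, the linearized closed loop conserves \<open>\<mu> (g0 \<bullet> m q)\<^sup>2 + (g0 \<bullet> p)\<^sup>2\<close>, and along exponentially
  decaying solutions the higher-order terms are too small to make this quantity decay
  (\<open>conserved_form_not_exponentially_stable\<close>).
\<close>

section \<open>Calculus of smooth functions\<close>

abbreviation dderiv :: "('a::real_normed_vector \<Rightarrow> 'b::real_normed_vector) \<Rightarrow> 'a \<Rightarrow> 'a \<Rightarrow> 'b" where
  "dderiv f v x \<equiv> frechet_derivative f (at x) v"

lemma C_k_on_cong:
  assumes "open S" and "\<And>x. x \<in> S \<Longrightarrow> f x = g x"
  shows "C_k_on k S f \<longleftrightarrow> C_k_on k S g"
  using assms(2)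
proof (induction k arbitrary: f g)
  case 0
  then show ?case by (simp cong: continuous_on_cong)
next
  case (Suc k)
  have d: "f differentiable (at x) \<longleftrightarrow> g differentiable (at x)" if "x \<in> S" for x
  proof -
    have "g differentiable (at x)" if "f differentiable (at x)" "\<And>y. y \<in> S \<Longrightarrow> f y = g y" for f g :: "'a \<Rightarrow> 'b"
      using that has_derivative_transform_within_open[of f _ x UNIV S g] \<open>x \<in> S\<close> assms(1)
      unfolding differentiable_def by blast
    then show ?thesis using Suc.prems by metis
  qed
  have e: "frechet_derivative f (at x) = frechet_derivative g (at x)"
    if "x \<in> S" "f differentiable (at x)" for x
    using frechet_derivative_transform_within_open[of f x S g] that Suc.prems assms(1) by blast
  have "C_k_on k S (\<lambda>x. dderiv f v x) \<longleftrightarrow> C_k_on k S (\<lambda>x. dderiv g v x)"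
    if "\<forall>x\<in>S. f differentiable (at x)" for v
    using e that by (intro Suc.IH) auto
  then show ?case using d by auto
qed

text \<open>The definition speaks of the chosen Frechet derivative. With this rule any explicit formula for the
  derivative can be used instead.\<close>

lemma C_k_on_SucI:
  assumes "open S" "\<And>x. x \<in> S \<Longrightarrow> (f has_derivative f' x) (at x)"
    and "\<And>v. C_k_on k S (\<lambda>x. f' x v)"
  shows "C_k_on (Suc k) S f"
proof -
  have "frechet_derivative f (at x) = f' x" if "x \<in> S" for x
    using frechet_derivative_at[OF assms(2)[OF that]] by simp
  then have "C_k_on k S (\<lambda>x. dderiv f v x)" for v
    using C_k_on_cong[OF assms(1), of "\<lambda>x. dderiv f v x" "\<lambda>x. f' x v" k] assms(3) by simp
  then show ?thesis using assms(2) by (auto simp: differentiable_def)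
qed

lemma C_k_on_SucD:
  assumes "C_k_on (Suc k) S f"
  shows "x \<in> S \<Longrightarrow> (f has_derivative frechet_derivative f (at x)) (at x)"
    and "C_k_on k S (\<lambda>x. dderiv f v x)"
  using assms by (auto simp: frechet_derivative_works)

lemma C_k_on_imp_continuous_on: "C_k_on k S f \<Longrightarrow> continuous_on S f"
  by (cases k) (auto intro!: continuous_at_imp_continuous_on differentiable_imp_continuous_within)

lemma C_k_on_SucD_le: "C_k_on (Suc k) S f \<Longrightarrow> C_k_on k S f"
proof (induction k arbitrary: f)
  case 0
  then show ?case using C_k_on_imp_continuous_on[of "Suc 0" S f] by simp
next
  case (Suc k)
  then show ?case by (metis C_k_on.simps(2))
qed

lemma C_k_on_mono: "C_k_on k S f \<Longrightarrow> T \<subseteq> S \<Longrightarrow> C_k_on k T f"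
  by (induction k arbitrary: f) (auto intro: continuous_on_subset)

lemma C_k_on_const: "open S \<Longrightarrow> C_k_on k S (\<lambda>x. c)"
proof (induction k arbitrary: c)
  case (Suc k)
  show ?case by (rule C_k_on_SucI[where f' = "\<lambda>x v. 0"]) (auto intro: Suc)
qed simp

lemma C_k_on_add:
  "open S \<Longrightarrow> C_k_on k S f \<Longrightarrow> C_k_on k S g \<Longrightarrow> C_k_on k S (\<lambda>x. f x + g x)"
proof (induction k arbitrary: f g)
  case (Suc k)
  show ?case
    by (rule C_k_on_SucI[where f' = "\<lambda>x v. dderiv f v x + dderiv g v x"])
      (use Suc.prems C_k_on_SucD[OF Suc.prems(2)] C_k_on_SucD[OF Suc.prems(3)] in
        \<open>auto intro!: has_derivative_add Suc.IH\<close>)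
qed (simp add: continuous_on_add)

lemma C_k_on_bounded_linear:
  assumes "bounded_linear L"
  shows "open S \<Longrightarrow> C_k_on k S f \<Longrightarrow> C_k_on k S (\<lambda>x. L (f x))"
proof (induction k arbitrary: f)
  case 0
  then show ?case by (simp add: bounded_linear.continuous_on[OF assms])
next
  case (Suc k)
  show ?case
    by (rule C_k_on_SucI[where f' = "\<lambda>x v. L (dderiv f v x)"])
      (use Suc.prems C_k_on_SucD[OF Suc.prems(2)] in
        \<open>auto intro!: bounded_linear.has_derivative[OF assms] Suc.IH\<close>)
qed

lemma C_k_on_bounded_bilinear:
  assumes "bounded_bilinear B"
  shows "open S \<Longrightarrow> C_k_on k S f \<Longrightarrow> C_k_on k S g \<Longrightarrow> C_k_on k S (\<lambda>x. B (f x) (g x))"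
proof (induction k arbitrary: f g)
  case 0
  then show ?case by (simp add: bounded_bilinear.continuous_on[OF assms])
next
  case (Suc k)
  show ?case
    by (rule C_k_on_SucI[where f' = "\<lambda>x v. B (f x) (dderiv g v x) + B (dderiv f v x) (g x)"])
      (use Suc.prems C_k_on_SucD[OF Suc.prems(2)] C_k_on_SucD[OF Suc.prems(3)] in
        \<open>auto intro!: bounded_bilinear.FDERIV[OF assms] Suc.IH C_k_on_add
          C_k_on_SucD_le[OF Suc.prems(2)] C_k_on_SucD_le[OF Suc.prems(3)]\<close>)
qed

lemma C_k_on_sum:
  "open S \<Longrightarrow> (\<And>i. i \<in> I \<Longrightarrow> C_k_on k S (f i)) \<Longrightarrow> C_k_on k S (\<lambda>x. \<Sum>i\<in>I. f i x)"
  by (induction I rule: infinite_finite_induct) (auto intro!: C_k_on_const C_k_on_add)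

text \<open>The directional derivative of the composition differentiates the outer function in a direction that
  depends on the point. Expanding this direction in a basis leaves finitely many derivatives of the outer
  function in fixed directions, and those fall under the induction hypothesis.\<close>

lemma C_k_on_compose:
  fixes g :: "'a::real_normed_vector \<Rightarrow> 'b::euclidean_space"
  assumes "open S" "open T" "g ` S \<subseteq> T"
  shows "C_k_on k T f \<Longrightarrow> C_k_on k S g \<Longrightarrow> C_k_on k S (\<lambda>x. f (g x))"
proof (induction k arbitrary: f)
  case 0
  then show ?case using assms(3) by (simp add: continuous_on_compose2)
next
  case (Suc k)
  have lin: "linear (frechet_derivative f (at (g x)))" if "x \<in> S" for x
    using C_k_on_SucD(1)[OF Suc.prems(1), of "g x"] that assms(3)
    by (auto intro: has_derivative_linear)
  have e: "dderiv f w (g x) = (\<Sum>b\<in>Basis. (w \<bullet> b) *\<^sub>R dderiv f b (g x))" if "x \<in> S" for x w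
  proof -
    have "dderiv f w (g x) = dderiv f (\<Sum>b\<in>Basis. (w \<bullet> b) *\<^sub>R b) (g x)"
      by (simp add: euclidean_representation)
    then show ?thesis by (simp add: linear_sum[OF lin[OF that]] linear_scale[OF lin[OF that]] o_def)
  qed
  have "C_k_on k S (\<lambda>x. dderiv f b (g x))" for b
    by (rule Suc.IH) (use C_k_on_SucD(2)[OF Suc.prems(1)] C_k_on_SucD_le[OF Suc.prems(2)] in auto)
  then have s: "C_k_on k S (\<lambda>x. \<Sum>b\<in>Basis. (dderiv g v x \<bullet> b) *\<^sub>R dderiv f b (g x))" for v
    using C_k_on_SucD(2)[OF Suc.prems(2)]
    by (intro C_k_on_sum C_k_on_bounded_bilinear[OF bounded_bilinear_scaleR] assms
        C_k_on_bounded_linear[OF bounded_linear_inner_left])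
  have s': "C_k_on k S (\<lambda>x. dderiv f (dderiv g v x) (g x))" for v
    using s[of v] C_k_on_cong[OF assms(1), of "\<lambda>x. dderiv f (dderiv g v x) (g x)", OF e] by blast
  show ?case
    by (rule C_k_on_SucI[where f' = "\<lambda>x v. dderiv f (dderiv g v x) (g x)"])
      (use assms C_k_on_SucD(1)[OF Suc.prems(1)] C_k_on_SucD(1)[OF Suc.prems(2)] s' in
        \<open>auto intro!: has_derivative_compose[of g _ _ _ f]\<close>)
qed

lemma C_k_on_Un:
  assumes "open S" "open T" shows "C_k_on k S f \<Longrightarrow> C_k_on k T f \<Longrightarrow> C_k_on k (S \<union> T) f"
  by (induction k arbitrary: f) (auto intro: continuous_on_open_Un assms)

lemma C_k_on_inverse: "C_k_on k (- {0::real}) inverse"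
proof (induction k)
  case 0
  then show ?case by (auto intro!: continuous_intros)
next
  case (Suc k)
  have "C_k_on k (- {0::real}) (\<lambda>x. inverse x * inverse x)"
    by (intro C_k_on_bounded_bilinear[OF bounded_bilinear_mult] Suc) auto
  then have *: "C_k_on k (- {0::real}) (\<lambda>x. (- v) * (inverse x * inverse x))" for v
    by (intro C_k_on_bounded_linear[OF bounded_linear_mult_right]) auto
  show ?case
    by (rule C_k_on_SucI[where f' = "\<lambda>x v. (- v) * (inverse x * inverse x)"])
      (use * in \<open>auto intro!: derivative_eq_intros simp: power2_eq_square field_simps\<close>)
qed

lemma C_k_on_exp: "C_k_on k (UNIV :: real set) exp"
proof (induction k)
  case 0
  then show ?case by (auto intro!: continuous_intros)
next
  case (Suc k)
  have *: "C_k_on k (UNIV :: real set) (\<lambda>x. v * exp x)" for v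
    by (intro C_k_on_bounded_linear[OF bounded_linear_mult_right] Suc) auto
  show ?case
    by (rule C_k_on_SucI[where f' = "\<lambda>x v. v * exp x"])
      (use * in \<open>auto intro!: derivative_eq_intros\<close>)
qed

named_theorems smooth_intros

lemma smooth_on_cong:
  "open S \<Longrightarrow> (\<And>x. x \<in> S \<Longrightarrow> f x = g x) \<Longrightarrow> smooth_on S f \<longleftrightarrow> smooth_on S g"
  unfolding smooth_on_def using C_k_on_cong by blast

lemma smooth_on_mono: "smooth_on S f \<Longrightarrow> T \<subseteq> S \<Longrightarrow> smooth_on T f"
  unfolding smooth_on_def using C_k_on_mono by blast

lemma smooth_on_Un: "open S \<Longrightarrow> open T \<Longrightarrow> smooth_on S f \<Longrightarrow> smooth_on T f \<Longrightarrow> smooth_on (S \<union> T) f"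
  unfolding smooth_on_def using C_k_on_Un by blast

lemma smooth_on_has_derivative:
  "smooth_on S f \<Longrightarrow> x \<in> S \<Longrightarrow> (f has_derivative frechet_derivative f (at x)) (at x)"
  unfolding smooth_on_def using C_k_on_SucD(1)[of 0] by blast

lemma smooth_on_imp_continuous_on: "smooth_on S f \<Longrightarrow> continuous_on S f"
  unfolding smooth_on_def using C_k_on_imp_continuous_on by blast

lemma smooth_on_dderiv [smooth_intros]: "smooth_on S f \<Longrightarrow> smooth_on S (\<lambda>x. dderiv f v x)"
  unfolding smooth_on_def using C_k_on_SucD(2) by blast

lemma smooth_on_const [smooth_intros]: "open S \<Longrightarrow> smooth_on S (\<lambda>x. c)"
  by (simp add: smooth_on_def C_k_on_const)

lemma smooth_on_add [smooth_intros]: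
  "open S \<Longrightarrow> smooth_on S f \<Longrightarrow> smooth_on S g \<Longrightarrow> smooth_on S (\<lambda>x. f x + g x)"
  by (simp add: smooth_on_def C_k_on_add)

lemma smooth_on_sum [smooth_intros]:
  "open S \<Longrightarrow> (\<And>i. i \<in> I \<Longrightarrow> smooth_on S (f i)) \<Longrightarrow> smooth_on S (\<lambda>x. \<Sum>i\<in>I. f i x)"
  by (simp add: smooth_on_def C_k_on_sum)

lemma smooth_on_bounded_linear:
  "bounded_linear L \<Longrightarrow> open S \<Longrightarrow> smooth_on S f \<Longrightarrow> smooth_on S (\<lambda>x. L (f x))"
  by (simp add: smooth_on_def C_k_on_bounded_linear)

lemma smooth_on_bounded_bilinear:
  "bounded_bilinear B \<Longrightarrow> open S \<Longrightarrow> smooth_on S f \<Longrightarrow> smooth_on S g \<Longrightarrow> smooth_on S (\<lambda>x. B (f x) (g x))"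
  by (simp add: smooth_on_def C_k_on_bounded_bilinear)

lemma smooth_on_compose:
  fixes g :: "'a::real_normed_vector \<Rightarrow> 'b::euclidean_space"
  assumes "smooth_on T f" "open S" "open T" "g ` S \<subseteq> T" "smooth_on S g"
  shows "smooth_on S (\<lambda>x. f (g x))"
  using assms C_k_on_compose[of S T g] unfolding smooth_on_def by blast

lemma smooth_on_compose_UNIV:
  fixes g :: "'a::real_normed_vector \<Rightarrow> 'b::euclidean_space"
  shows "smooth_on UNIV f \<Longrightarrow> open S \<Longrightarrow> smooth_on S g \<Longrightarrow> smooth_on S (\<lambda>x. f (g x))"
  by (rule smooth_on_compose[of UNIV]) auto

lemma smooth_on_ident [smooth_intros]: "open S \<Longrightarrow> smooth_on S (\<lambda>x. x)"
proof -
  assume S: "open S"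
  have "C_k_on k S (\<lambda>x. x)" for k
  proof (cases k)
    case (Suc l)
    show ?thesis unfolding Suc
      by (rule C_k_on_SucI[where f' = "\<lambda>x v. v"]) (auto intro: C_k_on_const S)
  qed auto
  then show ?thesis by (simp add: smooth_on_def)
qed

lemmas smooth_on_minus [smooth_intros] = smooth_on_bounded_linear[OF bounded_linear_minus[OF bounded_linear_ident]]
lemmas smooth_on_scaleR [smooth_intros] = smooth_on_bounded_bilinear[OF bounded_bilinear_scaleR]
lemmas smooth_on_mult [smooth_intros] = smooth_on_bounded_bilinear[OF bounded_bilinear_mult]
lemmas smooth_on_inner [smooth_intros] = smooth_on_bounded_bilinear[OF bounded_bilinear_inner]
lemmas smooth_on_fst [smooth_intros] = smooth_on_bounded_linear[OF bounded_linear_fst]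
lemmas smooth_on_snd [smooth_intros] = smooth_on_bounded_linear[OF bounded_linear_snd]
lemmas smooth_on_vec_nth [smooth_intros] = smooth_on_bounded_linear[OF bounded_linear_vec_nth]

lemma smooth_on_diff [smooth_intros]:
  "open S \<Longrightarrow> smooth_on S f \<Longrightarrow> smooth_on S g \<Longrightarrow> smooth_on S (\<lambda>x. f x - g x)"
  using smooth_on_add[of S f "\<lambda>x. - g x"] smooth_on_minus[of S g] by simp

lemma smooth_on_prod [smooth_intros]:
  fixes f :: "'i \<Rightarrow> 'a::real_normed_vector \<Rightarrow> real"
  shows "open S \<Longrightarrow> (\<And>i. i \<in> I \<Longrightarrow> smooth_on S (f i)) \<Longrightarrow> smooth_on S (\<lambda>x. \<Prod>i\<in>I. f i x)"
  by (induction I rule: infinite_finite_induct) (auto intro!: smooth_intros)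

lemma smooth_on_exp [smooth_intros]:
  fixes f :: "'a::real_normed_vector \<Rightarrow> real"
  shows "open S \<Longrightarrow> smooth_on S f \<Longrightarrow> smooth_on S (\<lambda>x. exp (f x))"
  using smooth_on_compose_UNIV[of exp S f] by (simp add: smooth_on_def C_k_on_exp)

lemma smooth_on_divide [smooth_intros]:
  fixes f g :: "'a::real_normed_vector \<Rightarrow> real"
  assumes "open S" "smooth_on S f" "smooth_on S g" "\<And>x. x \<in> S \<Longrightarrow> g x \<noteq> 0"
  shows "smooth_on S (\<lambda>x. f x / g x)"
proof -
  have "smooth_on (- {0::real}) inverse"
    by (simp add: smooth_on_def C_k_on_inverse)
  then have "smooth_on S (\<lambda>x. inverse (g x))"
    using assms by (intro smooth_on_compose[of "- {0}" inverse S g] open_Compl) auto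
  then show ?thesis using assms smooth_on_mult by (simp add: divide_inverse)
qed

lemma smooth_on_Pair [smooth_intros]:
  assumes "open S" "smooth_on S f" "smooth_on S g"
  shows "smooth_on S (\<lambda>x. (f x, g x))"
proof -
  have "smooth_on S (\<lambda>x. (f x, 0) + (0, g x))"
    using assms
    by (intro smooth_on_add smooth_on_bounded_linear[of "\<lambda>y. (y, 0)"] smooth_on_bounded_linear[of "\<lambda>y. (0, y)"])
      (auto intro!: bounded_linear_Pair bounded_linear_ident bounded_linear_zero)
  then show ?thesis by simp
qed

lemma smooth_on_vec_lambda [smooth_intros]:
  fixes f :: "'a::real_normed_vector \<Rightarrow> 'i::finite \<Rightarrow> 'b::euclidean_space"
  assumes "open S" "\<And>i. smooth_on S (\<lambda>x. f x i)"
  shows "smooth_on S (\<lambda>x. \<chi> i. f x i)"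
proof -
  have "linear (axis i :: 'b \<Rightarrow> 'b^'i)" for i
    by (rule linearI) (auto simp: axis_def Finite_Cartesian_Product.vec_eq_iff)
  then have "bounded_linear (axis i :: 'b \<Rightarrow> 'b^'i)" for i
    by (rule linear_conv_bounded_linear[THEN iffD1])
  then have "smooth_on S (\<lambda>x. \<Sum>i\<in>UNIV. axis i (f x i))"
    using assms by (intro smooth_on_sum smooth_on_bounded_linear[where L = "axis _"])
  moreover have "(\<Sum>i\<in>UNIV. axis i (f x i)) = (\<chi> i. f x i)" for x
    by (simp add: Finite_Cartesian_Product.vec_eq_iff axis_def)
  ultimately show ?thesis by simp
qed

lemma smooth_on_matrix_vector_mult [smooth_intros]:
  fixes A :: "'a::real_normed_vector \<Rightarrow> real^'m^'n"
  assumes "open S" "smooth_on S A" "smooth_on S f"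
  shows "smooth_on S (\<lambda>x. A x *v f x)"
  unfolding matrix_vector_mult_def using assms by (intro smooth_intros) auto

lemma smooth_on_matrix_matrix_mult [smooth_intros]:
  fixes A :: "'a::real_normed_vector \<Rightarrow> real^'m^'n" and B :: "'a \<Rightarrow> real^'k^'m"
  assumes "open S" "smooth_on S A" "smooth_on S B"
  shows "smooth_on S (\<lambda>x. A x ** B x)"
  unfolding matrix_matrix_mult_def using assms by (intro smooth_intros) auto

lemma smooth_on_transpose [smooth_intros]:
  fixes A :: "'a::real_normed_vector \<Rightarrow> real^'m^'n"
  assumes "open S" "smooth_on S A"
  shows "smooth_on S (\<lambda>x. Finite_Cartesian_Product.transpose (A x))"
  unfolding Finite_Cartesian_Product.transpose_def using assms by (intro smooth_intros) auto

lemma smooth_on_det: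
  fixes A :: "'a::real_normed_vector \<Rightarrow> real^'n^'n"
  assumes "open S" "smooth_on S A"
  shows "smooth_on S (\<lambda>x. Determinants.det (A x))"
  unfolding Determinants.det_def using assms by (intro smooth_intros) auto

lemma matrix_inv_works:
  fixes A :: "real^'n^'n"
  assumes "invertible A"
  shows "A ** matrix_inv A = Finite_Cartesian_Product.mat 1"
    and "matrix_inv A ** A = Finite_Cartesian_Product.mat 1"
  using someI_ex[of "\<lambda>A'. A ** A' = Finite_Cartesian_Product.mat 1 \<and> A' ** A = Finite_Cartesian_Product.mat 1"] assms
  unfolding invertible_def matrix_inv_def by blast+

text \<open>By Cramer's rule every entry of the inverse is a quotient of determinants, and these are polynomials in
  the entries of the matrix.\<close>

lemma smooth_on_matrix_inv [smooth_intros]: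
  fixes A :: "'a::real_normed_vector \<Rightarrow> real^'n^'n"
  assumes "open S" "smooth_on S A" "\<And>x. x \<in> S \<Longrightarrow> invertible (A x)"
  shows "smooth_on S (\<lambda>x. matrix_inv (A x))"
proof -
  let ?c = "\<lambda>x i j. (\<chi> r s. if s = i then axis j 1 $ r else A x $ r $ s) :: real^'n^'n"
  have c: "smooth_on S (\<lambda>x. ?c x i j)" for i j
  proof (intro smooth_on_vec_lambda assms(1))
    fix r s
    show "smooth_on S (\<lambda>x. if s = i then axis j 1 $ r else A x $ r $ s)"
      using assms by (cases "s = i") (auto intro!: smooth_intros)
  qed
  have "matrix_inv (A x) = (\<chi> i j. Determinants.det (?c x i j) / Determinants.det (A x))" if "x \<in> S" for x
  proof -
    have d: "Determinants.det (A x) \<noteq> 0" using assms(3)[OF that] by (simp add: invertible_det_nz)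
    have "A x *v column j (matrix_inv (A x)) = axis j 1" for j
      using matrix_inv_works(1)[OF assms(3)[OF that]]
      by (simp flip: matrix_vector_mult_basis add: matrix_vector_mul_assoc)
    then have "column j (matrix_inv (A x)) = (\<chi> i. Determinants.det (?c x i j) / Determinants.det (A x))" for j
      using cramer[OF d] by blast
    then show ?thesis by (simp add: Finite_Cartesian_Product.vec_eq_iff Finite_Cartesian_Product.column_def)
  qed
  moreover have "smooth_on S (\<lambda>x. \<chi> i j. Determinants.det (?c x i j) / Determinants.det (A x))"
    by (intro smooth_on_vec_lambda smooth_on_divide smooth_on_det c assms(1,2))
      (use assms(3) in \<open>simp add: invertible_det_nz\<close>)
  ultimately show ?thesis
    using smooth_on_cong[OF assms(1), of "\<lambda>x. matrix_inv (A x)"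
      "\<lambda>x. \<chi> i j. Determinants.det (?c x i j) / Determinants.det (A x)"] by simp
qed

lemma smooth_on_grad [smooth_intros]:
  assumes "open S" "smooth_on S f" shows "smooth_on S (grad f)"
  unfolding grad_def using assms by (intro smooth_intros) auto

section \<open>Bump functions\<close>

text \<open>The case \<open>k = 0\<close> is the flat function \<open>exp (- 1 / x)\<close>. The powers of \<open>1 / x\<close> are included because the
  family is then closed, up to linear combinations, under differentiation.\<close>

definition flat_exp :: "nat \<Rightarrow> real \<Rightarrow> real" where
  "flat_exp k x = (if x \<le> 0 then 0 else inverse x ^ k * exp (- inverse x))"

lemma flat_exp_has_derivative:
  "(flat_exp k has_real_derivative flat_exp (k + 2) x - real k * flat_exp (k + 1) x) (at x)"
proof -
  consider "x < 0" | "x = 0" | "x > 0" by linarith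
  then show ?thesis
  proof cases
    case 1
    have "(flat_exp k has_real_derivative 0) (at x)"
      by (rule has_field_derivative_transform_within_open[of "\<lambda>_. 0" 0 x "{..<0}"])
        (use 1 in \<open>auto simp: flat_exp_def\<close>)
    then show ?thesis using 1 by (simp add: flat_exp_def)
  next
    case 2
    have "((\<lambda>h. flat_exp k h / h) \<longlongrightarrow> 0) (at_left 0)"
      by (rule tendsto_eventually) (auto simp: eventually_at_filter flat_exp_def)
    moreover have "((\<lambda>h. flat_exp k h / h) \<longlongrightarrow> 0) (at_right 0)"
    proof -
      have "((\<lambda>h. inverse h ^ (k + 1) / exp (inverse h)) \<longlongrightarrow> (0::real)) (at_right 0)"
        by (rule filterlim_compose[OF tendsto_power_div_exp_0 filterlim_inverse_at_top_right])
      moreover have "\<forall>\<^sub>F h in at_right (0::real). inverse h ^ (k + 1) / exp (inverse h) = flat_exp k h / h"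
        by (auto simp: eventually_at_filter flat_exp_def exp_minus divide_inverse intro!: always_eventually)
      ultimately show ?thesis by (rule Lim_transform_eventually)
    qed
    ultimately have "((\<lambda>h. flat_exp k h / h) \<longlongrightarrow> 0) (at 0)"
      by (simp add: filterlim_split_at)
    then have "(flat_exp k has_real_derivative 0) (at 0)"
      by (simp add: has_field_derivative_iff flat_exp_def)
    then show ?thesis using 2 by (simp add: flat_exp_def)
  next
    case 3
    have "((\<lambda>x. inverse x ^ k * exp (- inverse x)) has_real_derivative
        inverse x ^ (k + 2) * exp (- inverse x) - real k * (inverse x ^ (k + 1) * exp (- inverse x))) (at x)"
    proof -
      have "((\<lambda>x. inverse x ^ k) has_real_derivative real k * (- (inverse x ^ Suc (Suc 0)) * inverse x ^ (k - Suc 0))) (at x)"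
        using 3 by (intro DERIV_power DERIV_inverse) auto
      moreover have "real k * (- (inverse x ^ Suc (Suc 0)) * inverse x ^ (k - Suc 0)) = - real k * inverse x ^ (k + 1)"
        by (cases k) (auto simp: algebra_simps)
      ultimately have "((\<lambda>x. inverse x ^ k) has_real_derivative - real k * inverse x ^ (k + 1)) (at x)"
        by (simp only:)
      moreover have "((\<lambda>x. exp (- inverse x)) has_real_derivative exp (- inverse x) * inverse x ^ 2) (at x)"
        using 3 by (auto intro!: derivative_eq_intros simp: power2_eq_square)
      ultimately show ?thesis
        by (rule DERIV_cong[OF DERIV_mult]) (simp add: algebra_simps power_add power2_eq_square)
    qed
    then have "(flat_exp k has_real_derivative
        inverse x ^ (k + 2) * exp (- inverse x) - real k * (inverse x ^ (k + 1) * exp (- inverse x))) (at x)"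
      by (rule has_field_derivative_transform_within_open[of _ _ x "{0<..}"])
        (use 3 in \<open>auto simp: flat_exp_def\<close>)
    then show ?thesis using 3 by (simp add: flat_exp_def)
  qed
qed

lemma smooth_flat_exp: "smooth_on UNIV (flat_exp k)"
proof -
  have "C_k_on j UNIV (flat_exp k)" for j
  proof (induction j arbitrary: k)
    case 0
    show ?case
      using flat_exp_has_derivative by (auto intro!: continuous_at_imp_continuous_on DERIV_isCont)
  next
    case (Suc j)
    have "C_k_on j UNIV (\<lambda>x. v * (flat_exp (k + 2) x + (- real k) * flat_exp (k + 1) x))" for v
      by (intro C_k_on_bounded_linear[OF bounded_linear_mult_right] C_k_on_add Suc) auto
    then have *: "C_k_on j UNIV (\<lambda>x. v * (flat_exp (k + 2) x - real k * flat_exp (k + 1) x))" for v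
      by simp
    have "(*) (c::real) = (\<lambda>v. v * c)" for c by (simp add: fun_eq_iff)
    then have "(flat_exp k has_derivative (\<lambda>v. v * (flat_exp (k + 2) x - real k * flat_exp (k + 1) x))) (at x)" for x
      using flat_exp_has_derivative[of k x] unfolding has_field_derivative_def by metis
    then show ?case by (rule C_k_on_SucI[OF open_UNIV _ *])
  qed
  then show ?thesis by (simp add: smooth_on_def)
qed

text \<open>A quotient \<open>\<phi> / (\<phi> + \<psi>)\<close>, where the flat functions \<open>\<phi>\<close> and \<open>\<psi>\<close> vanish outside a ball and
  inside the ball of half its radius, respectively, and never both at the same point.\<close>

lemma bump_function_exists:
  fixes U :: "'a::euclidean_space set"
  assumes "open U" "x \<in> U"
  obtains \<rho> :: "'a \<Rightarrow> real" and K W where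
    "smooth_on UNIV \<rho>" "\<And>y. 0 \<le> \<rho> y" "\<And>y. \<rho> y \<le> 1"
    "open W" "x \<in> W" "W \<subseteq> U" "\<And>y. y \<in> W \<Longrightarrow> \<rho> y = 1"
    "closed K" "K \<subseteq> U" "\<And>y. y \<notin> K \<Longrightarrow> \<rho> y = 0"
proof -
  obtain r where r: "r > 0" "cball x r \<subseteq> U"
    using assms open_contains_cball by metis
  define a where "a y = r\<^sup>2 - (y - x) \<bullet> (y - x)" for y
  define b where "b y = (y - x) \<bullet> (y - x) - (r/2)\<^sup>2" for y
  define \<rho> where "\<rho> y = flat_exp 0 (a y) / (flat_exp 0 (a y) + flat_exp 0 (b y))" for y
  have nonneg: "0 \<le> flat_exp 0 t" for t by (simp add: flat_exp_def)
  have pos: "0 < flat_exp 0 t" if "t > 0" for t using that by (simp add: flat_exp_def)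
  have zero: "flat_exp 0 t = 0" if "t \<le> 0" for t using that by (simp add: flat_exp_def)
  have ab: "a y > 0 \<or> b y > 0" for y
  proof -
    have "(r/2)\<^sup>2 < r\<^sup>2" using r(1) by (intro power_strict_mono) auto
    then show ?thesis by (auto simp: a_def b_def)
  qed
  have den: "flat_exp 0 (a y) + flat_exp 0 (b y) > 0" for y
    using ab[of y] nonneg pos by (meson add_nonneg_pos add_pos_nonneg)
  have sa: "smooth_on UNIV a" "smooth_on UNIV b"
    unfolding a_def b_def by (intro smooth_intros; simp)+
  have "smooth_on UNIV \<rho>"
    unfolding \<rho>_def using den
    by (intro smooth_on_divide smooth_on_add smooth_on_compose_UNIV[OF smooth_flat_exp] sa) (auto simp: less_imp_neq[symmetric])
  moreover have "0 \<le> \<rho> y" "\<rho> y \<le> 1" for y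
    unfolding \<rho>_def using den[of y] nonneg by (auto simp: divide_le_eq_1_pos)
  moreover have "\<rho> y = 1" if "y \<in> ball x (r/2)" for y
  proof -
    have "norm (y - x) < r/2" using that by (simp add: dist_norm norm_minus_commute)
    then have "(norm (y - x))\<^sup>2 < (r/2)\<^sup>2" by (intro power_strict_mono) auto
    then have "b y \<le> 0" by (simp add: b_def power2_norm_eq_inner)
    then show ?thesis using den[of y] zero by (simp add: \<rho>_def)
  qed
  moreover have "\<rho> y = 0" if "y \<notin> cball x r" for y
  proof -
    have "r \<le> norm (y - x)" using that by (simp add: dist_norm norm_minus_commute)
    then have "r\<^sup>2 \<le> (norm (y - x))\<^sup>2" using r(1) by (intro power_mono) auto
    then have "a y \<le> 0" by (simp add: a_def power2_norm_eq_inner)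
    then show ?thesis using zero by (simp add: \<rho>_def)
  qed
  moreover have "ball x (r/2) \<subseteq> U" using r by (auto intro!: subsetD[OF r(2)])
  ultimately show thesis
    using that[of \<rho> "ball x (r/2)" "cball x r"] r by auto
qed

text \<open>Off \<open>K\<close> the product is zero whatever values \<open>h\<close> takes there, and the complement of \<open>K\<close> together with
  \<open>U\<close> covers the space. This turns local formulas, such as quotients, into global smooth functions.\<close>

lemma smooth_on_cutoff:
  assumes "open U" "smooth_on U h" "smooth_on UNIV \<rho>" "closed K" "K \<subseteq> U" "\<And>y. y \<notin> K \<Longrightarrow> \<rho> y = 0"
  shows "smooth_on UNIV (\<lambda>x. \<rho> x *\<^sub>R h x)"
proof -
  have "smooth_on U (\<lambda>x. \<rho> x *\<^sub>R h x)"
    using assms by (intro smooth_on_scaleR smooth_on_mono[OF assms(3)]) auto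
  moreover have "smooth_on (- K) (\<lambda>x. \<rho> x *\<^sub>R h x)"
    using assms smooth_on_cong[of "- K" "\<lambda>x. \<rho> x *\<^sub>R h x" "\<lambda>_. 0"] smooth_on_const[of "- K" 0]
    by (simp add: open_Compl)
  ultimately have "smooth_on (U \<union> - K) (\<lambda>x. \<rho> x *\<^sub>R h x)"
    using assms by (intro smooth_on_Un) auto
  moreover have "U \<union> - K = UNIV" using assms(5) by auto
  ultimately show ?thesis by simp
qed

section \<open>Second derivatives\<close>

lemma has_derivative_along_line:
  assumes "(f has_derivative f') (at (a + s *\<^sub>R v))"
  shows "((\<lambda>s. f (a + s *\<^sub>R v)) has_vector_derivative f' v) (at s)"
proof -
  have "((\<lambda>s. a + s *\<^sub>R v) has_derivative (\<lambda>h. h *\<^sub>R v)) (at s)"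
    by (auto intro!: derivative_eq_intros)
  from has_derivative_compose[OF this, of f f'] assms
  have "((\<lambda>s. f (a + s *\<^sub>R v)) has_derivative (\<lambda>h. f' (h *\<^sub>R v))) (at s)" by simp
  moreover have "linear f'" using assms by (rule has_derivative_linear)
  ultimately show ?thesis by (simp add: has_vector_derivative_def linear_scale)
qed

lemma smooth_on_derivative_along_line:
  fixes f :: "'a::real_normed_vector \<Rightarrow> real"
  assumes "smooth_on S f" "a + s *\<^sub>R v \<in> S"
  shows "((\<lambda>s. f (a + s *\<^sub>R v)) has_real_derivative dderiv f v (a + s *\<^sub>R v)) (at s)"
  using has_derivative_along_line[OF smooth_on_has_derivative[OF assms]]
  by (simp add: has_real_derivative_iff_has_vector_derivative)

lemma dderiv_linear:
  "smooth_on S f \<Longrightarrow> x \<in> S \<Longrightarrow> linear (frechet_derivative f (at x))"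
  using smooth_on_has_derivative has_derivative_linear by blast

text \<open>The mean value theorem is applied twice, first in the direction \<open>v\<close> and then in the direction \<open>w\<close>. The
  left-hand side is symmetric in \<open>v\<close> and \<open>w\<close>, whereas the order of differentiation on the right is not.\<close>

lemma second_difference_eq:
  fixes f :: "'a::real_normed_vector \<Rightarrow> real"
  assumes f: "smooth_on S f" and t: "t > 0"
    and S: "\<And>s r. 0 \<le> s \<Longrightarrow> s \<le> t \<Longrightarrow> 0 \<le> r \<Longrightarrow> r \<le> t \<Longrightarrow> x + s *\<^sub>R v + r *\<^sub>R w \<in> S"
  obtains s r where "0 < s" "s < t" "0 < r" "r < t"
    "f (x + t *\<^sub>R v + t *\<^sub>R w) - f (x + t *\<^sub>R v) - f (x + t *\<^sub>R w) + f x
      = t * t * D2 f (x + s *\<^sub>R v + r *\<^sub>R w) v w"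
proof -
  let ?\<phi> = "\<lambda>s. f (x + t *\<^sub>R w + s *\<^sub>R v) - f (x + s *\<^sub>R v)"
  have "(?\<phi> has_real_derivative dderiv f v (x + t *\<^sub>R w + s *\<^sub>R v) - dderiv f v (x + s *\<^sub>R v)) (at s)"
    if "0 \<le> s" "s \<le> t" for s
    using S[OF that, of t] S[OF that, of 0] t
    by (intro DERIV_diff smooth_on_derivative_along_line[OF f]) (auto simp: algebra_simps)
  from MVT2[OF t this] obtain s where s: "0 < s" "s < t"
    "?\<phi> t - ?\<phi> 0 = (t - 0) * (dderiv f v (x + t *\<^sub>R w + s *\<^sub>R v) - dderiv f v (x + s *\<^sub>R v))" by blast
  let ?\<psi> = "\<lambda>r. dderiv f v (x + s *\<^sub>R v + r *\<^sub>R w)"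
  have "(?\<psi> has_real_derivative D2 f (x + s *\<^sub>R v + r *\<^sub>R w) v w) (at r)" if "0 \<le> r" "r \<le> t" for r
    unfolding D2_def using S[of s r] that s
    by (intro smooth_on_derivative_along_line[OF smooth_on_dderiv[OF f]]) auto
  from MVT2[OF t this] obtain r where r: "0 < r" "r < t"
    "?\<psi> t - ?\<psi> 0 = (t - 0) * D2 f (x + s *\<^sub>R v + r *\<^sub>R w) v w" by blast
  show thesis
    by (rule that[OF s(1,2) r(1,2)]) (use s(3) r(3) in \<open>simp add: algebra_simps\<close>)
qed

text \<open>For small \<open>t\<close> the same second difference is \<open>t\<^sup>2\<close> times each of the two mixed derivatives, evaluated at
  points close to \<open>x\<close>; continuity of both rules out different values at \<open>x\<close>.\<close>

lemma D2_symmetric: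
  fixes f :: "'a::real_normed_vector \<Rightarrow> real"
  assumes S: "open S" and f: "smooth_on S f" and x: "x \<in> S"
  shows "D2 f x v w = D2 f x w v"
proof (rule ccontr)
  assume ne: "D2 f x v w \<noteq> D2 f x w v"
  define e where "e = \<bar>D2 f x v w - D2 f x w v\<bar> / 2"
  have e: "e > 0" using ne by (simp add: e_def)
  have c: "isCont (\<lambda>y. D2 f y v w) x" for v w
    unfolding D2_def using smooth_on_imp_continuous_on[OF smooth_on_dderiv[OF smooth_on_dderiv[OF f]]] S x
    by (simp add: continuous_on_eq_continuous_at)
  obtain d1 where d1: "d1 > 0" "\<And>y. dist y x < d1 \<Longrightarrow> dist (D2 f y v w) (D2 f x v w) < e"
    using c[of v w] e unfolding continuous_at_eps_delta by metis
  obtain d2 where d2: "d2 > 0" "\<And>y. dist y x < d2 \<Longrightarrow> dist (D2 f y w v) (D2 f x w v) < e"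
    using c[of w v] e unfolding continuous_at_eps_delta by metis
  obtain d3 where d3: "d3 > 0" "ball x d3 \<subseteq> S" using S x open_contains_ball by metis
  define d where "d = min d1 (min d2 d3)"
  \<comment> \<open>The summand 1 keeps the denominator of \<open>t\<close> positive even if both directions are zero.\<close>
  define N where "N = norm v + norm w + 1"
  define t where "t = d / (2 * N)"
  have d: "d > 0" using d1 d2 d3 by (simp add: d_def)
  have nn: "N > 0" by (simp add: N_def add_nonneg_pos)
  have t: "t > 0" using d nn by (simp add: t_def)
  have near: "dist (x + s *\<^sub>R v + r *\<^sub>R w) x < d" if "0 \<le> s" "s \<le> t" "0 \<le> r" "r \<le> t" for s r
  proof -
    have "norm (s *\<^sub>R v + r *\<^sub>R w) \<le> s * norm v + r * norm w"
      using that by (metis abs_of_nonneg norm_scaleR norm_triangle_ineq)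
    also have "\<dots> \<le> t * norm v + t * norm w" using that by (intro add_mono mult_right_mono) auto
    also have "\<dots> \<le> t * N" using t by (simp add: N_def algebra_simps)
    also have "\<dots> = d / 2" using nn by (simp add: t_def)
    also have "\<dots> < d" using d by simp
    finally show ?thesis by (simp add: dist_norm add.assoc)
  qed
  have inS: "y \<in> S" if "dist y x < d" for y
    using that d3 by (auto simp: d_def dist_commute)
  obtain s r where sr: "0 < s" "s < t" "0 < r" "r < t"
    "f (x + t *\<^sub>R v + t *\<^sub>R w) - f (x + t *\<^sub>R v) - f (x + t *\<^sub>R w) + f x
      = t * t * D2 f (x + s *\<^sub>R v + r *\<^sub>R w) v w"
    using second_difference_eq[OF f t, of x v w] inS near by metis
  have near': "dist (x + s *\<^sub>R w + r *\<^sub>R v) x < d" if "0 \<le> s" "s \<le> t" "0 \<le> r" "r \<le> t" for s r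
    using near[of r s] that by (simp add: add_ac)
  obtain s' r' where sr': "0 < s'" "s' < t" "0 < r'" "r' < t"
    "f (x + t *\<^sub>R w + t *\<^sub>R v) - f (x + t *\<^sub>R w) - f (x + t *\<^sub>R v) + f x
      = t * t * D2 f (x + s' *\<^sub>R w + r' *\<^sub>R v) w v"
    using second_difference_eq[OF f t, of x w v] inS near' by metis
  have "t * t * D2 f (x + s *\<^sub>R v + r *\<^sub>R w) v w = t * t * D2 f (x + s' *\<^sub>R w + r' *\<^sub>R v) w v"
    using sr(5) sr'(5) add.assoc[of x "t *\<^sub>R v" "t *\<^sub>R w"] add.assoc[of x "t *\<^sub>R w" "t *\<^sub>R v"]
      add.commute[of "t *\<^sub>R v" "t *\<^sub>R w"] by (smt (verit))
  then have eq: "D2 f (x + s *\<^sub>R v + r *\<^sub>R w) v w = D2 f (x + s' *\<^sub>R w + r' *\<^sub>R v) w v"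
    using t by simp
  have "dist (D2 f (x + s *\<^sub>R v + r *\<^sub>R w) v w) (D2 f x v w) < e"
    using near[of s r] sr by (intro d1(2)) (auto simp: d_def)
  moreover have "dist (D2 f (x + s' *\<^sub>R w + r' *\<^sub>R v) w v) (D2 f x w v) < e"
    using near'[of s' r'] sr' by (intro d2(2)) (auto simp: d_def)
  ultimately show False using eq by (auto simp: e_def dist_real_def abs_if split: if_splits)
qed

lemma D2_linear_right:
  "smooth_on S f \<Longrightarrow> x \<in> S \<Longrightarrow> linear (D2 f x v)"
proof -
  assume "smooth_on S f" "x \<in> S"
  then have "linear (frechet_derivative (\<lambda>y. dderiv f v y) (at x))"
    by (intro dderiv_linear[OF smooth_on_dderiv])
  moreover have "frechet_derivative (\<lambda>y. dderiv f v y) (at x) = D2 f x v"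
    by (rule ext) (simp add: D2_def)
  ultimately show ?thesis by (simp only:)
qed

lemma D2_linear_left:
  fixes f :: "'a::real_normed_vector \<Rightarrow> real"
  assumes "open S" "smooth_on S f" "x \<in> S" shows "linear (\<lambda>v. D2 f x v w)"
proof -
  have "(\<lambda>v. D2 f x v w) = D2 f x w" by (rule ext) (rule D2_symmetric[OF assms])
  then show ?thesis using D2_linear_right[OF assms(2,3), of w] by (simp only:)
qed

text \<open>The constant is the minimum on the unit sphere, which is compact.\<close>

lemma positive_quadratic_lower_bound:
  fixes Q :: "'a::euclidean_space \<Rightarrow> real"
  assumes "continuous_on UNIV Q" and hom: "\<And>c v. Q (c *\<^sub>R v) = c\<^sup>2 * Q v" and pos: "\<And>v. v \<noteq> 0 \<Longrightarrow> Q v > 0"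
  obtains \<kappa> where "\<kappa> > 0" "\<And>v. \<kappa> * (norm v)\<^sup>2 \<le> Q v"
proof -
  obtain b :: 'a where b: "b \<in> Basis" using nonempty_Basis by blast
  have "compact (sphere (0::'a) 1)" "sphere (0::'a) 1 \<noteq> {}" using b by (auto intro: exI[of _ b])
  then obtain u where u: "u \<in> sphere 0 1" "\<And>v. v \<in> sphere 0 1 \<Longrightarrow> Q u \<le> Q v"
    using continuous_attains_inf[of "sphere 0 1" Q] continuous_on_subset[OF assms(1)] by blast
  have "Q u * (norm v)\<^sup>2 \<le> Q v" for v
  proof (cases "v = 0")
    case True
    then show ?thesis using hom[of 0 0] by simp
  next
    case False
    then have "Q u \<le> Q ((1 / norm v) *\<^sub>R v)" by (intro u(2)) auto
    then show ?thesis using False by (simp add: hom power_divide field_simps)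
  qed
  moreover have "Q u > 0" using u(1) by (intro pos) auto
  ultimately show thesis using that by blast
qed

lemma D2_expand:
  fixes f :: "'a::euclidean_space \<Rightarrow> real"
  assumes "open S" "smooth_on S f" "x \<in> S"
  shows "D2 f x v w = (\<Sum>i\<in>Basis. \<Sum>j\<in>Basis. (v \<bullet> i) * (w \<bullet> j) * D2 f x i j)"
proof -
  note l = D2_linear_left[OF assms] and r = D2_linear_right[OF assms(2,3)]
  have "D2 f x v w = D2 f x (\<Sum>i\<in>Basis. (v \<bullet> i) *\<^sub>R i) (\<Sum>j\<in>Basis. (w \<bullet> j) *\<^sub>R j)"
    by (simp add: euclidean_representation)
  also have "\<dots> = (\<Sum>i\<in>Basis. (v \<bullet> i) * D2 f x i (\<Sum>j\<in>Basis. (w \<bullet> j) *\<^sub>R j))"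
    by (subst linear_sum[OF l]) (simp add: linear_scale[OF l])
  also have "\<dots> = (\<Sum>i\<in>Basis. \<Sum>j\<in>Basis. (v \<bullet> i) * (w \<bullet> j) * D2 f x i j)"
    by (simp add: linear_sum[OF r] linear_scale[OF r] sum_distrib_left mult_ac)
  finally show ?thesis .
qed

lemma local_min_first_order:
  fixes f :: "'a::real_normed_vector \<Rightarrow> real"
  assumes "smooth_on S f" "x \<in> S" "\<forall>\<^sub>F y in nhds x. f x \<le> f y"
  shows "dderiv f v x = 0"
proof -
  obtain T where "open T" "x \<in> T" "\<forall>y\<in>T. f x \<le> f y" using assms(3) eventually_nhds by metis
  then have "frechet_derivative f (at x) = (\<lambda>v. 0)"
    using differential_zero_maxmin[OF _ _ smooth_on_has_derivative[OF assms(1,2)]] by blast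
  then show ?thesis by simp
qed

text \<open>A negative second derivative would make the first derivative along the line negative shortly after
  \<open>x\<close>, and the function would fall below its value at \<open>x\<close>.\<close>

lemma local_min_second_order:
  fixes f :: "'a::real_normed_vector \<Rightarrow> real"
  assumes f: "smooth_on UNIV f" and min: "\<forall>\<^sub>F y in nhds x. f x \<le> f y"
  shows "0 \<le> D2 f x v v"
proof (rule ccontr)
  assume neg: "\<not> 0 \<le> D2 f x v v"
  let ?\<phi> = "\<lambda>t. f (x + t *\<^sub>R v)" and ?\<psi> = "\<lambda>t. dderiv f v (x + t *\<^sub>R v)"
  have d1: "(?\<phi> has_real_derivative ?\<psi> t) (at t)" for t
    by (rule smooth_on_derivative_along_line[OF f]) simp
  have "(?\<psi> has_real_derivative D2 f x v v) (at 0)"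
    using smooth_on_derivative_along_line[OF smooth_on_dderiv[OF f], of x 0 v v] by (simp add: D2_def)
  then obtain d where d: "d > 0" "\<And>h. 0 < h \<Longrightarrow> h < d \<Longrightarrow> ?\<psi> h < ?\<psi> 0"
    using DERIV_neg_dec_right[of ?\<psi> "D2 f x v v" 0] neg by auto
  have "?\<psi> 0 = 0" using local_min_first_order[OF f _ min] by simp
  obtain T where T: "open T" "x \<in> T" "\<forall>y\<in>T. f x \<le> f y" using min eventually_nhds by metis
  obtain r where r: "r > 0" "ball x r \<subseteq> T" using T open_contains_ball by metis
  define N where "N = norm v + 1"
  define h where "h = min (d / 2) (r / (2 * N))"
  have nn: "N > 0" by (simp add: N_def add_nonneg_pos)
  have h: "0 < h" "h < d" using d r nn by (auto simp: h_def)
  have "h * norm v \<le> h * N" using h by (simp add: N_def)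
  also have "\<dots> \<le> r / (2 * N) * N"
    using nn by (intro mult_right_mono) (auto simp: h_def)
  also have "\<dots> < r" using r(1) nn by simp
  finally have "x + h *\<^sub>R v \<in> ball x r" using h by (simp add: dist_norm)
  then have "f x \<le> ?\<phi> h" using T r by blast
  moreover obtain z where "0 < z" "z < h" "?\<phi> h - ?\<phi> 0 = (h - 0) * ?\<psi> z"
    using MVT2[OF h(1), of ?\<phi> ?\<psi>] d1 by blast
  moreover have "?\<psi> z < 0" using d(2)[of z] h \<open>?\<psi> 0 = 0\<close> \<open>0 < z\<close> \<open>z < h\<close> by simp
  ultimately show False using h(1) by (simp add: mult_pos_neg) (smt (verit) mult_pos_neg)
qed

text \<open>A positive definite second derivative stays positive semidefinite at all nearby points, uniformly in the
  direction, so the derivative along every segment that starts at \<open>x\<close> is nondecreasing.\<close>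

lemma second_order_sufficient:
  fixes f :: "'a::euclidean_space \<Rightarrow> real"
  assumes f: "smooth_on UNIV f" and d0: "\<And>v. dderiv f v x = 0"
    and pos: "\<And>v. v \<noteq> 0 \<Longrightarrow> D2 f x v v > 0"
  shows "\<forall>\<^sub>F y in nhds x. f x \<le> f y"
proof -
  note ex = D2_expand[OF open_UNIV f UNIV_I]
  have "continuous_on UNIV (\<lambda>v. \<Sum>i\<in>Basis. \<Sum>j\<in>Basis. (v \<bullet> i) * (v \<bullet> j) * D2 f x i j)"
    by (intro continuous_intros)
  then have "continuous_on UNIV (\<lambda>v. D2 f x v v)"
    by (simp flip: ex)
  moreover have "D2 f x (c *\<^sub>R v) (c *\<^sub>R v) = c\<^sup>2 * D2 f x v v" for c v
    by (simp add: linear_scale[OF D2_linear_left[OF open_UNIV f UNIV_I]]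
        linear_scale[OF D2_linear_right[OF f UNIV_I]] power2_eq_square)
  ultimately obtain \<kappa> where \<kappa>: "\<kappa> > 0" "\<And>v. \<kappa> * (norm v)\<^sup>2 \<le> D2 f x v v"
    using positive_quadratic_lower_bound[of "\<lambda>v. D2 f x v v"] pos by blast
  let ?E = "\<lambda>y. \<Sum>i\<in>Basis. \<Sum>j\<in>Basis. \<bar>D2 f y i j - D2 f x i j\<bar>"
  have "continuous_on UNIV ?E"
    unfolding D2_def using smooth_on_imp_continuous_on[OF smooth_on_dderiv[OF smooth_on_dderiv[OF f]]]
    by (intro continuous_intros) auto
  then have "isCont ?E x" by (simp add: continuous_on_eq_continuous_at)
  then obtain d where d: "d > 0" "\<And>y. dist y x < d \<Longrightarrow> dist (?E y) (?E x) < \<kappa>"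
    using continuous_at_eps_delta[THEN iffD1, OF \<open>isCont ?E x\<close>, rule_format, OF \<kappa>(1)] by blast
  have nonneg: "0 \<le> D2 f y v v" if y: "dist y x < d" for y v
  proof -
    have "D2 f x v v - D2 f y v v = (\<Sum>i\<in>Basis. \<Sum>j\<in>Basis. (v \<bullet> i) * (v \<bullet> j) * (D2 f x i j - D2 f y i j))"
      by (subst ex[of x v v], subst ex[of y v v]) (simp add: sum_subtractf right_diff_distrib)
    also have "\<dots> \<le> (\<Sum>i\<in>Basis. \<Sum>j\<in>Basis. (norm v)\<^sup>2 * \<bar>D2 f y i j - D2 f x i j\<bar>)"
    proof (intro sum_mono)
      fix i j :: 'a assume ij: "i \<in> Basis" "j \<in> Basis"
      have "\<bar>(v \<bullet> i) * (v \<bullet> j)\<bar> \<le> norm v * norm v"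
        unfolding abs_mult using ij by (intro mult_mono Basis_le_norm) auto
      then have "\<bar>(v \<bullet> i) * (v \<bullet> j)\<bar> * \<bar>D2 f x i j - D2 f y i j\<bar> \<le> (norm v)\<^sup>2 * \<bar>D2 f x i j - D2 f y i j\<bar>"
        by (intro mult_right_mono) (auto simp: power2_eq_square)
      then show "(v \<bullet> i) * (v \<bullet> j) * (D2 f x i j - D2 f y i j) \<le> (norm v)\<^sup>2 * \<bar>D2 f y i j - D2 f x i j\<bar>"
        using abs_ge_self[of "(v \<bullet> i) * (v \<bullet> j) * (D2 f x i j - D2 f y i j)"]
          abs_minus_commute[of "D2 f x i j" "D2 f y i j"]
        unfolding abs_mult[of "(v \<bullet> i) * (v \<bullet> j)"] by simp
    qed
    also have "\<dots> = (norm v)\<^sup>2 * ?E y" by (simp add: sum_distrib_left)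
    also have "\<dots> \<le> (norm v)\<^sup>2 * \<kappa>"
      using d(2)[OF y] by (intro mult_left_mono) (auto simp: dist_real_def)
    finally show ?thesis using \<kappa>(2)[of v] by (simp add: mult.commute)
  qed
  have "f x \<le> f y" if "dist y x < d" for y
  proof -
    let ?v = "y - x"
    let ?\<phi> = "\<lambda>t. f (x + t *\<^sub>R ?v)" and ?\<psi> = "\<lambda>t. dderiv f ?v (x + t *\<^sub>R ?v)"
    have "dist (x + t *\<^sub>R ?v) x < d" if "0 \<le> t" "t \<le> 1" for t
    proof -
      have "t * norm ?v \<le> 1 * norm ?v" using that by (intro mult_right_mono) auto
      then show ?thesis using \<open>dist y x < d\<close> that by (simp add: dist_norm)
    qed
    then have nn: "0 \<le> D2 f (x + t *\<^sub>R ?v) ?v ?v" if "0 \<le> t" "t \<le> 1" for t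
      using nonneg that by blast
    have "0 \<le> ?\<psi> t" if t: "0 \<le> t" "t \<le> 1" for t
    proof -
      have "?\<psi> 0 \<le> ?\<psi> t"
        using DERIV_nonneg_imp_nondecreasing[OF t(1), of ?\<psi>] t nn
          smooth_on_derivative_along_line[OF smooth_on_dderiv[OF f] UNIV_I, folded D2_def, where a = x and v = ?v]
        by (meson order_trans)
      then show ?thesis using d0 by simp
    qed
    then have "?\<phi> 0 \<le> ?\<phi> 1"
      using DERIV_nonneg_imp_nondecreasing[of 0 1 ?\<phi>]
        smooth_on_derivative_along_line[OF f UNIV_I, where a = x and v = ?v] by (meson zero_le_one)
    then show ?thesis by simp
  qed
  then show ?thesis using d(1) eventually_nhds_metric by blast
qed

section \<open>Integration along a constant vector field\<close>

text \<open>The weight \<open>h\<close> serves the induction: differentiating under the integral in the direction \<open>v\<close> yields the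
  derivatives of \<open>f\<close> in the directions \<open>v\<close> and \<open>L v\<close>, the latter with the additional weight \<open>s - 1\<close>.\<close>

lemma C_k_on_weighted_line_integral:
  fixes f :: "'a::euclidean_space \<Rightarrow> real" and L :: "'a \<Rightarrow> 'a"
  assumes L: "bounded_linear L"
  shows "C_k_on k UNIV f \<Longrightarrow> continuous_on UNIV h \<Longrightarrow>
    C_k_on k UNIV (\<lambda>q. integral {0..1} (\<lambda>s. h s * f (q + (s - 1) *\<^sub>R L q)))"
proof (induction k arbitrary: f h)
  case 0
  have "continuous_on (UNIV \<times> cbox 0 1) (\<lambda>(q, s). h s * f (q + (s - 1) *\<^sub>R L q))"
    using 0 by (auto simp: split_beta intro!: continuous_intros continuous_on_compose2[of UNIV f]
        continuous_on_compose2[of UNIV h] bounded_linear.continuous_on[OF L])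
  from integral_continuous_on_param[OF this] show ?case by simp
next
  case (Suc k)
  note df = C_k_on_SucD(1)[OF Suc.prems(1) UNIV_I]
  have lin: "linear (frechet_derivative f (at x))" for x
    using df by (rule has_derivative_linear)
  have cdf: "continuous_on UNIV (\<lambda>x. dderiv f v x)" for v
    using C_k_on_imp_continuous_on[OF C_k_on_SucD(2)[OF Suc.prems(1)]] .
  let ?A = "\<lambda>q s. q + (s - 1) *\<^sub>R L q"
  have linL: "linear L" using L by (rule bounded_linear.linear)
  let ?D = "\<lambda>q s v. h s * dderiv f (?A v s) (?A q s)"
  have blD: "bounded_linear (?D q s)" for q s
    using bounded_linear_const_mult[OF bounded_linear_compose[OF has_derivative_bounded_linear[OF df]
          bounded_linear_add[OF bounded_linear_ident bounded_linear_scaleR_right[THEN bounded_linear_compose, OF L]]]]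
    by simp
  have split: "?D q s v = h s * dderiv f v (?A q s) + h s * (s - 1) * dderiv f (L v) (?A q s)" for q s v
    by (subst linear_add[OF lin], subst linear_scale[OF lin]) (simp add: distrib_left)
  have contD: "continuous_on (U \<times> cbox 0 1) (\<lambda>(q, s). ?D q s v)" for U v
    unfolding split using Suc.prems(2)
    by (auto simp: split_beta intro!: continuous_intros continuous_on_compose2[OF cdf]
        continuous_on_compose2[of UNIV h] bounded_linear.continuous_on[OF L])
  have ch: "continuous_on T h" for T using Suc.prems(2) continuous_on_subset by blast
  have cA: "continuous_on T (\<lambda>s. g (?A q s))" if "continuous_on UNIV g" for T q and g :: "'a \<Rightarrow> real"
    by (rule continuous_on_compose2[OF that]) (auto intro!: continuous_intros)
  have contf: "continuous_on UNIV f" using C_k_on_imp_continuous_on[OF Suc.prems(1)] .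
  have der0: "((\<lambda>q. integral (cbox 0 1) (\<lambda>s. h s * f (?A q s))) has_derivative
      blinfun_apply (integral (cbox 0 1) (\<lambda>s. Blinfun (?D q s)))) (at q within UNIV)" for q
  proof (rule leibniz_rule[where fx = "\<lambda>q s. Blinfun (?D q s)"])
    fix q s
    show "((\<lambda>q. h s * f (?A q s)) has_derivative blinfun_apply (Blinfun (?D q s))) (at q within UNIV)"
      unfolding bounded_linear_Blinfun_apply[OF blD]
      by (intro has_derivative_mult_right has_derivative_compose[of _ _ _ _ f, OF _ df]
          has_derivative_add has_derivative_ident has_derivative_scaleR_right
          bounded_linear_imp_has_derivative[OF L])
  next
    fix q
    show "(\<lambda>s. h s * f (?A q s)) integrable_on cbox 0 1"
      by (intro integrable_continuous continuous_on_mult ch cA contf)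
  next
    show "continuous_on (UNIV \<times> cbox 0 1) (\<lambda>(q, s). Blinfun (?D q s))"
      using contD[of UNIV]
      by (intro continuous_on_blinfun_componentwise)
        (simp add: split_beta bounded_linear_Blinfun_apply[OF blD])
  qed auto
  have val: "blinfun_apply (integral (cbox 0 1) (\<lambda>s. Blinfun (?D q s))) v =
      integral {0..1} (\<lambda>s. h s * dderiv f v (?A q s)) + integral {0..1} (\<lambda>s. h s * (s - 1) * dderiv f (L v) (?A q s))" for q v
  proof -
    have "(\<lambda>s. Blinfun (?D q s)) integrable_on cbox 0 1"
    proof (intro integrable_continuous continuous_on_blinfun_componentwise)
      show "continuous_on (cbox 0 1) (\<lambda>s. blinfun_apply (Blinfun (?D q s)) v)" for v
        by (subst bounded_linear_Blinfun_apply[OF blD], subst split) (intro continuous_on_add continuous_on_mult ch cA cdf continuous_on_diff continuous_on_id continuous_on_const)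
    qed
    then have "blinfun_apply (integral (cbox 0 1) (\<lambda>s. Blinfun (?D q s))) v = integral {0..1} (\<lambda>s. ?D q s v)"
      by (simp add: blinfun_apply_integral bounded_linear_Blinfun_apply[OF blD])
    also have "\<dots> = integral {0..1} (\<lambda>s. h s * dderiv f v (?A q s)) + integral {0..1} (\<lambda>s. h s * (s - 1) * dderiv f (L v) (?A q s))"
      unfolding split
      by (intro integral_add integrable_continuous_real continuous_on_mult ch cA cdf continuous_on_diff
          continuous_on_id continuous_on_const)
    finally show ?thesis .
  qed
  have der: "((\<lambda>q. integral {0..1} (\<lambda>s. h s * f (?A q s))) has_derivative
     (\<lambda>v. integral {0..1} (\<lambda>s. h s * dderiv f v (?A q s)) + integral {0..1} (\<lambda>s. h s * (s - 1) * dderiv f (L v) (?A q s)))) (at q)" for q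
    by (rule has_derivative_eq_rhs[OF der0[of q, unfolded box_real]], rule ext, rule val[unfolded box_real])
  show ?case
  proof (rule C_k_on_SucI[OF open_UNIV der])
    show "C_k_on k UNIV (\<lambda>q. integral {0..1} (\<lambda>s. h s * dderiv f v (?A q s)) +
       integral {0..1} (\<lambda>s. h s * (s - 1) * dderiv f (L v) (?A q s)))" for v
      by (intro C_k_on_add open_UNIV Suc.IH C_k_on_SucD(2)[OF Suc.prems(1)] Suc.prems(2)
          continuous_on_mult continuous_on_diff continuous_on_id continuous_on_const)
  qed
qed

text \<open>The integral of \<open>f\<close> along the line through \<open>q\<close> in the direction \<open>w\<close>, starting at the hyperplane orthogonal
  to \<open>w\<close> and measured in units of \<open>w\<close>. The substitution to the fixed interval from 0 to 1 makes
  differentiation under the integral applicable.\<close>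

definition line_integral :: "'a::euclidean_space \<Rightarrow> ('a \<Rightarrow> real) \<Rightarrow> 'a \<Rightarrow> real" where
  "line_integral w f q = (let c = (q \<bullet> w) / (w \<bullet> w) in
     c * integral {0..1} (\<lambda>s. f (q + (s - 1) *\<^sub>R (c *\<^sub>R w))))"

lemma smooth_on_line_integral:
  assumes "smooth_on UNIV f" shows "smooth_on UNIV (line_integral w f)"
proof -
  have l: "bounded_linear (\<lambda>q. (q \<bullet> w) / (w \<bullet> w))"
    by (rule bounded_linear_compose[OF bounded_linear_divide bounded_linear_inner_left])
  then have L: "bounded_linear (\<lambda>q. ((q \<bullet> w) / (w \<bullet> w)) *\<^sub>R w)"
    by (rule bounded_linear_scaleR_const)
  have "smooth_on UNIV (\<lambda>q. integral {0..1} (\<lambda>s. f (q + (s - 1) *\<^sub>R (((q \<bullet> w) / (w \<bullet> w)) *\<^sub>R w))))"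
    using C_k_on_weighted_line_integral[OF L, of _ f "\<lambda>_. 1"] assms unfolding smooth_on_def by simp
  moreover have "smooth_on UNIV (\<lambda>q. (q \<bullet> w) / (w \<bullet> w))"
    by (rule smooth_on_bounded_linear[OF l open_UNIV smooth_on_ident[OF open_UNIV]])
  ultimately show ?thesis unfolding line_integral_def[abs_def] Let_def by (intro smooth_on_mult) auto
qed

lemma line_integral_transversal: "q \<bullet> w = 0 \<Longrightarrow> line_integral w f q = 0"
  by (simp add: line_integral_def)

text \<open>This solves a first-order linear partial differential equation with constant direction: on each line
  parallel to \<open>w\<close> it is the fundamental theorem of calculus.\<close>

lemma dderiv_line_integral:
  fixes f :: "'a::euclidean_space \<Rightarrow> real"
  assumes f: "smooth_on UNIV f" and w: "w \<noteq> 0"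
  shows "dderiv (line_integral w f) w q = f q"
proof -
  define c where "c = (q \<bullet> w) / (w \<bullet> w)"
  define F where "F \<sigma> = f (q + (\<sigma> - c) *\<^sub>R w)" for \<sigma>
  define a where "a = \<bar>c\<bar> + 1"
  have ww: "w \<bullet> w \<noteq> 0" using w by simp
  have cF: "continuous_on T F" for T
    unfolding F_def
    by (rule continuous_on_compose2[OF smooth_on_imp_continuous_on[OF f]]) (auto intro!: continuous_intros)
  obtain \<Phi> where \<Phi>: "\<And>x. x \<in> {-a..a} \<Longrightarrow> (\<Phi> has_vector_derivative F x) (at x within {-a..a})"
    using antiderivative_continuous[OF cF] by metis
  have eq: "line_integral w f (q + t *\<^sub>R w) = \<Phi> (c + t) - \<Phi> 0" if t: "\<bar>t\<bar> < 1" for t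
  proof -
    have c': "((q + t *\<^sub>R w) \<bullet> w) / (w \<bullet> w) = c + t"
      using ww by (simp add: c_def inner_add_left add_divide_distrib)
    have r: "s * (c + t) \<in> {-a..a}" if "s \<in> {0..1}" for s
    proof -
      have "\<bar>s * (c + t)\<bar> \<le> 1 * \<bar>c + t\<bar>" unfolding abs_mult using that by (intro mult_right_mono) auto
      also have "\<dots> \<le> a" using t by (simp add: a_def)
      finally show ?thesis by (simp add: abs_le_iff) 
    qed
    have sub: "(\<lambda>s. s * (c + t)) ` {0..1} \<subseteq> {-a..a}" using r by blast
    have "((\<lambda>s. (c + t) *\<^sub>R F (s * (c + t))) has_integral (\<Phi> \<circ> (\<lambda>s. s * (c + t))) 1 - (\<Phi> \<circ> (\<lambda>s. s * (c + t))) 0) {0..1}"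
    proof (rule fundamental_theorem_of_calculus)
      fix s :: real assume s: "s \<in> {0..1}"
      show "((\<Phi> \<circ> (\<lambda>s. s * (c + t))) has_vector_derivative (c + t) *\<^sub>R F (s * (c + t))) (at s within {0..1})"
        using has_vector_derivative_within_subset[OF \<Phi>[OF r[OF s]] sub]
        by (intro vector_diff_chain_within) (auto intro!: derivative_eq_intros)
    qed simp
    moreover have "F (s * (c + t)) = f (q + t *\<^sub>R w + (s - 1) *\<^sub>R ((c + t) *\<^sub>R w))" for s
      by (simp add: F_def algebra_simps)
    ultimately have "(c + t) * integral {0..1} (\<lambda>s. f (q + t *\<^sub>R w + (s - 1) *\<^sub>R ((c + t) *\<^sub>R w))) = \<Phi> (c + t) - \<Phi> 0"
      by (simp add: has_integral_iff)
    then show ?thesis unfolding line_integral_def c' Let_def by simp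
  qed
  have "{-a<..<a} \<subseteq> {-a..a}" by auto
  moreover have "c \<in> {-a<..<a}" by (auto simp: a_def)
  ultimately have "(\<Phi> has_real_derivative F c) (at c)"
    using \<Phi>[of c] has_vector_derivative_within_open[of c "{-a<..<a}" \<Phi>]
      has_vector_derivative_within_subset[of \<Phi> "F c" c "{-a..a}" "{-a<..<a}"]
    by (auto simp: has_real_derivative_iff_has_vector_derivative)
  then have "((\<lambda>t. \<Phi> (c + t) - \<Phi> 0) has_real_derivative F c) (at 0)"
    using DERIV_at_within_shift[of \<Phi> "F c" c 0 UNIV] by (auto intro!: derivative_eq_intros)
  then have "((\<lambda>t. line_integral w f (q + t *\<^sub>R w)) has_real_derivative F c) (at 0)"
    by (rule has_field_derivative_transform_within_open[of _ _ 0 "ball 0 1"]) (auto simp: eq)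
  moreover have "((\<lambda>t. line_integral w f (q + t *\<^sub>R w)) has_real_derivative dderiv (line_integral w f) w q) (at 0)"
    using smooth_on_derivative_along_line[OF smooth_on_line_integral[OF f], of q 0 w w] by simp
  ultimately have "dderiv (line_integral w f) w q = F c" by (rule DERIV_unique[symmetric])
  then show ?thesis by (simp add: F_def)
qed

section \<open>Ordinary differential equations and exponential stability\<close>

lemma solves_at:
  assumes "solves f x" "t > 0"
  shows "(x has_vector_derivative f (x t)) (at t)"
proof -
  have "(x has_vector_derivative f (x t)) (at t within {0..})"
    using assms by (simp add: solves_def)
  moreover have "{0..} \<inter> {0<..} - {t} = UNIV \<inter> {0<..} - {t}" by auto
  then have "at t within {0..} = at t"
    using assms(2) by (intro at_within_nhd[of t "{0<..}"]) auto
  ultimately show ?thesis by simp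
qed

lemma solves_continuous: "solves f x \<Longrightarrow> continuous_on {0..} x"
  unfolding solves_def by (intro continuous_on_vector_derivative) auto

text \<open>Functions weighted by \<open>exp (- 2 L t)\<close> turn the Picard operator into a contraction with factor \<open>1/2\<close> on
  the bounded continuous functions on the whole line. One application of Banach's fixed point theorem thus
  gives a solution for all nonnegative times at once; the operator reads negative times as time zero.\<close>

lemma bounded_lipschitz_has_solution:
  fixes f :: "'a::euclidean_space \<Rightarrow> 'a"
  assumes L: "L > 0" "\<And>u v. norm (f u - f v) \<le> L * norm (u - v)"
    and B: "\<And>u. norm (f u) \<le> B"
  obtains x where "solves f x" "x 0 = x0"
proof -
  have cf: "continuous_on UNIV f"
  proof (rule continuous_at_imp_continuous_on, rule ballI)
    fix x :: 'a
    have "((\<lambda>y. L * norm (y - x)) \<longlongrightarrow> 0) (at x)"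
      by (auto intro!: tendsto_eq_intros)
    then have "((\<lambda>y. f y - f x) \<longlongrightarrow> 0) (at x)"
      by (rule Lim_null_comparison[rotated]) (auto intro!: always_eventually L)
    then show "isCont f x" by (simp add: isCont_def LIM_zero_cancel)
  qed
  have B0: "B \<ge> 0" using B[of 0] norm_ge_zero order_trans by blast
  define g where "g y s = f (exp (2 * L * s) *\<^sub>R apply_bcontfun y s)" for y :: "real \<Rightarrow>\<^sub>C 'a" and s
  have cg: "continuous_on T (g y)" for y T
    unfolding g_def by (rule continuous_on_compose2[OF cf]) (auto intro!: continuous_intros)
  have ig: "g y integrable_on {0..t}" for y t
    by (intro integrable_continuous_real cg)
  define F where "F y t = exp (- 2 * L * max 0 t) *\<^sub>R (x0 + integral {0..max 0 t} (g y))" for y t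
  have expL: "t * exp (- 2 * L * t) \<le> 1 / (2 * L)" if "t \<ge> 0" for t
  proof -
    have "2 * L * t \<le> exp (2 * L * t)" using exp_ge_add_one_self[of "2 * L * t"] by linarith
    then show ?thesis using L(1) by (simp add: exp_minus field_simps)
  qed
  have Fb: "F y \<in> bcontfun" for y
  proof (rule bcontfun_normI)
    have c: "continuous_on {0..} (\<lambda>t. integral {0..t} (g y))"
    proof (rule continuous_on_vector_derivative)
      fix t :: real assume t: "t \<in> {0..}"
      have "((\<lambda>u. integral {0..u} (g y)) has_vector_derivative g y t) (at t within {0..t+1})"
        using t by (intro integral_has_vector_derivative cg) auto
      moreover have "at t within {0..t+1} = at t within {0..}"
        using t by (intro at_within_nhd[of _ "{..<t+1}"]) auto
      ultimately show "((\<lambda>u. integral {0..u} (g y)) has_vector_derivative g y t) (at t within {0..})" by simp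
    qed
    have "continuous_on UNIV (\<lambda>t. integral {0..max 0 t} (g y))"
      by (rule continuous_on_compose2[OF c]) (auto intro!: continuous_intros)
    then show "continuous_on UNIV (F y)" unfolding F_def by (intro continuous_intros)
    fix t :: real
    let ?t = "max 0 t"
    have "norm (integral {0..?t} (g y)) \<le> B * (?t - 0)"
      by (rule integral_bound[OF _ cg]) (auto simp: g_def intro!: B)
    then have "norm (F y t) \<le> exp (- 2 * L * ?t) * (norm x0 + B * ?t)"
      unfolding F_def norm_scaleR abs_exp_cancel
      by (intro mult_left_mono order_trans[OF norm_triangle_ineq]) auto
    also have "\<dots> = exp (- 2 * L * ?t) * norm x0 + B * (?t * exp (- 2 * L * ?t))"
      by (simp add: algebra_simps)
    also have "\<dots> \<le> 1 * norm x0 + B * (1 / (2 * L))"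
      using L(1) B0 expL[of ?t] by (intro add_mono mult_right_mono mult_left_mono) auto
    finally show "norm (F y t) \<le> 1 * norm x0 + B * (1 / (2 * L))" .
  qed
  define T where "T y = Bcontfun (F y)" for y
  have Tapp: "apply_bcontfun (T y) t = F y t" for y t
    unfolding T_def by (simp add: Bcontfun_inverse[OF Fb])
  have "dist (T y) (T z) \<le> 1/2 * dist y z" for y z
  proof (rule dist_bound)
    fix t :: real
    let ?t = "max 0 t"
    have E: "((\<lambda>s. dist y z * (L * exp (2 * L * s))) has_integral dist y z * (exp (2 * L * ?t) / 2 - exp (2 * L * 0) / 2)) {0..?t}"
      using L(1) by (intro has_integral_mult_right fundamental_theorem_of_calculus)
        (auto intro!: derivative_eq_intros simp flip: has_real_derivative_iff_has_vector_derivative)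
    have "norm (integral {0..?t} (g y) - integral {0..?t} (g z)) = norm (integral {0..?t} (\<lambda>s. g y s - g z s))"
      by (simp add: integral_diff ig)
    also have "\<dots> \<le> integral {0..?t} (\<lambda>s. dist y z * (L * exp (2 * L * s)))"
    proof (rule integral_norm_bound_integral)
      show "(\<lambda>s. g y s - g z s) integrable_on {0..?t}" by (intro integrable_diff ig)
      show "(\<lambda>s. dist y z * (L * exp (2 * L * s))) integrable_on {0..?t}" using E by blast
      fix s
      have "norm (g y s - g z s) \<le> L * norm (exp (2 * L * s) *\<^sub>R apply_bcontfun y s - exp (2 * L * s) *\<^sub>R apply_bcontfun z s)"
        unfolding g_def by (rule L(2))
      also have "\<dots> = L * (exp (2 * L * s) * dist (apply_bcontfun y s) (apply_bcontfun z s))"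
        by (simp add: dist_norm flip: scaleR_diff_right)
      also have "\<dots> \<le> L * (exp (2 * L * s) * dist y z)"
        using L(1) by (intro mult_left_mono dist_bounded) auto
      finally show "norm (g y s - g z s) \<le> dist y z * (L * exp (2 * L * s))" by (simp add: mult_ac)
    qed
    also have "\<dots> = dist y z * (exp (2 * L * ?t) / 2 - exp (2 * L * 0) / 2)" using E by blast
    also have "\<dots> \<le> dist y z * (exp (2 * L * ?t) / 2)" by (intro mult_left_mono) auto
    finally have *: "norm (integral {0..?t} (g y) - integral {0..?t} (g z)) \<le> dist y z * (exp (2 * L * ?t) / 2)" .
    have "dist (F y t) (F z t) = exp (- 2 * L * ?t) * norm (integral {0..?t} (g y) - integral {0..?t} (g z))"
      unfolding F_def dist_norm by (simp flip: scaleR_diff_right)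
    also have "\<dots> \<le> exp (- 2 * L * ?t) * (dist y z * (exp (2 * L * ?t) / 2))"
      by (intro mult_left_mono *) auto
    also have "\<dots> = 1/2 * dist y z" by (simp add: exp_minus)
    finally show "dist (apply_bcontfun (T y) t) (apply_bcontfun (T z) t) \<le> 1/2 * dist y z" by (simp add: Tapp)
  qed
  then obtain y where y: "T y = y" using banach_fix_type[of "1/2" T] by auto
  define x where "x t = x0 + integral {0..t} (g y)" for t
  have x: "x t = exp (2 * L * t) *\<^sub>R apply_bcontfun y t" if "t \<ge> 0" for t
  proof -
    have "apply_bcontfun y t = F y t" using Tapp[of y t] y by simp
    then show ?thesis using that by (simp add: F_def x_def max_absorb2 exp_minus)
  qed
  have "solves f x"
    unfolding solves_def
  proof (intro allI impI)
    fix t :: real assume t: "t \<ge> 0"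
    have "((\<lambda>u. integral {0..u} (g y)) has_vector_derivative g y t) (at t within {0..t+1})"
      using t by (intro integral_has_vector_derivative cg) auto
    moreover have "at t within {0..t+1} = at t within {0..}"
      using t by (intro at_within_nhd[of _ "{..<t+1}"]) auto
    moreover have "g y t = f (x t)" using x[OF t] by (simp add: g_def)
    ultimately show "(x has_vector_derivative f (x t)) (at t within {0..})"
      unfolding x_def by (auto intro!: derivative_eq_intros)
  qed
  moreover have "x 0 = x0" by (simp add: x_def)
  ultimately show thesis using that by blast
qed

lemma smooth_on_imp_lipschitz_on_cball:
  fixes f :: "'a::euclidean_space \<Rightarrow> 'b::real_normed_vector"
  assumes f: "smooth_on UNIV f"
  obtains L where "L > 0" "\<And>x y. x \<in> cball 0 r \<Longrightarrow> y \<in> cball 0 r \<Longrightarrow> norm (f x - f y) \<le> L * norm (x - y)"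
proof -
  let ?S = "\<lambda>x. \<Sum>b\<in>Basis. norm (dderiv f b x)"
  have "continuous_on (cball 0 r) ?S"
    using smooth_on_imp_continuous_on[OF smooth_on_dderiv[OF f]]
    by (intro continuous_on_sum continuous_on_norm) (auto intro: continuous_on_subset)
  then have "compact (?S ` cball 0 r)" by (intro compact_continuous_image) auto
  then have "bounded (?S ` cball 0 r)" by (rule compact_imp_bounded)
  then obtain L where L0: "L > 0" "\<forall>s \<in> ?S ` cball 0 r. norm s \<le> L"
    unfolding bounded_pos by blast
  then have L: "?S x \<le> L" if "x \<in> cball 0 r" for x
    using L0(2)[rule_format, OF imageI[OF that]] abs_ge_self order_trans unfolding real_norm_def by blast
  have "norm (f x - f y) \<le> L * norm (x - y)" if xy: "x \<in> cball 0 r" "y \<in> cball 0 r" for x y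
  proof (rule differentiable_bound[OF convex_cball _ _ xy, of f "\<lambda>x. frechet_derivative f (at x)"])
    fix x :: 'a assume x: "x \<in> cball 0 r"
    have d: "(f has_derivative frechet_derivative f (at x)) (at x)"
      using smooth_on_has_derivative[OF f] by simp
    then show "(f has_derivative frechet_derivative f (at x)) (at x within cball 0 r)"
      by (rule has_derivative_at_withinI)
    have lin: "linear (frechet_derivative f (at x))" using d by (rule has_derivative_linear)
    show "onorm (frechet_derivative f (at x)) \<le> L"
    proof (rule onorm_le)
      fix v
      have "dderiv f v x = dderiv f (\<Sum>b\<in>Basis. (v \<bullet> b) *\<^sub>R b) x" by (simp add: euclidean_representation)
      also have "\<dots> = (\<Sum>b\<in>Basis. (v \<bullet> b) *\<^sub>R dderiv f b x)"
        by (simp add: linear_sum[OF lin] linear_scale[OF lin])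
      also have "norm \<dots> \<le> (\<Sum>b\<in>Basis. norm v * norm (dderiv f b x))"
        by (intro sum_norm_le) (auto intro!: mult_right_mono Basis_le_norm)
      also have "\<dots> = norm v * ?S x" by (simp add: sum_distrib_left)
      also have "\<dots> \<le> norm v * L" using L[OF x] by (intro mult_left_mono) auto
      finally show "norm (dderiv f v x) \<le> L * norm v" by (simp add: mult.commute)
    qed
  qed
  then show thesis using that L0(1) by blast
qed

lemma derivative_bilinear_along_solution:
  assumes W: "bilinear (W :: 'a::euclidean_space \<Rightarrow> 'a \<Rightarrow> real)" and sym: "\<And>x y. W x y = W y x"
    and x: "(x has_vector_derivative v) (at t)"
  shows "((\<lambda>t. W (x t) (x t)) has_real_derivative 2 * W (x t) v) (at t)"
proof -
  have bb: "bounded_bilinear W" using W bilinear_conv_bounded_bilinear by blast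
  have "((\<lambda>t. W (x t) (x t)) has_vector_derivative W (x t) v + W v (x t)) (at t)"
    by (rule bounded_bilinear.has_vector_derivative[OF bb x x])
  then show ?thesis using sym[of v "x t"] by (simp add: has_real_derivative_iff_has_vector_derivative)
qed

lemma linearization_error:
  assumes "(f has_derivative A) (at 0)" "f 0 = 0" "e > 0"
  obtains d where "d > 0" "\<And>x. norm x < d \<Longrightarrow> norm (f x - A x) \<le> e * norm x"
proof -
  have "\<exists>d>0. \<forall>y. norm (y - 0) < d \<longrightarrow> norm (f y - f 0 - A (y - 0)) \<le> e * norm (y - 0)"
    using assms(1,3) unfolding has_derivative_at_alt by blast
  then show thesis using that by (auto simp: assms(2))
qed

text \<open>In a small ball the linearization error is dominated by the decay rate \<open>c\<close>, so \<open>W\<close> decays exponentially as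
  long as a solution stays there, and a solution that starts close enough to the origin has no first time at
  which it could reach the boundary. For existence, \<open>f\<close> is composed with the projection to the ball; this
  field is bounded and globally Lipschitz, and its solutions remain in the ball, where it agrees with \<open>f\<close>.\<close>

lemma lyapunov_exponentially_stable:
  fixes f :: "'a::euclidean_space \<Rightarrow> 'a" and W :: "'a \<Rightarrow> 'a \<Rightarrow> real"
  assumes f: "smooth_on UNIV f" "f 0 = 0" and A: "(f has_derivative A) (at 0)"
    and W: "bilinear W" "\<And>x y. W x y = W y x"
    and \<kappa>: "\<kappa> > 0" "\<And>x. \<kappa> * (norm x)\<^sup>2 \<le> W x x"
    and c: "c > 0" "\<And>x. W x (A x) \<le> - c * (norm x)\<^sup>2"
  shows "exponentially_stable f"
proof -
  obtain K where K: "K > 0" "\<And>x y. norm (W x y) \<le> K * norm x * norm y"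
    using bilinear_bounded_pos[OF W(1)] by blast
  have Wadd: "W x (y + z) = W x y + W x z" for x y z
    using W(1) by (simp add: bilinear_def linear_add)
  have bb: "bounded_bilinear W" using W(1) bilinear_conv_bounded_bilinear by blast
  obtain d where d: "d > 0" "\<And>x. norm x < d \<Longrightarrow> norm (f x - A x) \<le> c / (2 * K) * norm x"
    using linearization_error[OF A f(2), of "c / (2 * K)"] c(1) K(1) by auto
  define r where "r = d / 2"
  have r: "r > 0" "r < d" using d(1) by (auto simp: r_def)
  \<comment> \<open>Since \<open>W x x \<le> K |x|\<^sup>2\<close>, the decay \<open>- c |x|\<^sup>2\<close> of \<open>W\<close> is at least \<open>\<rho>\<close> times \<open>W\<close>.\<close>
  define \<rho> where "\<rho> = c / K"
  have \<rho>: "\<rho> > 0" using c K by (simp add: \<rho>_def)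
  have WK: "W x x \<le> K * (norm x)\<^sup>2" for x
    using K(2)[of x x] by (simp add: power2_eq_square mult.assoc)
  have decay: "2 * W x (f x) \<le> - \<rho> * W x x" if x: "norm x \<le> r" for x
  proof -
    have "W x (f x) = W x (A x) + W x (f x - A x)" using Wadd[of x "A x" "f x - A x"] by simp
    also have "W x (f x - A x) \<le> K * norm x * norm (f x - A x)" using K(2)[of x "f x - A x"] by simp
    also have "\<dots> \<le> K * norm x * (c / (2 * K) * norm x)"
      using d(2)[of x] x r K(1) by (intro mult_left_mono) auto
    also have "\<dots> = c / 2 * (norm x)\<^sup>2" using K(1) by (simp add: power2_eq_square)
    finally have "2 * W x (f x) \<le> - c * (norm x)\<^sup>2" using c(2)[of x] by simp
    moreover have "\<rho> * W x x \<le> \<rho> * (K * (norm x)\<^sup>2)" using \<rho> WK[of x] by (intro mult_left_mono) auto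
    moreover have "\<rho> * (K * (norm x)\<^sup>2) = c * (norm x)\<^sup>2" using K(1) by (simp add: \<rho>_def)
    ultimately show ?thesis by simp
  qed
  \<comment> \<open>The square root alone compares \<open>|x|\<close> with the square root of \<open>W\<close>; the summand 1 makes \<open>C\<close> positive.\<close>
  define C where "C = sqrt (K / \<kappa>) + 1"
  have C: "C > 0" "K / \<kappa> \<le> C\<^sup>2"
  proof -
    have s: "sqrt (K / \<kappa>) \<ge> 0" using K \<kappa> by simp
    then show "C > 0" unfolding C_def by linarith
    have "(sqrt (K / \<kappa>))\<^sup>2 \<le> C\<^sup>2" using s by (intro power_mono) (auto simp: C_def)
    then show "K / \<kappa> \<le> C\<^sup>2" using K \<kappa> by simp
  qed
  have bound: "norm (x t) \<le> C * exp (- (\<rho> / 2) * t) * norm (x 0)"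
    if sol: "solves F x" and F: "\<And>y. norm y \<le> r \<Longrightarrow> F y = f y" and t: "0 \<le> t"
      and inb: "\<And>s. 0 < s \<Longrightarrow> s < t \<Longrightarrow> norm (x s) \<le> r" for F x t
  proof -
    let ?E = "\<lambda>t. W (x t) (x t) * exp (\<rho> * t)"
    have "?E t \<le> ?E 0"
    proof (rule DERIV_nonpos_imp_decreasing_open[OF t])
      fix s assume s: "0 < s" "s < t"
      have "(x has_vector_derivative f (x s)) (at s)"
        using solves_at[OF sol s(1)] F[OF inb[OF s]] by simp
      from derivative_bilinear_along_solution[OF W this]
      have "(?E has_real_derivative 2 * W (x s) (f (x s)) * exp (\<rho> * s) + \<rho> * exp (\<rho> * s) * W (x s) (x s)) (at s)"
        by (rule DERIV_mult) (auto intro!: derivative_eq_intros)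
      moreover have "2 * W (x s) (f (x s)) * exp (\<rho> * s) + \<rho> * exp (\<rho> * s) * W (x s) (x s)
          = (2 * W (x s) (f (x s)) + \<rho> * W (x s) (x s)) * exp (\<rho> * s)" by (simp add: algebra_simps)
      moreover have "\<dots> \<le> 0" using decay[OF inb[OF s]] by (intro mult_nonpos_nonneg) auto
      ultimately show "\<exists>y. (?E has_real_derivative y) (at s) \<and> y \<le> 0" by metis
    next
      have "continuous_on {0..t} x" using solves_continuous[OF sol] continuous_on_subset by fastforce
      then show "continuous_on {0..t} ?E"
        by (intro continuous_on_mult bounded_bilinear.continuous_on[OF bb] continuous_intros)
    qed
    then have "W (x t) (x t) * exp (\<rho> * t) \<le> K * (norm (x 0))\<^sup>2" using WK[of "x 0"] by simp
    then have "\<kappa> * (norm (x t))\<^sup>2 * exp (\<rho> * t) \<le> K * (norm (x 0))\<^sup>2"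
      using \<kappa>(2)[of "x t"] by (meson exp_ge_zero mult_right_mono order_trans)
    then have "(norm (x t))\<^sup>2 \<le> K / \<kappa> * exp (- \<rho> * t) * (norm (x 0))\<^sup>2"
      using \<kappa>(1) by (simp add: exp_minus field_simps)
    also have "\<dots> \<le> C\<^sup>2 * exp (- \<rho> * t) * (norm (x 0))\<^sup>2"
      using C(2) by (intro mult_right_mono) auto
    also have "\<dots> = (C * exp (- (\<rho> / 2) * t) * norm (x 0))\<^sup>2"
      by (simp add: power_mult_distrib flip: exp_double)
    finally show ?thesis using C(1) by (intro power2_le_imp_le[of "norm (x t)"]) auto
  qed
  \<comment> \<open>Then both \<open>\<delta>\<close> and the bound \<open>C \<delta>\<close> for the solution stay below \<open>r\<close>.\<close>
  define \<delta> where "\<delta> = r / (C + 1)"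
  have \<delta>: "\<delta> > 0" using r C by (simp add: \<delta>_def)
  have \<delta>r: "C * \<delta> < r" "\<delta> \<le> r"
    using r(1) C(1) by (simp_all add: \<delta>_def field_simps)
  have trap: "norm (x t) < r" if sol: "solves F x" and F: "\<And>y. norm y \<le> r \<Longrightarrow> F y = f y"
      and x0: "norm (x 0) < \<delta>" and t: "0 \<le> t" for F x t
  proof (rule ccontr)
    assume nr: "\<not> norm (x t) < r"
    let ?H = "{s\<in>{0..t}. r \<le> norm (x s)}"
    have "continuous_on {0..t} x" using solves_continuous[OF sol] continuous_on_subset by fastforce
    then have "closed ?H" by (intro continuous_closed_preimage_constant continuous_on_closed_Collect_le continuous_intros) auto
    moreover have "bounded ?H" by (rule bounded_subset[of "{0..t}"]) auto
    ultimately have "compact ?H" by (simp add: compact_eq_bounded_closed)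
    moreover have "?H \<noteq> {}" using nr t by auto
    ultimately obtain t0 where t0: "t0 \<in> ?H" "\<And>s. s \<in> ?H \<Longrightarrow> t0 \<le> s"
      using compact_attains_inf[of ?H] by blast
    have "norm (x s) \<le> r" if "0 < s" "s < t0" for s
    proof (rule ccontr)
      assume "\<not> norm (x s) \<le> r"
      then have "s \<in> ?H" using that t0(1) by auto
      then show False using t0(2)[of s] that by simp
    qed
    then have "norm (x t0) \<le> C * exp (- (\<rho> / 2) * t0) * norm (x 0)"
      using t0(1) by (intro bound[OF sol F]) auto
    also have "\<dots> \<le> C * 1 * norm (x 0)"
      using t0(1) C(1) \<rho> by (intro mult_right_mono mult_left_mono) auto
    also have "\<dots> \<le> C * \<delta>" using x0 C(1) by simp
    finally show False using \<delta>r t0(1) by auto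
  qed
  let ?P = "closest_point (cball (0::'a) r)"
  have P: "?P y \<in> cball 0 r" for y using r by (intro closest_point_in_set) auto
  obtain L where L: "L > 0" "\<And>x y. x \<in> cball 0 r \<Longrightarrow> y \<in> cball 0 r \<Longrightarrow> norm (f x - f y) \<le> L * norm (x - y)"
    using smooth_on_imp_lipschitz_on_cball[OF f(1)] by blast
  have Lip: "norm (f (?P x) - f (?P y)) \<le> L * norm (x - y)" for x y
  proof -
    have "norm (f (?P x) - f (?P y)) \<le> L * norm (?P x - ?P y)" by (intro L(2) P)
    also have "\<dots> \<le> L * norm (x - y)"
      using closest_point_lipschitz[of "cball (0::'a) r" x y] r L(1) by (intro mult_left_mono) (auto simp: dist_norm)
    finally show ?thesis .
  qed
  have Bd: "norm (f (?P x)) \<le> L * r" for x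
  proof -
    have "norm (f (?P x) - f 0) \<le> L * norm (?P x - 0)" using r by (intro L(2) P) auto
    also have "\<dots> \<le> L * r" using P[of x] L(1) by (intro mult_left_mono) auto
    finally show ?thesis by (simp add: f(2))
  qed
  have FP: "(f \<circ> ?P) y = f y" if "norm y \<le> r" for y using that by (simp add: closest_point_self)
  have ex: "\<exists>x. solves f x \<and> x 0 = x0" if x0: "norm x0 < \<delta>" for x0
  proof -
    obtain x where x: "solves (f \<circ> ?P) x" "x 0 = x0"
      using bounded_lipschitz_has_solution[of L "f \<circ> ?P" "L * r" x0] L(1) Lip Bd by auto
    have "norm (x t) < r" if "0 \<le> t" for t
      using trap[OF x(1) FP _ that] x0 x(2) by simp
    then have "(f \<circ> ?P) (x t) = f (x t)" if "0 \<le> t" for t using FP[of "x t"] that by (simp add: less_imp_le)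
    then have "solves f x" using x(1) unfolding solves_def by simp
    then show ?thesis using x(2) by blast
  qed
  have decays: "norm (x t) \<le> C * exp (- (\<rho> / 2) * t) * norm x0"
    if a: "norm x0 < \<delta>" "solves f x" "x 0 = x0" "0 \<le> t" for x0 x t
  proof -
    have "norm (x s) \<le> r" if "0 < s" for s
      using trap[of f x s] a that by simp
    then show ?thesis using bound[of f x t] a by simp
  qed
  have "\<forall>x0. norm x0 < \<delta> \<longrightarrow> (\<exists>x. solves f x \<and> x 0 = x0) \<and>
      (\<forall>x. solves f x \<and> x 0 = x0 \<longrightarrow> (\<forall>t\<ge>0. norm (x t) \<le> C * exp (- (\<rho> / 2) * t) * norm x0))"
    using ex decays by blast
  then show ?thesis
    unfolding exponentially_stable_def using \<delta> C(1) half_gt_zero[OF \<rho>] by blast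
qed

text \<open>Start at a small multiple \<open>\<epsilon> \<xi>\<close>. Only the linearization error changes \<open>Q\<close> along the solution, and if the
  solution decays exponentially, the total change is at most a small multiple of \<open>\<epsilon>\<^sup>2\<close>. So \<open>Q\<close> stays above
  half of its initial value, although it must tend to zero.\<close>

lemma conserved_form_not_exponentially_stable:
  fixes f :: "'a::euclidean_space \<Rightarrow> 'a" and Q :: "'a \<Rightarrow> 'a \<Rightarrow> real"
  assumes f0: "f 0 = 0" and A: "(f has_derivative A) (at 0)"
    and Q: "bilinear Q" "\<And>x y. Q x y = Q y x"
    and cons: "\<And>x. Q x (A x) = 0" and \<xi>: "Q \<xi> \<xi> > 0"
  shows "\<not> exponentially_stable f"
proof
  assume "exponentially_stable f"
  then obtain \<delta> c r where \<delta>: "\<delta> > 0" and c: "c > 0" and r: "r > 0"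
    and ex: "\<And>x0. norm x0 < \<delta> \<Longrightarrow> \<exists>x. solves f x \<and> x 0 = x0"
    and st: "\<And>x0 x t. norm x0 < \<delta> \<Longrightarrow> solves f x \<Longrightarrow> x 0 = x0 \<Longrightarrow> t \<ge> 0 \<Longrightarrow> norm (x t) \<le> c * exp (- r * t) * norm x0"
    unfolding exponentially_stable_def by metis
  obtain K where K: "K > 0" "\<And>x y. norm (Q x y) \<le> K * norm x * norm y"
    using bilinear_bounded_pos[OF Q(1)] by blast
  have Qadd: "Q x (y + z) = Q x y + Q x z" for x y z
    using Q(1) by (simp add: bilinear_def linear_add)
  have bb: "bounded_bilinear Q" using Q(1) bilinear_conv_bounded_bilinear by blast
  have \<xi>0: "norm \<xi> > 0" using \<xi> bounded_bilinear.zero_left[OF bb] by (metis norm_le_zero_iff not_less order_less_irrefl)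
  \<comment> \<open>With this accuracy of the linearization, the total change \<open>D\<close> of \<open>Q\<close> below is half of its initial value.\<close>
  define \<eta> where "\<eta> = r * Q \<xi> \<xi> / (2 * K * c\<^sup>2 * (norm \<xi>)\<^sup>2)"
  have \<eta>: "\<eta> > 0" using r \<xi> K c \<xi>0 by (simp add: \<eta>_def)
  obtain d where d: "d > 0" "\<And>x. norm x < d \<Longrightarrow> norm (f x - A x) \<le> \<eta> * norm x"
    using linearization_error[OF A f0 \<eta>] by blast
  define m where "m = min (\<delta> / 2) (d / (2 * c))"
  have m: "m > 0" using \<delta> d c by (simp add: m_def)
  define \<epsilon> where "\<epsilon> = m / norm \<xi>"
  have \<epsilon>: "\<epsilon> > 0" using m \<xi>0 by (simp add: \<epsilon>_def)
  have n0: "norm (\<epsilon> *\<^sub>R \<xi>) = m" using m \<xi>0 by (simp add: \<epsilon>_def)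
  then have n1: "norm (\<epsilon> *\<^sub>R \<xi>) < \<delta>" "c * norm (\<epsilon> *\<^sub>R \<xi>) < d"
  proof -
    show "norm (\<epsilon> *\<^sub>R \<xi>) < \<delta>" unfolding n0 using \<delta> by (auto simp: m_def)
    have "c * norm (\<epsilon> *\<^sub>R \<xi>) \<le> c * (d / (2 * c))" unfolding n0 using c by (intro mult_left_mono) (auto simp: m_def)
    also have "\<dots> < d" using c d by simp
    finally show "c * norm (\<epsilon> *\<^sub>R \<xi>) < d" .
  qed
  define N where "N = norm (\<epsilon> *\<^sub>R \<xi>)"
  have N0: "N \<ge> 0" by (simp add: N_def)
  obtain x where x: "solves f x" "x 0 = \<epsilon> *\<^sub>R \<xi>" using ex[OF n1(1)] by blast
  have bd: "norm (x t) \<le> c * exp (- r * t) * N" if "t \<ge> 0" for t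
    using st[OF n1(1) x that] by (simp add: N_def)
  define D where "D = K * \<eta> * c\<^sup>2 * N\<^sup>2 / r"
  let ?E = "\<lambda>t. Q (x t) (x t) - D * exp (- 2 * r * t)"
  have mono: "?E 0 \<le> ?E t" if t: "t \<ge> 0" for t
  proof (rule DERIV_nonneg_imp_increasing_open[OF t])
    fix s assume s: "0 < s" "s < t"
    have "norm (x s) \<le> c * exp (- r * s) * N" using bd s by simp
    also have "\<dots> \<le> c * 1 * N" using s r c N0 by (intro mult_right_mono mult_left_mono) auto
    also have "\<dots> < d" using n1(2) by (simp add: N_def)
    finally have xd: "norm (x s) < d" .
    have "\<bar>Q (x s) (f (x s))\<bar> = \<bar>Q (x s) (A (x s)) + Q (x s) (f (x s) - A (x s))\<bar>"
      using Qadd[of "x s" "A (x s)" "f (x s) - A (x s)"] by simp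
    also have "\<dots> \<le> K * norm (x s) * norm (f (x s) - A (x s))"
      using K(2)[of "x s" "f (x s) - A (x s)"] by (simp add: cons)
    also have "\<dots> \<le> K * norm (x s) * (\<eta> * norm (x s))"
      using d(2)[OF xd] K(1) by (intro mult_left_mono) auto
    also have "\<dots> = K * \<eta> * (norm (x s))\<^sup>2" by (simp add: power2_eq_square)
    also have "\<dots> \<le> K * \<eta> * (c * exp (- r * s) * N)\<^sup>2"
      using bd[of s] s K(1) \<eta> by (intro mult_left_mono power_mono) auto
    also have "\<dots> = r * (D * exp (- 2 * r * s))"
      using r by (simp add: D_def power_mult_distrib flip: exp_double)
    finally have "- (r * (D * exp (- 2 * r * s))) \<le> Q (x s) (f (x s))" by simp
    then have ge: "0 \<le> 2 * Q (x s) (f (x s)) - D * (exp (- 2 * r * s) * (- 2 * r))" by (simp add: algebra_simps)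
    have "(?E has_real_derivative 2 * Q (x s) (f (x s)) - D * (exp (- 2 * r * s) * (- 2 * r))) (at s)"
      by (intro DERIV_diff derivative_bilinear_along_solution[OF Q solves_at[OF x(1) s(1)]])
        (auto intro!: derivative_eq_intros)
    then show "\<exists>y. (?E has_real_derivative y) (at s) \<and> y \<ge> 0" using ge by blast
  next
    have "continuous_on {0..t} x" using solves_continuous[OF x(1)] continuous_on_subset by fastforce
    then show "continuous_on {0..t} ?E"
      by (intro continuous_on_diff bounded_bilinear.continuous_on[OF bb] continuous_intros)
  qed
  have Q0: "Q (x 0) (x 0) = \<epsilon>\<^sup>2 * Q \<xi> \<xi>"
    unfolding x(2) by (simp add: bounded_bilinear.scaleR_left[OF bb] bounded_bilinear.scaleR_right[OF bb] power2_eq_square)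
  have "D = \<epsilon>\<^sup>2 * Q \<xi> \<xi> / 2"
    using r K c \<xi>0 \<epsilon> by (simp add: D_def \<eta>_def N_def power_mult_distrib field_simps)
  then have lower: "\<epsilon>\<^sup>2 * Q \<xi> \<xi> / 2 \<le> Q (x t) (x t)" if "t \<ge> 0" for t
    using mono[OF that] Q0 \<epsilon> \<xi> by (simp add: add_increasing2) (smt (verit) exp_gt_zero mult_pos_pos zero_less_power)
  define Z where "Z = K * (c * N)\<^sup>2 + 1"
  \<comment> \<open>A time \<open>t\<close> with \<open>exp (- 2 r t) \<le> z\<close> brings the upper bound for \<open>Q\<close> below its lower bound.\<close>
  define z where "z = \<epsilon>\<^sup>2 * Q \<xi> \<xi> / (4 * Z)"
  have den: "Z > 0" unfolding Z_def using K(1) by (intro add_nonneg_pos) auto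
  have z: "z > 0" using \<epsilon> \<xi> den by (simp add: z_def)
  define t where "t = max 0 (- ln z / (2 * r))"
  have t: "t \<ge> 0" by (simp add: t_def)
  have "- ln z / (2 * r) \<le> t" by (simp add: t_def)
  then have "- (2 * r * t) \<le> ln z" using r by (simp add: field_simps)
  then have ez: "exp (- (2 * r * t)) \<le> z" using z by (metis exp_le_cancel_iff exp_ln)
  have "Q (x t) (x t) \<le> K * (norm (x t))\<^sup>2" using K(2)[of "x t" "x t"] by (simp add: power2_eq_square mult.assoc)
  also have "\<dots> \<le> K * (c * exp (- r * t) * N)\<^sup>2" using bd[OF t] K(1) by (intro mult_left_mono power_mono) auto
  also have "\<dots> = K * (c * N)\<^sup>2 * exp (- (2 * r * t))"
    by (simp add: power_mult_distrib mult.assoc flip: exp_double)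
  also have "\<dots> \<le> K * (c * N)\<^sup>2 * z" using ez K(1) by (intro mult_left_mono) auto
  also have "\<dots> \<le> Z * z" using z by (simp add: Z_def)
  also have "\<dots> = \<epsilon>\<^sup>2 * Q \<xi> \<xi> / 4" using den by (simp add: z_def)
  also have "\<dots> < \<epsilon>\<^sup>2 * Q \<xi> \<xi> / 2" using \<epsilon> \<xi> by simp
  finally show False using lower[OF t] by simp
qed


section \<open>Strict Lyapunov functions from dissipation and observability\<close>

text \<open>Write \<open>y\<^sub>i = C A\<^sup>i x\<close>. Subtracting a small multiple of \<open>y\<^sub>n \<bullet> y\<^sub>n\<^sub>+\<^sub>1\<close> from the form adds decay in
  \<open>y\<^sub>n\<^sub>+\<^sub>1\<close>, at the price of the product of \<open>y\<^sub>n\<close> and \<open>y\<^sub>n\<^sub>+\<^sub>2\<close>; by the arithmetic-geometric mean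
  inequality this is absorbed by the decay in \<open>y\<^sub>n\<close>, up to an error in \<open>|x|\<^sup>2\<close>. The induction allows such an
  error, but asks it to be as small as desired in comparison with the decay rate \<open>c\<close>. Once all \<open>y\<^sub>i\<close> up to \<open>N\<close>
  occur, observability makes them dominate \<open>|x|\<^sup>2\<close>, and the error disappears.\<close>

lemma strict_lyapunov_function_exists:
  fixes A :: "'a::euclidean_space \<Rightarrow> 'a" and C :: "'a \<Rightarrow> 'b::euclidean_space"
  assumes A: "linear A" and C: "linear C"
    and Q: "bilinear Q" "\<And>x y. Q x y = Q y x" "\<And>x. x \<noteq> 0 \<Longrightarrow> 0 < Q x x"
    and diss: "k > 0" "\<And>x. Q x (A x) \<le> - k * (norm (C x))\<^sup>2"
    and obs: "\<And>x. (\<And>i. i \<le> N \<Longrightarrow> C ((A ^^ i) x) = 0) \<Longrightarrow> x = 0"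
  obtains W \<kappa> c where "bilinear W" "\<And>x y. W x y = W y x" "\<kappa> > 0" "\<And>x. \<kappa> * (norm x)\<^sup>2 \<le> W x x"
    "c > 0" "\<And>x. W x (A x) \<le> - c * (norm x)\<^sup>2"
proof -
  define y where "y i x = C ((A ^^ i) x)" for i x
  have yA: "y i (A x) = y (Suc i) x" for i x
    by (simp add: y_def funpow_swap1)
  have ly: "linear (y i)" for i
  proof -
    have "linear (A ^^ i)"
    proof (induction i)
      case 0
      then show ?case by (simp add: linear_ident id_def)
    next
      case (Suc i)
      then show ?case unfolding funpow.simps(2) by (rule linear_compose[OF _ A])
    qed
    then show ?thesis using linear_compose[OF _ C] unfolding y_def comp_def by blast
  qed
  let ?S = "\<lambda>n x. \<Sum>i\<le>n. (norm (y i x))\<^sup>2"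
  have claim: "\<exists>W c. bilinear W \<and> (\<forall>x y. W x y = W y x) \<and> (\<forall>x. \<bar>W x x - Q x x\<bar> \<le> \<eta> * (norm x)\<^sup>2) \<and>
      0 < c \<and> c \<le> 1 \<and> (\<forall>x. W x (A x) \<le> - c * (?S n x - \<eta> * (norm x)\<^sup>2))" if "\<eta> > 0" for n \<eta>
    using that
  proof (induction n arbitrary: \<eta>)
    case 0
    have "Q x (A x) \<le> - min k 1 * ((norm (y 0 x))\<^sup>2 - \<eta> * (norm x)\<^sup>2)" for x
    proof -
      have "min k 1 * (norm (y 0 x))\<^sup>2 \<le> k * (norm (y 0 x))\<^sup>2" by (intro mult_right_mono) auto
      moreover have "0 \<le> min k 1 * (\<eta> * (norm x)\<^sup>2)" using 0 diss(1) by simp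
      moreover have "y 0 x = C x" by (simp add: y_def)
      ultimately show ?thesis using diss(2)[of x] by (simp add: right_diff_distrib)
    qed
    then show ?case using Q 0 diss(1) by (intro exI[of _ Q] exI[of _ "min k 1"]) auto
  next
    case (Suc n)
    obtain K0 where K0: "\<And>x. norm (y n x) \<le> K0 * norm x" using linear_bounded[OF ly] by blast
    obtain K1 where K1: "\<And>x. norm (y (Suc n) x) \<le> K1 * norm x" using linear_bounded[OF ly] by blast
    obtain K2 where K2: "\<And>x. norm (y (Suc (Suc n)) x) \<le> K2 * norm x" using linear_bounded[OF ly] by blast
    define K where "K = \<bar>K0\<bar> + \<bar>K1\<bar> + \<bar>K2\<bar>"
    have K: "norm (y n x) \<le> K * norm x" "norm (y (Suc n) x) \<le> K * norm x" "norm (y (Suc (Suc n)) x) \<le> K * norm x" for x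
    proof -
      have "K0 * norm x \<le> K * norm x" "K1 * norm x \<le> K * norm x" "K2 * norm x \<le> K * norm x"
        by (intro mult_right_mono; simp add: K_def)+
      then show "norm (y n x) \<le> K * norm x" "norm (y (Suc n) x) \<le> K * norm x" "norm (y (Suc (Suc n)) x) \<le> K * norm x"
        using K0[of x] K1[of x] K2[of x] by linarith+
    qed
    define D where "D = 3 + K\<^sup>2"
    have D: "D \<ge> 3" by (simp add: D_def)
    \<comment> \<open>The induction hypothesis is used with error \<open>\<tau>\<^sup>2\<close>, which is small compared with the new rate \<open>c \<tau> / 2\<close>.\<close>
    define \<tau> where "\<tau> = min 1 (\<eta> / D)"
    have \<tau>: "0 < \<tau>" "\<tau> \<le> 1" "\<tau> * D \<le> \<eta>"
    proof -
      show "0 < \<tau>" "\<tau> \<le> 1" using Suc.prems D by (auto simp: \<tau>_def)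
      have "\<tau> * D \<le> \<eta> / D * D" using D by (intro mult_right_mono) (auto simp: \<tau>_def)
      then show "\<tau> * D \<le> \<eta>" using D by simp
    qed
    obtain W c where W: "bilinear W" "\<And>x y. W x y = W y x" "\<And>x. \<bar>W x x - Q x x\<bar> \<le> \<tau>\<^sup>2 * (norm x)\<^sup>2"
      and c: "0 < c" "c \<le> 1" and d: "\<And>x. W x (A x) \<le> - c * (?S n x - \<tau>\<^sup>2 * (norm x)\<^sup>2)"
      using Suc.IH[OF zero_less_power[OF \<tau>(1), of 2]] by blast
    define P where "P x x' = 1/2 * (y n x \<bullet> y (Suc n) x' + y n x' \<bullet> y (Suc n) x)" for x x'
    define W' where "W' x x' = W x x' - (c * \<tau>) * P x x'" for x x'
    have "bilinear W'"
      unfolding bilinear_def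
      by (intro conjI allI linearI)
        (simp_all add: W'_def P_def bilinear_ladd[OF W(1)] bilinear_radd[OF W(1)] bilinear_lmul[OF W(1)]
          bilinear_rmul[OF W(1)] linear_add[OF ly] linear_scale[OF ly] inner_add_left inner_add_right algebra_simps)
    moreover have "W' x x' = W' x' x" for x x' by (simp add: W'_def P_def W(2)[of x x'])
    moreover have "\<bar>W' x x - Q x x\<bar> \<le> \<eta> * (norm x)\<^sup>2" for x
    proof -
      have "\<bar>P x x\<bar> \<le> norm (y n x) * norm (y (Suc n) x)"
        unfolding P_def using Cauchy_Schwarz_ineq2[of "y n x" "y (Suc n) x"] by simp
      also have "\<dots> \<le> (K * norm x) * (K * norm x)" by (intro mult_mono' K) auto
      finally have "\<bar>P x x\<bar> \<le> K\<^sup>2 * (norm x)\<^sup>2" by (simp add: power2_eq_square mult_ac)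
      then have "(c * \<tau>) * \<bar>P x x\<bar> \<le> (1 * \<tau>) * (K\<^sup>2 * (norm x)\<^sup>2)"
        using c \<tau> by (intro mult_mono) auto
      moreover have "\<tau>\<^sup>2 * (norm x)\<^sup>2 \<le> \<tau> * (norm x)\<^sup>2"
        using \<tau> by (intro mult_right_mono) (auto simp: power2_eq_square mult_left_le)
      moreover have "\<bar>W' x x - Q x x\<bar> \<le> \<bar>W x x - Q x x\<bar> + (c * \<tau>) * \<bar>P x x\<bar>"
        using abs_triangle_ineq4[of "W x x - Q x x" "c * \<tau> * P x x"] c \<tau> by (simp add: W'_def abs_mult algebra_simps)
      moreover have "\<tau> * D * (norm x)\<^sup>2 \<le> \<eta> * (norm x)\<^sup>2" using \<tau>(3) by (intro mult_right_mono) auto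
      moreover have "\<tau> * D * (norm x)\<^sup>2 = \<tau> * 3 * (norm x)\<^sup>2 + \<tau> * (K\<^sup>2 * (norm x)\<^sup>2)"
        by (simp add: D_def algebra_simps)
      moreover have "0 \<le> \<tau> * (norm x)\<^sup>2" using \<tau>(1) by simp
      ultimately show ?thesis using W(3)[of x] by linarith
    qed
    moreover have "W' x (A x) \<le> - (c * \<tau> / 2) * (?S (Suc n) x - \<eta> * (norm x)\<^sup>2)" for x
    proof -
      define a where "a = norm (y n x)"
      define b where "b = norm (y (Suc n) x)"
      define N2 where "N2 = (norm x)\<^sup>2"
      define s where "s = ?S n x"
      have N2: "N2 \<ge> 0" by (simp add: N2_def)
      have "P x (A x) = 1/2 * (y n x \<bullet> y (Suc (Suc n)) x + b\<^sup>2)"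
        by (simp add: P_def yA b_def power2_norm_eq_inner)
      moreover have "- (a * (K * norm x)) \<le> y n x \<bullet> y (Suc (Suc n)) x"
      proof -
        have "\<bar>y n x \<bullet> y (Suc (Suc n)) x\<bar> \<le> a * norm (y (Suc (Suc n)) x)"
          unfolding a_def by (rule Cauchy_Schwarz_ineq2)
        also have "\<dots> \<le> a * (K * norm x)" using K(3)[of x] by (intro mult_left_mono) (auto simp: a_def)
        finally show ?thesis by linarith
      qed
      ultimately have P: "P x (A x) \<ge> 1/2 * (b\<^sup>2 - a * (K * norm x))" by simp
      have amgm: "\<tau> * (a * (K * norm x)) \<le> a\<^sup>2 + \<tau>\<^sup>2 * K\<^sup>2 * N2"
      proof -
        have "0 \<le> (a - \<tau> * K * norm x)\<^sup>2 + (a\<^sup>2 + \<tau>\<^sup>2 * K\<^sup>2 * N2)" using N2 by simp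
        then show ?thesis by (simp add: N2_def power2_eq_square algebra_simps)
      qed
      have as: "a\<^sup>2 \<le> s" unfolding a_def s_def by (rule member_le_sum) auto
      have "W' x (A x) \<le> - c * (s - \<tau>\<^sup>2 * N2) - (c * \<tau>) * (1/2 * (b\<^sup>2 - a * (K * norm x)))"
      proof -
        have "(c * \<tau>) * (1/2 * (b\<^sup>2 - a * (K * norm x))) \<le> (c * \<tau>) * P x (A x)"
          by (rule mult_left_mono[OF P]) (use c \<tau> in auto)
        then show ?thesis using d[of x] unfolding W'_def s_def N2_def by linarith
      qed
      also have "\<dots> = - (c / 2) * (2 * s - 2 * \<tau>\<^sup>2 * N2 + \<tau> * b\<^sup>2 - \<tau> * (a * (K * norm x)))"
        by (simp add: algebra_simps)
      also have "\<dots> \<le> - (c / 2) * (\<tau> * (s + b\<^sup>2 - \<eta> * N2))"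
      proof -
        have "\<tau> * s \<le> s" using \<tau> as by (intro mult_left_le_one_le) (auto intro: order_trans[OF zero_le_power2])
        moreover have "\<tau>\<^sup>2 * D * N2 \<le> \<tau> * \<eta> * N2"
          using \<tau> N2 by (intro mult_right_mono) (auto simp: power2_eq_square mult.assoc)
        moreover have "\<tau>\<^sup>2 * D * N2 = \<tau>\<^sup>2 * 3 * N2 + \<tau>\<^sup>2 * K\<^sup>2 * N2" by (simp add: D_def algebra_simps)
        moreover have "0 \<le> \<tau>\<^sup>2 * N2" using N2 by simp
        moreover have "\<tau> * (s + b\<^sup>2 - \<eta> * N2) = \<tau> * s + \<tau> * b\<^sup>2 - \<tau> * \<eta> * N2" by (simp add: algebra_simps)
        ultimately have "\<tau> * (s + b\<^sup>2 - \<eta> * N2) \<le> 2 * s - 2 * \<tau>\<^sup>2 * N2 + \<tau> * b\<^sup>2 - \<tau> * (a * (K * norm x))"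
          using amgm as by linarith
        then show ?thesis using c by (simp add: mult_left_mono)
      qed
      finally show ?thesis by (simp add: s_def b_def N2_def mult.assoc)
    qed
    moreover have "0 < c * \<tau> / 2" "c * \<tau> / 2 \<le> 1"
      using c \<tau> mult_le_one[of c \<tau>] by auto
    ultimately show ?case by blast
  qed
  have "continuous_on UNIV (\<lambda>x. Q x x)"
    using bounded_bilinear.continuous_on[OF bilinear_conv_bounded_bilinear[THEN iffD1, OF Q(1)] continuous_on_id continuous_on_id] .
  moreover have "Q (t *\<^sub>R x) (t *\<^sub>R x) = t\<^sup>2 * Q x x" for t x
    by (simp add: bilinear_lmul[OF Q(1)] bilinear_rmul[OF Q(1)] power2_eq_square)
  ultimately obtain q where q: "q > 0" "\<And>x. q * (norm x)\<^sup>2 \<le> Q x x"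
    using positive_quadratic_lower_bound[of "\<lambda>x. Q x x"] Q(3) by blast
  have "continuous_on UNIV (?S N)"
    by (intro continuous_on_sum continuous_on_power continuous_on_norm linear_continuous_on linear_conv_bounded_linear[THEN iffD1] ly)
  moreover have "?S N (t *\<^sub>R x) = t\<^sup>2 * ?S N x" for t x
    by (simp add: linear_scale[OF ly] power_mult_distrib sum_distrib_left)
  moreover have "?S N x > 0" if "x \<noteq> 0" for x
  proof -
    have "\<not> (\<forall>i\<le>N. y i x = 0)" using obs[of x] that unfolding y_def by auto
    then obtain i where "i \<le> N" "y i x \<noteq> 0" by auto
    then show ?thesis by (intro sum_pos2[of _ i]) auto
  qed
  ultimately obtain m where m: "m > 0" "\<And>x. m * (norm x)\<^sup>2 \<le> ?S N x"
    by (rule positive_quadratic_lower_bound[of "?S N"]) (assumption | rule that)+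
  define \<eta> where "\<eta> = min (q / 2) (m / 2)"
  have \<eta>: "\<eta> > 0" "\<eta> \<le> q / 2" "\<eta> \<le> m / 2" using q m by (auto simp: \<eta>_def)
  obtain W c where W: "bilinear W" "\<And>x y. W x y = W y x" "\<And>x. \<bar>W x x - Q x x\<bar> \<le> \<eta> * (norm x)\<^sup>2"
    and c: "0 < c" and d: "\<And>x. W x (A x) \<le> - c * (?S N x - \<eta> * (norm x)\<^sup>2)"
    using claim[OF \<eta>(1), of N] by blast
  have "q / 2 * (norm x)\<^sup>2 \<le> W x x" for x
    using W(3)[of x] q(2)[of x] mult_right_mono[OF \<eta>(2), of "(norm x)\<^sup>2"] by simp
  moreover have "W x (A x) \<le> - (c * m / 2) * (norm x)\<^sup>2" for x
  proof -
    have "m / 2 * (norm x)\<^sup>2 \<le> ?S N x - \<eta> * (norm x)\<^sup>2"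
      using m(2)[of x] mult_right_mono[OF \<eta>(3), of "(norm x)\<^sup>2"] by simp
    then have "c * (m / 2 * (norm x)\<^sup>2) \<le> c * (?S N x - \<eta> * (norm x)\<^sup>2)" using c by (intro mult_left_mono) auto
    then show ?thesis using d[of x] by simp
  qed
  moreover have "c * m / 2 > 0" "q / 2 > 0" using c m q by auto
  ultimately show thesis using that W(1,2) by blast
qed

section \<open>Controllability of the linearization\<close>

lemma sym_pos_def_inner:
  "sym_pos_def A \<Longrightarrow> x \<bullet> (A *v y) = (A *v x) \<bullet> y"
  unfolding sym_pos_def_def by (metis dot_lmul_matrix transpose_matrix_vector)

lemma sym_pos_def_invertible:
  assumes "sym_pos_def A" shows "invertible A"
proof -
  have "x = 0" if "A *v x = 0" for x
    using assms that unfolding sym_pos_def_def by (metis inner_zero_right less_irrefl)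
  then have "inj ((*v) A)"
    by (metis matrix_left_invertible_ker matrix_left_invertible_injective)
  then show ?thesis
    by (simp add: invertible_left_inverse matrix_left_invertible_injective)
qed

lemma matrix_inv_cancel:
  fixes A :: "real^'n^'n"
  assumes "invertible A"
  shows "matrix_inv A *v (A *v x) = x" and "A *v (matrix_inv A *v x) = x"
  using matrix_inv_works[OF assms] by (simp_all add: matrix_vector_mul_assoc)

lemmas sym_pos_def_cancel = matrix_inv_cancel[OF sym_pos_def_invertible]

lemma sym_pos_def_matrix_inv:
  assumes "sym_pos_def A" shows "sym_pos_def (matrix_inv A)"
proof -
  have s: "x \<bullet> (matrix_inv A *v y) = (matrix_inv A *v x) \<bullet> y" for x y
    using sym_pos_def_inner[OF assms, of "matrix_inv A *v x" "matrix_inv A *v y"]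
    by (simp add: sym_pos_def_cancel[OF assms])
  have "Finite_Cartesian_Product.transpose (matrix_inv A) *v x = matrix_inv A *v x" for x
    by (rule vector_eq_rdot[THEN iffD1]) (metis dot_lmul_matrix s transpose_matrix_vector)
  then have "Finite_Cartesian_Product.transpose (matrix_inv A) = matrix_inv A"
    by (simp add: matrix_eq)
  moreover have "0 < x \<bullet> (matrix_inv A *v x)" if "x \<noteq> 0" for x
  proof -
    have "matrix_inv A *v x \<noteq> 0" using that sym_pos_def_cancel(2)[OF assms, of x] by auto
    then have "0 < (matrix_inv A *v x) \<bullet> (A *v (matrix_inv A *v x))"
      using assms unfolding sym_pos_def_def by blast
    then show ?thesis by (simp add: sym_pos_def_cancel[OF assms] inner_commute)
  qed
  ultimately show ?thesis by (simp add: sym_pos_def_def)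
qed

definition annihilates :: "real^'n \<Rightarrow> real^'m^'n \<Rightarrow> bool" where
  "annihilates g B \<longleftrightarrow> g \<noteq> 0 \<and> (\<forall>y. g \<bullet> y = 0 \<longleftrightarrow> y \<in> range (\<lambda>u. B *v u))"

lemma annihilator_exists:
  fixes B :: "real^'m^'n"
  assumes "CARD('n) = CARD('m) + 1" "rank B = CARD('m)"
  obtains g where "annihilates g B"
proof -
  let ?S = "range (\<lambda>u. B *v u)"
  have sub: "subspace ?S"
    using linear_subspace_image[OF matrix_vector_mul_linear subspace_UNIV] .
  have d: "dim ?S = CARD('m)" using assms(2) rank_dim_range by metis
  then obtain g where g: "g \<noteq> 0" "span ?S \<subseteq> {x. g \<bullet> x = 0}"
    using lowdim_subset_hyperplane[of ?S] assms(1) by auto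
  have "?S = {x. g \<bullet> x = 0}"
  proof (rule subspace_dim_equal[OF sub subspace_hyperplane])
    show "?S \<subseteq> {x. g \<bullet> x = 0}" using g(2) span_superset by blast
    show "dim {x. g \<bullet> x = 0} \<le> dim ?S" using dim_hyperplane[OF g(1)] d assms(1) by simp
  qed
  then have "\<forall>y. g \<bullet> y = 0 \<longleftrightarrow> y \<in> ?S" by blast
  then show thesis using that g(1) unfolding annihilates_def by blast
qed

lemma annihilates_range: "annihilates g B \<Longrightarrow> g \<bullet> (B *v u) = 0"
  unfolding annihilates_def by blast

lemma annihilates_solve:
  assumes "annihilates g B" "g \<bullet> y = 0" obtains u where "y = B *v u"
  using assms unfolding annihilates_def by blast

text \<open>Subtracting from \<open>x\<close> its projection to \<open>g\<close> leaves a vector that lies in the range of \<open>B\<close> and is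
  orthogonal to itself.\<close>

lemma annihilates_unique:
  assumes "annihilates g B" "\<And>u. x \<bullet> (B *v u) = 0"
  obtains c where "x = c *\<^sub>R g"
proof -
  define c where "c = (x \<bullet> g) / (g \<bullet> g)"
  define y where "y = x - c *\<^sub>R g"
  have "g \<noteq> 0" using assms(1) by (simp add: annihilates_def)
  then have gy: "g \<bullet> y = 0" by (simp add: y_def c_def inner_diff_right inner_commute)
  then obtain u where "y = B *v u" using annihilates_solve[OF assms(1)] by blast
  then have "x \<bullet> y = 0" using assms(2) by simp
  then have "y \<bullet> y = 0" using gy by (simp add: y_def inner_diff_left) 
  then show thesis using that[of c] by (simp add: y_def)
qed

lemma symmetric_matrix_inner:
  fixes P :: "real^'n^'n"
  assumes "Finite_Cartesian_Product.transpose P = P"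
  shows "x \<bullet> (P *v y) = (P *v x) \<bullet> y"
  using assms by (metis dot_lmul_matrix transpose_matrix_vector)

text \<open>Controllability depends only on the coefficient matrices at the origin, which are parameters here.\<close>

definition lin_A :: "real^'n^'n \<Rightarrow> real^'n^'n \<Rightarrow> (real^'n) \<times> (real^'n) \<Rightarrow> (real^'n) \<times> (real^'n)" where
  "lin_A m P = (\<lambda>(q, p). (matrix_inv m *v p, - (P *v q)))"

definition lin_B :: "real^'m^'n \<Rightarrow> real^'m \<Rightarrow> (real^'n) \<times> (real^'n)" where
  "lin_B B = (\<lambda>u. (0, B *v u))"

lemma matrix_vector_mult_uminus: "(A :: real^'n^'m) *v (- x) = - (A *v x)"
  using linear_neg[OF matrix_vector_mul_linear[of A]] by simp

lemma four_le_dim_phase_space: "CARD('n::finite) = CARD('m::finite) + 1 \<Longrightarrow> 4 \<le> DIM((real^'n) \<times> (real^'n))"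
proof -
  assume n: "CARD('n) = CARD('m) + 1"
  have "DIM((real^'n) \<times> (real^'n)) = 2 * (CARD('m) + 1)" by (simp add: n)
  moreover have "4 \<le> 2 * (c + 1)" if "1 \<le> c" for c :: nat using that by simp
  moreover have "1 \<le> CARD('m)" using zero_less_card_finite[where 'a = 'm] by (intro Suc_leI[of 0, folded One_nat_def])
  ultimately show ?thesis by (simp only:)
qed

text \<open>If \<open>P g\<close> is parallel to \<open>m g\<close>, then \<open>g \<bullet> m q\<close> and \<open>g \<bullet> p\<close> form a subsystem that is not driven by the
  input, so the controllable subspace lies in their common kernel. The first two blocks of the Kalman matrix
  already span this kernel.\<close>

lemma controllable_subspace_degenerate:
  fixes m P :: "real^'n^'n" and B :: "real^'m^'n"
  assumes n: "CARD('n) = CARD('m) + 1" and m: "sym_pos_def m"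
    and P: "Finite_Cartesian_Product.transpose P = P" and g: "annihilates g B"
    and par: "P *v g = \<mu> *\<^sub>R (m *v g)"
  shows "controllable_subspace (lin_A m P) (lin_B B) = {(q, p). g \<bullet> (m *v q) = 0 \<and> g \<bullet> p = 0}"
    (is "?L = ?K")
proof
  have sub: "subspace ?K"
    by (auto simp: subspace_def matrix_vector_right_distrib inner_add_right
        matrix_vector_mult_scaleR zero_prod_def)
  have inv: "lin_A m P x \<in> ?K" if "x \<in> ?K" for x
  proof -
    obtain q p where x: "x = (q, p)" by (cases x)
    have "g \<bullet> (P *v q) = \<mu> * (g \<bullet> (m *v q))"
      using symmetric_matrix_inner[OF P, of g q] par sym_pos_def_inner[OF m, of g q] by simp
    then show ?thesis using that by (simp add: x lin_A_def sym_pos_def_cancel[OF m])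
  qed
  have iter: "(lin_A m P ^^ k) (lin_B B u) \<in> ?K" for k u
  proof (induction k)
    case 0
    show ?case by (simp add: lin_B_def annihilates_range[OF g])
  next
    case (Suc k)
    then show ?case using inv by simp
  qed
  show "?L \<subseteq> ?K"
    unfolding controllable_subspace_def by (intro span_minimal sub UN_least image_subsetI iter)
  show "?K \<subseteq> ?L"
  proof
    fix x assume "x \<in> ?K"
    then obtain q p where x: "x = (q, p)" "g \<bullet> (m *v q) = 0" "g \<bullet> p = 0" by auto
    obtain u where u: "p = B *v u" using annihilates_solve[OF g x(3)] .
    obtain v where v: "m *v q = B *v v" using annihilates_solve[OF g x(2)] .
    have "(lin_A m P ^^ 1) (lin_B B v) = (q, 0)"
      using sym_pos_def_cancel(1)[OF m, of q] by (simp add: lin_A_def lin_B_def v[symmetric])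
    moreover have "(lin_A m P ^^ 0) (lin_B B u) = (0, p)" by (simp add: lin_B_def u)
    ultimately have xeq: "x = (lin_A m P ^^ 1) (lin_B B v) + (lin_A m P ^^ 0) (lin_B B u)"
      by (simp add: x)
    have mem: "(lin_A m P ^^ k) (lin_B B w) \<in> ?L" if "k < 4" for k w
      unfolding controllable_subspace_def using four_le_dim_phase_space[OF n] that
      by (intro span_base UN_I[of k]) auto
    have "(lin_A m P ^^ 1) (lin_B B v) \<in> ?L" "(lin_A m P ^^ 0) (lin_B B u) \<in> ?L"
      by (rule mem, simp)+
    then show "x \<in> ?L"
      unfolding xeq controllable_subspace_def by (rule span_add)
  qed
qed

text \<open>Four blocks of the Kalman matrix suffice, and the state space has dimension at least four. A vector
  orthogonal to the blocks 0 and 1 has the form \<open>(\<alpha> m g, \<beta> g)\<close>. Orthogonality to the blocks 2 and 3 says that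
  \<open>\<beta> m\<^sup>-\<^sup>1 P g\<close> and \<open>\<alpha> m\<^sup>-\<^sup>1 P g\<close> are multiples of \<open>g\<close>, hence \<open>\<alpha> = \<beta> = 0\<close> unless \<open>P g\<close> is parallel to \<open>m g\<close>.\<close>

lemma controllable_iff_not_parallel:
  fixes m P :: "real^'n^'n" and B :: "real^'m^'n"
  assumes n: "CARD('n) = CARD('m) + 1" and m: "sym_pos_def m"
    and P: "Finite_Cartesian_Product.transpose P = P" and g: "annihilates g B"
  shows "controllable (lin_A m P) (lin_B B) \<longleftrightarrow> \<not> (\<exists>\<mu>. P *v g = \<mu> *\<^sub>R (m *v g))"
proof
  assume c: "controllable (lin_A m P) (lin_B B)"
  show "\<not> (\<exists>\<mu>. P *v g = \<mu> *\<^sub>R (m *v g))"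
  proof
    assume "\<exists>\<mu>. P *v g = \<mu> *\<^sub>R (m *v g)"
    then have eq: "controllable_subspace (lin_A m P) (lin_B B) = {(q, p). g \<bullet> (m *v q) = 0 \<and> g \<bullet> p = 0}"
      using controllable_subspace_degenerate[OF n m P g] by blast
    have "span (controllable_subspace (lin_A m P) (lin_B B)) = UNIV"
      using c unfolding controllable_def dim_eq_full .
    then have "controllable_subspace (lin_A m P) (lin_B B) = UNIV"
      by (simp add: controllable_subspace_def span_span)
    then have "(0, g) \<in> {(q, p). g \<bullet> (m *v q) = 0 \<and> g \<bullet> p = 0}" unfolding eq by simp
    then show False using g by (simp add: annihilates_def)
  qed
next
  assume np: "\<not> (\<exists>\<mu>. P *v g = \<mu> *\<^sub>R (m *v g))"
  let ?X = "\<Union>k<DIM((real^'n) \<times> (real^'n)). range (\<lambda>u. (lin_A m P ^^ k) (lin_B B u))"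
  have "span ?X = UNIV"
  proof (rule ccontr)
    assume "span ?X \<noteq> UNIV"
    then obtain z where z: "z \<noteq> 0" "\<And>x. x \<in> span ?X \<Longrightarrow> z \<bullet> x = 0" using span_not_UNIV_orthogonal by blast
    obtain a b where ab: "z = (a, b)" by (cases z)
    have orth: "z \<bullet> (lin_A m P ^^ k) (lin_B B u) = 0" if "k < 4" for k u
      using four_le_dim_phase_space[OF n] that by (intro z(2) span_base UN_I[of k]) auto
    note mi = sym_pos_def_inner[OF sym_pos_def_matrix_inv[OF m]] and Ps = symmetric_matrix_inner[OF P]
    have "b \<bullet> (B *v u) = 0" for u using orth[of 0 u] by (simp add: ab lin_B_def)
    then obtain \<beta> where \<beta>: "b = \<beta> *\<^sub>R g" using annihilates_unique[OF g] by blast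
    have "(matrix_inv m *v a) \<bullet> (B *v u) = 0" for u
      using orth[of 1 u] by (simp add: ab lin_A_def lin_B_def mi)
    then obtain \<alpha> where "matrix_inv m *v a = \<alpha> *\<^sub>R g" using annihilates_unique[OF g] by blast
    then have \<alpha>: "a = \<alpha> *\<^sub>R (m *v g)"
      using sym_pos_def_cancel(2)[OF m, of a] by (simp add: matrix_vector_mult_scaleR)
    have par: "\<gamma> = 0" if "\<And>u. (\<gamma> *\<^sub>R (matrix_inv m *v (P *v g))) \<bullet> (B *v u) = 0" for \<gamma>
    proof (rule ccontr)
      assume "\<gamma> \<noteq> 0"
      then have "(matrix_inv m *v (P *v g)) \<bullet> (B *v u) = 0" for u using that by simp
      then obtain \<mu> where "matrix_inv m *v (P *v g) = \<mu> *\<^sub>R g" using annihilates_unique[OF g] by blast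
      then have "P *v g = \<mu> *\<^sub>R (m *v g)"
        using sym_pos_def_cancel(2)[OF m, of "P *v g"] by (simp add: matrix_vector_mult_scaleR)
      then show False using np by blast
    qed
    have "(\<beta> *\<^sub>R (matrix_inv m *v (P *v g))) \<bullet> (B *v u) = 0" for u
      using orth[of 2 u] by (simp add: ab numeral_2_eq_2 lin_A_def lin_B_def \<beta> mi[symmetric] Ps[symmetric])
    then have "\<beta> = 0" by (rule par)
    have "(\<alpha> *\<^sub>R (matrix_inv m *v (P *v g))) \<bullet> (B *v u) = 0" for u
      using orth[of 3 u] sym_pos_def_inner[OF m, of g]
      by (simp add: ab numeral_3_eq_3 lin_A_def lin_B_def \<alpha> mi[symmetric] Ps[symmetric] sym_pos_def_cancel[OF m]
          matrix_vector_mult_uminus flip: sym_pos_def_inner[OF m])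
    then have "\<alpha> = 0" by (rule par)
    then show False using z(1) \<open>\<beta> = 0\<close> \<alpha> \<beta> by (simp add: ab zero_prod_def)
  qed
  then show "controllable (lin_A m P) (lin_B B)"
    unfolding controllable_def controllable_subspace_def dim_eq_full by (simp add: span_span)
qed

lemma eigenvalue_of_real_matrix:
  assumes N: "N \<in> carrier_mat k k" and v: "v \<in> carrier_vec k" "v \<noteq> 0\<^sub>v k" and e: "N *\<^sub>v v = z \<cdot>\<^sub>v v"
  shows "eigenvalue (map_mat complex_of_real N) (complex_of_real z)"
proof -
  have "eigenvalue N z" using assms unfolding eigenvalue_def eigenvector_def by auto
  then have "poly (char_poly N) z = 0" using eigenvalue_root_char_poly[OF N] by simp
  then have "poly (map_poly complex_of_real (char_poly N)) (complex_of_real z) = 0"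
    by (simp add: of_real_hom.poly_map_poly)
  then have "poly (char_poly (map_mat complex_of_real N)) (complex_of_real z) = 0"
    by (simp add: of_real_hom.char_poly_hom[OF N])
  then show ?thesis using eigenvalue_root_char_poly[of "map_mat complex_of_real N" k] N by simp
qed

text \<open>The matrix of \<open>y'' = - \<mu> y\<close> has the eigenvectors \<open>(1, \<plusminus> \<i> \<surd>\<mu>)\<close>.\<close>

lemma oscillatory_harmonic_oscillator:
  assumes "\<mu> > 0"
  shows "oscillatory (Matrix.mat 2 2 (\<lambda>(i, j). if i = 0 then (if j = 0 then 0 else 1) else (if j = 0 then - \<mu> else 0)))"
    (is "oscillatory ?N")
proof -
  define w where "w = complex_of_real (sqrt \<mu>)"
  have w: "w \<noteq> 0" "w * w = complex_of_real \<mu>"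
    using assms by (simp_all add: w_def flip: of_real_mult)
  let ?N' = "map_mat complex_of_real ?N"
  let ?D = "Matrix.mat 2 2 (\<lambda>(i, j). if i = j then (if i = 0 then \<i> * w else - (\<i> * w)) else 0)"
  let ?P = "Matrix.mat 2 2 (\<lambda>(i, j). if i = 0 then 1 else (if j = 0 then \<i> * w else - (\<i> * w)))"
  let ?Q = "Matrix.mat 2 2 (\<lambda>(i, j). if j = 0 then 1/2 else (if i = 0 then 1 / (2 * \<i> * w) else - 1 / (2 * \<i> * w)))"
  have "similar_mat_wit ?N' ?D ?P ?Q"
    unfolding similar_mat_wit_def Let_def
    using w by (auto simp: scalar_prod_def numeral_2_eq_2 less_Suc_eq divide_simps mult_ac intro!: eq_matI)
  then have "similar_mat ?N' ?D" unfolding similar_mat_def by blast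
  moreover have "diagonal_mat ?D" by (auto simp: diagonal_mat_def)
  moreover have "z \<noteq> 0 \<and> Re z = 0" if "eigenvalue ?N' z" for z
  proof -
    obtain v where v: "v \<in> carrier_vec 2" "v \<noteq> 0\<^sub>v 2" "?N' *\<^sub>v v = z \<cdot>\<^sub>v v"
      using \<open>eigenvalue ?N' z\<close> unfolding eigenvalue_def eigenvector_def by auto
    have d: "dim_vec v = 2" using v(1) by simp
    have "vec_index (?N' *\<^sub>v v) 0 = z * vec_index v 0" "vec_index (?N' *\<^sub>v v) 1 = z * vec_index v 1"
      using v(1) unfolding v(3) by auto
    then have e: "vec_index v 1 = z * vec_index v 0" "- complex_of_real \<mu> * vec_index v 0 = z * vec_index v 1"
      using d by (auto simp: scalar_prod_def numeral_2_eq_2)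
    have "vec_index v 0 \<noteq> 0"
    proof
      assume "vec_index v 0 = 0"
      then have "v = 0\<^sub>v 2" using e(1) d by (auto intro!: eq_vecI simp: numeral_2_eq_2 less_Suc_eq)
      then show False using v(2) by simp
    qed
    then have zz: "z * z = - complex_of_real \<mu>" 
    proof -
      have "(z * z + complex_of_real \<mu>) * vec_index v 0 = 0"
        using e(2) unfolding e(1) by (simp add: distrib_right mult.assoc) (metis add.right_inverse add.commute)
      then show ?thesis using \<open>vec_index v 0 \<noteq> 0\<close> by (simp add: add_eq_0_iff2)
    qed
    then have "z \<noteq> 0" using assms by auto
    have "Re z * Re z - Im z * Im z = - \<mu>" "2 * (Re z * Im z) = 0"
      using zz by (auto simp: complex_eq_iff)
    then have "Re z = 0" using assms by (smt (verit) mult_eq_0_iff not_real_square_gt_zero)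
    then show ?thesis using \<open>z \<noteq> 0\<close> by simp
  qed
  ultimately show ?thesis unfolding oscillatory_def Let_def by blast
qed

text \<open>The coordinates \<open>(g \<bullet> m q, g \<bullet> p)\<close> represent the uncontrollable part by the matrix of \<open>y'' = - \<mu> y\<close>. If
  \<open>\<mu> \<le> 0\<close>, then in every other representation the image of \<open>x = (q1, \<surd>(- \<mu>) p1)\<close> is an eigenvector with the real
  eigenvalue \<open>\<surd>(- \<mu>)\<close>, which contradicts being oscillatory.\<close>

lemma oscillatory_iff_positive:
  fixes m P :: "real^'n^'n" and B :: "real^'m^'n"
  assumes n: "CARD('n) = CARD('m) + 1" and m: "sym_pos_def m"
    and P: "Finite_Cartesian_Product.transpose P = P" and g: "annihilates g B"
    and par: "P *v g = \<mu> *\<^sub>R (m *v g)"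
  shows "uncontrollable_part_oscillatory (lin_A m P) (lin_B B) \<longleftrightarrow> \<mu> > 0"
proof -
  let ?A = "lin_A m P"
  have gg: "g \<bullet> g \<noteq> 0" using g by (simp add: annihilates_def)
  define p1 where "p1 = (1 / (g \<bullet> g)) *\<^sub>R g"
  define q1 where "q1 = matrix_inv m *v p1"
  have mq1: "m *v q1 = p1" by (simp add: q1_def sym_pos_def_cancel[OF m])
  have gp1: "g \<bullet> p1 = 1" using gg by (simp add: p1_def)
  have gP: "g \<bullet> (P *v q) = \<mu> * (g \<bullet> (m *v q))" for q
    using symmetric_matrix_inner[OF P, of g q] par sym_pos_def_inner[OF m, of g q] by simp
  note K = controllable_subspace_degenerate[OF n m P g par]
  show ?thesis
  proof
    assume "uncontrollable_part_oscillatory ?A (lin_B B)"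
    then obtain N k \<pi> where \<pi>: "quotient_map (controllable_subspace ?A (lin_B B)) k \<pi>"
      and N: "N \<in> carrier_mat k k" "\<And>x. \<pi> (?A x) = N *\<^sub>v \<pi> x" and osc: "oscillatory N"
      unfolding uncontrollable_part_oscillatory_def is_uncontrollable_part_def by blast
    have add: "\<pi> (x + y) = \<pi> x + \<pi> y" and scale: "\<pi> (c *\<^sub>R x) = c \<cdot>\<^sub>v \<pi> x" and car: "\<pi> x \<in> carrier_vec k"
      and ker: "\<pi> x = 0\<^sub>v k \<longleftrightarrow> x \<in> {(q, p). g \<bullet> (m *v q) = 0 \<and> g \<bullet> p = 0}" for x y c
      using \<pi> unfolding quotient_map_def K by blast+
    show "\<mu> > 0"
    proof (rule ccontr)
      assume neg: "\<not> \<mu> > 0"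
      \<comment> \<open>The vector \<open>x\<close> below satisfies \<open>A x = z x\<close> up to the element \<open>y\<close> of the controllable subspace.\<close>
      define z where "z = sqrt (- \<mu>)"
      have zz: "z * z = - \<mu>" using neg by (simp add: z_def)
      define x where "x = (q1, z *\<^sub>R p1)"
      define y where "y = (0 :: real^'n, - (P *v q1) + \<mu> *\<^sub>R p1)"
      have Ax: "?A x = z *\<^sub>R x + y"
        using zz by (simp add: x_def y_def lin_A_def q1_def matrix_vector_mult_scaleR)
      have "\<pi> y = 0\<^sub>v k"
        unfolding ker using gp1 by (simp add: y_def inner_add_right inner_diff_right gP mq1)
      then have "\<pi> (?A x) = z \<cdot>\<^sub>v \<pi> x"
        unfolding Ax add scale using car[of x] by simp
      then have "N *\<^sub>v \<pi> x = z \<cdot>\<^sub>v \<pi> x" using N(2) by simp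
      moreover have "\<pi> x \<noteq> 0\<^sub>v k" unfolding ker using gp1 by (simp add: x_def mq1)
      ultimately have "eigenvalue (map_mat complex_of_real N) (complex_of_real z)"
        using eigenvalue_of_real_matrix[OF N(1) car] by blast
      then have "complex_of_real z \<noteq> 0 \<and> Re (complex_of_real z) = 0"
        using osc unfolding oscillatory_def Let_def by blast
      then show False by simp
    qed
  next
    assume mu: "\<mu> > 0"
    let ?N = "Matrix.mat 2 2 (\<lambda>(i, j). if i = 0 then (if j = 0 then 0 else 1) else (if j = 0 then - \<mu> else 0)) :: real Matrix.mat"
    define \<pi> where "\<pi> = (\<lambda>(q, p). Matrix.vec 2 (\<lambda>i. if i = 0 then g \<bullet> (m *v q) else g \<bullet> p))"
    have "range \<pi> = carrier_vec 2"
    proof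
      show "range \<pi> \<subseteq> carrier_vec 2" by (auto simp: \<pi>_def)
      show "carrier_vec 2 \<subseteq> range \<pi>"
      proof
        fix v :: "real Matrix.vec" assume "v \<in> carrier_vec 2"
        then have "v = \<pi> (vec_index v 0 *\<^sub>R q1, vec_index v 1 *\<^sub>R p1)"
          using gp1 by (auto intro!: eq_vecI simp: \<pi>_def matrix_vector_mult_scaleR mq1 numeral_2_eq_2 less_Suc_eq)
        then show "v \<in> range \<pi>" by blast
      qed
    qed
    moreover have "\<pi> (x + y) = \<pi> x + \<pi> y" for x y
      by (cases x; cases y) (auto intro!: eq_vecI simp: \<pi>_def matrix_vector_right_distrib inner_add_right)
    moreover have "\<pi> (c *\<^sub>R x) = c \<cdot>\<^sub>v \<pi> x" for c x
      by (cases x) (auto intro!: eq_vecI simp: \<pi>_def matrix_vector_mult_scaleR)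
    moreover have "\<pi> x = 0\<^sub>v 2 \<longleftrightarrow> x \<in> {(q, p). g \<bullet> (m *v q) = 0 \<and> g \<bullet> p = 0}" for x
    proof -
      have "v = 0\<^sub>v 2 \<longleftrightarrow> vec_index v 0 = 0 \<and> vec_index v 1 = 0" if "v \<in> carrier_vec 2" for v :: "real Matrix.vec"
        using that by (auto intro!: eq_vecI simp: numeral_2_eq_2 less_Suc_eq)
      then have "\<pi> x = 0\<^sub>v 2 \<longleftrightarrow> vec_index (\<pi> x) 0 = 0 \<and> vec_index (\<pi> x) 1 = 0" by (auto simp: \<pi>_def split_beta)
      then show ?thesis by (cases x) (simp add: \<pi>_def)
    qed
    ultimately have "quotient_map (controllable_subspace ?A (lin_B B)) 2 \<pi>"
      unfolding quotient_map_def K by blast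
    moreover have "\<pi> (?A x) = ?N *\<^sub>v \<pi> x" for x
      by (cases x) (auto intro!: eq_vecI simp: \<pi>_def lin_A_def scalar_prod_def numeral_2_eq_2 less_Suc_eq
          sym_pos_def_cancel[OF m] gP)
    ultimately have "is_uncontrollable_part ?A (lin_B B) ?N"
      unfolding is_uncontrollable_part_def by (intro exI[of _ 2] exI[of _ \<pi>]) auto
    then show "uncontrollable_part_oscillatory ?A (lin_B B)"
      unfolding uncontrollable_part_oscillatory_def using oscillatory_harmonic_oscillator[OF mu] by blast
  qed
qed

section \<open>Gradients and Hessians of mechanical Hamiltonians\<close>

lemma bounded_bilinear_matrix_vector_mult:
  "bounded_bilinear (\<lambda>(A :: real^'n^'m) x. A *v x)"
  by (rule bilinear_conv_bounded_bilinear[THEN iffD1])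
    (auto simp: bilinear_def matrix_vector_mult_scaleR matrix_vector_right_distrib matrix_vector_mult_add_rdistrib
      scaleR_matrix_vector_assoc[symmetric] intro!: linearI)

lemmas has_derivative_matrix_vector_mult = bounded_bilinear.FDERIV[OF bounded_bilinear_matrix_vector_mult]

lemma has_derivative_matrix_vector_mult_zero:
  fixes A :: "'a::real_normed_vector \<Rightarrow> real^'n^'m"
  assumes "smooth_on UNIV A" "(y has_derivative y') (at x)" "y x = 0"
  shows "((\<lambda>x. A x *v y x) has_derivative (\<lambda>v. A x *v y' v)) (at x)"
  using has_derivative_matrix_vector_mult[OF smooth_on_has_derivative[OF assms(1) UNIV_I] assms(2)]
  by (simp add: assms(3))

lemma grad_inner:
  assumes "(f has_derivative f') (at x)"
  shows "grad f x \<bullet> v = f' v"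
proof -
  have lin: "linear f'" using assms by (rule has_derivative_linear)
  have "frechet_derivative f (at x) = f'" using frechet_derivative_at[OF assms] by simp
  then have "grad f x \<bullet> v = (\<Sum>i\<in>UNIV. v $ i * f' (axis i 1))"
    by (simp add: grad_def inner_vec_def mult.commute)
  also have "\<dots> = f' (\<Sum>i\<in>UNIV. v $ i *\<^sub>R axis i 1)"
    by (simp add: linear_sum[OF lin] linear_scale[OF lin])
  also have "(\<Sum>i\<in>UNIV. v $ i *\<^sub>R axis i 1) = v"
    using basis_expansion[of v] by (simp add: scalar_mult_eq_scaleR)
  finally show ?thesis .
qed

lemma grad_inner_smooth:
  "smooth_on UNIV f \<Longrightarrow> grad f x \<bullet> v = dderiv f v x"
  using grad_inner[OF smooth_on_has_derivative] by blast

lemma hessian_mult: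
  assumes "smooth_on UNIV f" shows "hessian f x *v v = dderiv (grad f) v x"
  unfolding hessian_def jacobian_def
  using matrix_vector_mul(2)[OF has_derivative_linear[OF smooth_on_has_derivative[OF smooth_on_grad[OF open_UNIV assms] UNIV_I]]]
  by metis

lemma hessian_inner:
  assumes f: "smooth_on UNIV f" shows "w \<bullet> (hessian f x *v v) = D2 f x w v"
proof -
  have "((\<lambda>y. w \<bullet> grad f y) has_derivative (\<lambda>v. w \<bullet> dderiv (grad f) v x)) (at x)"
    by (intro has_derivative_inner_right smooth_on_has_derivative[OF smooth_on_grad[OF open_UNIV f] UNIV_I])
  moreover have "(\<lambda>y. w \<bullet> grad f y) = (\<lambda>y. dderiv f w y)"
    using grad_inner_smooth[OF f] by (simp add: inner_commute)
  ultimately have "frechet_derivative (\<lambda>y. dderiv f w y) (at x) = (\<lambda>v. w \<bullet> dderiv (grad f) v x)"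
    using frechet_derivative_at by metis
  then show ?thesis by (simp add: D2_def hessian_mult[OF f])
qed

lemma hessian_symmetric:
  assumes f: "smooth_on UNIV f" shows "Finite_Cartesian_Product.transpose (hessian f x) = hessian f x"
proof -
  have "Finite_Cartesian_Product.transpose (hessian f x) *v v = hessian f x *v v" for v
  proof (rule vector_eq_rdot[THEN iffD1], rule allI)
    fix w
    have "(Finite_Cartesian_Product.transpose (hessian f x) *v v) \<bullet> w = v \<bullet> (hessian f x *v w)"
      by (simp add: dot_lmul_matrix)
    also have "\<dots> = w \<bullet> (hessian f x *v v)"
      by (simp add: hessian_inner[OF f] D2_symmetric[OF open_UNIV f UNIV_I, of x v w])
    finally show "(Finite_Cartesian_Product.transpose (hessian f x) *v v) \<bullet> w = (hessian f x *v v) \<bullet> w"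
      by (simp add: inner_commute)
  qed
  then show ?thesis by (simp add: matrix_eq)
qed

lemma smooth_inverse_mass:
  assumes "smooth_on UNIV M" "\<And>q. sym_pos_def (M q)"
  shows "smooth_on UNIV (\<lambda>q. matrix_inv (M q))"
  using assms by (intro smooth_on_matrix_inv) (auto intro: sym_pos_def_invertible)

lemma smooth_on_compose_fst:
  fixes f :: "'a::euclidean_space \<Rightarrow> 'b::real_normed_vector"
  shows "smooth_on UNIV f \<Longrightarrow> smooth_on UNIV (\<lambda>x :: 'a \<times> 'c::real_normed_vector. f (fst x))"
  by (rule smooth_on_compose_UNIV) (auto intro!: smooth_intros)

lemma hamiltonian_has_derivative:
  assumes M: "smooth_on UNIV M" "\<And>q. sym_pos_def (M q)" and V: "smooth_on UNIV V"
  shows "(hamiltonian M V has_derivative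
    (\<lambda>v. 1/2 * (p \<bullet> (dderiv (\<lambda>q. matrix_inv (M q)) (fst v) q *v p)) + snd v \<bullet> (matrix_inv (M q) *v p) + dderiv V (fst v) q)) (at (q, p))"
proof -
  let ?A = "\<lambda>q. matrix_inv (M q)"
  have f: "(fst has_derivative fst) (at (q, p))" "(snd has_derivative snd) (at (q, p))"
    by (auto intro!: derivative_eq_intros)
  have A: "((\<lambda>x. ?A (fst x)) has_derivative (\<lambda>v. dderiv ?A (fst v) q)) (at (q, p))"
    using has_derivative_compose[OF f(1), of ?A] smooth_on_has_derivative[OF smooth_inverse_mass[OF M] UNIV_I, of q] by simp
  have V': "((\<lambda>x. V (fst x)) has_derivative (\<lambda>v. dderiv V (fst v) q)) (at (q, p))"
    using has_derivative_compose[OF f(1), of V] smooth_on_has_derivative[OF V UNIV_I, of q] by simp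
  have "(hamiltonian M V has_derivative
    (\<lambda>v. 1/2 * (p \<bullet> (?A q *v snd v + dderiv ?A (fst v) q *v p) + snd v \<bullet> (?A q *v p)) + dderiv V (fst v) q)) (at (q, p))"
    unfolding hamiltonian_def split_beta
    using has_derivative_add[OF has_derivative_mult_right[OF has_derivative_inner[OF f(2) has_derivative_matrix_vector_mult[OF A f(2)]], of "1/2"] V']
    by simp
  then show ?thesis
    using sym_pos_def_inner[OF sym_pos_def_matrix_inv[OF M(2)], of p q]
    by (simp add: inner_add_right algebra_simps inner_commute)
qed

lemma grad_p_hamiltonian:
  assumes M: "smooth_on UNIV M" "\<And>q. sym_pos_def (M q)" and V: "smooth_on UNIV V"
  shows "grad_p (hamiltonian M V) (q, p) = matrix_inv (M q) *v p"
proof (rule vector_eq_rdot[THEN iffD1], rule allI)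
  fix v
  have "((\<lambda>p'. (q, p')) has_derivative (\<lambda>b. (0, b))) (at p)" by (auto intro!: derivative_eq_intros)
  from has_derivative_compose[OF this hamiltonian_has_derivative[OF M V, of p q]]
  have "((\<lambda>p'. hamiltonian M V (q, p')) has_derivative
     (\<lambda>b. 1/2 * (p \<bullet> (dderiv (\<lambda>q. matrix_inv (M q)) 0 q *v p)) + b \<bullet> (matrix_inv (M q) *v p) + dderiv V 0 q)) (at p)"
    by simp
  from grad_inner[OF this, of v]
  show "grad_p (hamiltonian M V) (q, p) \<bullet> v = (matrix_inv (M q) *v p) \<bullet> v"
    using linear_0[OF dderiv_linear[OF smooth_inverse_mass[OF M] UNIV_I]] linear_0[OF dderiv_linear[OF V UNIV_I]]
    by (simp add: grad_p_def inner_commute)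
qed

lemma grad_q_hamiltonian_inner:
  assumes M: "smooth_on UNIV M" "\<And>q. sym_pos_def (M q)" and V: "smooth_on UNIV V"
  shows "grad_q (hamiltonian M V) (q, p) \<bullet> w =
    1/2 * (p \<bullet> (dderiv (\<lambda>q. matrix_inv (M q)) w q *v p)) + grad V q \<bullet> w"
proof -
  have "((\<lambda>q'. (q', p)) has_derivative (\<lambda>a. (a, 0))) (at q)" by (auto intro!: derivative_eq_intros)
  from has_derivative_compose[OF this hamiltonian_has_derivative[OF M V, of p q]]
  have "((\<lambda>q'. hamiltonian M V (q', p)) has_derivative
     (\<lambda>a. 1/2 * (p \<bullet> (dderiv (\<lambda>q. matrix_inv (M q)) a q *v p)) + dderiv V a q)) (at q)"
    by simp
  from grad_inner[OF this, of w] show ?thesis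
    by (simp add: grad_q_def grad_inner_smooth[OF V])
qed

text \<open>The part of the configuration gradient that is quadratic in the momentum, written as a matrix that is
  linear in the momentum, to be applied to the momentum. Both factors vanish at \<open>p = 0\<close>, so the product rule
  shows at once that this part does not contribute to linearizations.\<close>

definition kinetic_grad_matrix :: "(real^'n \<Rightarrow> real^'n^'n) \<Rightarrow> (real^'n) \<times> (real^'n) \<Rightarrow> real^'n^'n" where
  "kinetic_grad_matrix M x = (\<chi> i. (1/2) *\<^sub>R (snd x v* dderiv (\<lambda>q. matrix_inv (M q)) (axis i 1) (fst x)))"

lemma grad_q_hamiltonian:
  assumes M: "smooth_on UNIV M" "\<And>q. sym_pos_def (M q)" and V: "smooth_on UNIV V"
  shows "grad_q (hamiltonian M V) x = kinetic_grad_matrix M x *v snd x + grad V (fst x)"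
proof -
  obtain q p where x: "x = (q, p)" by (cases x)
  have "grad_q (hamiltonian M V) (q, p) $ i = (kinetic_grad_matrix M (q, p) *v p + grad V q) $ i" for i
  proof -
    have "(kinetic_grad_matrix M (q, p) *v p) $ i = kinetic_grad_matrix M (q, p) $ i \<bullet> p"
      by (simp add: matrix_vector_mul_component)
    then have "(kinetic_grad_matrix M (q, p) *v p + grad V q) $ i =
        1/2 * (p \<bullet> (dderiv (\<lambda>q. matrix_inv (M q)) (axis i 1) q *v p)) + grad V q \<bullet> axis i 1"
      by (simp add: kinetic_grad_matrix_def dot_lmul_matrix inner_axis)
    also have "\<dots> = grad_q (hamiltonian M V) (q, p) \<bullet> axis i 1"
      using grad_q_hamiltonian_inner[OF M V] by simp
    finally show ?thesis by (simp add: inner_axis)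
  qed
  then show ?thesis by (simp add: x Finite_Cartesian_Product.vec_eq_iff)
qed

lemma smooth_kinetic_grad_matrix:
  assumes M: "smooth_on UNIV M" "\<And>q. sym_pos_def (M q)"
  shows "smooth_on UNIV (kinetic_grad_matrix M)"
  unfolding kinetic_grad_matrix_def transpose_matrix_vector[symmetric]
  by (intro smooth_on_vec_lambda smooth_on_scaleR smooth_on_const smooth_on_matrix_vector_mult smooth_on_transpose
      smooth_on_compose_fst[OF smooth_on_dderiv[OF smooth_inverse_mass[OF M]]] smooth_on_snd smooth_on_ident open_UNIV)

lemma grad_q_hamiltonian_has_derivative:
  fixes M :: "real^'n \<Rightarrow> real^'n^'n" and V :: "real^'n \<Rightarrow> real"
  assumes M: "smooth_on UNIV M" "\<And>q. sym_pos_def (M q)" and V: "smooth_on UNIV V"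
  shows "(grad_q (hamiltonian M V) has_derivative (\<lambda>v. hessian V 0 *v fst v)) (at 0)"
proof -
  let ?K = "kinetic_grad_matrix M"
  have s: "(snd has_derivative snd) (at (0 :: (real^'n) \<times> (real^'n)))" and f: "(fst has_derivative fst) (at (0 :: (real^'n) \<times> (real^'n)))"
    by (auto intro!: derivative_eq_intros)
  have "?K 0 = 0" by (simp add: kinetic_grad_matrix_def Finite_Cartesian_Product.vec_eq_iff vector_matrix_mult_def)
  then have "((\<lambda>x. ?K x *v snd x) has_derivative (\<lambda>v. 0)) (at 0)"
    using has_derivative_matrix_vector_mult_zero[OF smooth_kinetic_grad_matrix[OF M] s] by simp
  moreover have "((\<lambda>x. grad V (fst x)) has_derivative (\<lambda>v. hessian V 0 *v fst v)) (at (0 :: (real^'n) \<times> (real^'n)))"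
    unfolding hessian_mult[OF V]
    using has_derivative_compose[OF f, of "grad V"] smooth_on_has_derivative[OF smooth_on_grad[OF open_UNIV V] UNIV_I, of 0] by simp
  ultimately have "((\<lambda>x. ?K x *v snd x + grad V (fst x)) has_derivative (\<lambda>v. 0 + hessian V 0 *v fst v)) (at 0)"
    by (rule has_derivative_add)
  then show ?thesis by (simp add: grad_q_hamiltonian[OF M V, abs_def])
qed

text \<open>At the origin the mixed second derivatives vanish, because the kinetic energy is quadratic in \<open>p\<close>.\<close>

lemma hamiltonian_D2:
  fixes M :: "real^'n \<Rightarrow> real^'n^'n" and V :: "real^'n \<Rightarrow> real"
  assumes M: "smooth_on UNIV M" "\<And>q. sym_pos_def (M q)" and V: "smooth_on UNIV V"
  shows "D2 (hamiltonian M V) (0, 0) v w = D2 V 0 (fst v) (fst w) + snd v \<bullet> (matrix_inv (M 0) *v snd w)"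
proof -
  let ?X = "\<lambda>q. dderiv (\<lambda>q. matrix_inv (M q)) (fst v) q"
  have s: "(snd has_derivative snd) (at (0 :: (real^'n) \<times> (real^'n)))" and f: "(fst has_derivative fst) (at (0 :: (real^'n) \<times> (real^'n)))"
    by (auto intro!: derivative_eq_intros)
  have eq: "(\<lambda>x. dderiv (hamiltonian M V) v x) =
      (\<lambda>x. 1/2 * (snd x \<bullet> (?X (fst x) *v snd x)) + snd v \<bullet> (matrix_inv (M (fst x)) *v snd x) + dderiv V (fst v) (fst x))"
  proof
    fix x :: "(real^'n) \<times> (real^'n)"
    obtain q p where "x = (q, p)" by (cases x)
    then show "dderiv (hamiltonian M V) v x = 1/2 * (snd x \<bullet> (?X (fst x) *v snd x)) + snd v \<bullet> (matrix_inv (M (fst x)) *v snd x) + dderiv V (fst v) (fst x)"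
      using frechet_derivative_at[OF hamiltonian_has_derivative[OF M V, of p q], symmetric] by simp
  qed
  note sI = smooth_inverse_mass[OF M]
  have "((\<lambda>x. ?X (fst x) *v snd x) has_derivative (\<lambda>w. ?X 0 *v snd w)) (at 0)"
    using has_derivative_matrix_vector_mult_zero[OF smooth_on_compose_fst[OF smooth_on_dderiv[OF sI]] s] by simp
  from has_derivative_inner[OF s this]
  have 1: "((\<lambda>x. snd x \<bullet> (?X (fst x) *v snd x)) has_derivative (\<lambda>w. 0)) (at 0)" by simp
  have "((\<lambda>x. matrix_inv (M (fst x)) *v snd x) has_derivative (\<lambda>w. matrix_inv (M 0) *v snd w)) (at 0)"
    using has_derivative_matrix_vector_mult_zero[OF smooth_on_compose_fst[OF sI] s] by simp
  from has_derivative_inner_right[OF this, of "snd v"]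
  have 2: "((\<lambda>x. snd v \<bullet> (matrix_inv (M (fst x)) *v snd x)) has_derivative (\<lambda>w. snd v \<bullet> (matrix_inv (M 0) *v snd w))) (at 0)" .
  have 3: "((\<lambda>x. dderiv V (fst v) (fst x)) has_derivative (\<lambda>w. D2 V 0 (fst v) (fst w))) (at (0 :: (real^'n) \<times> (real^'n)))"
    unfolding D2_def
    using has_derivative_compose[OF f, of "\<lambda>q. dderiv V (fst v) q"]
      smooth_on_has_derivative[OF smooth_on_dderiv[OF V] UNIV_I, of "fst v" 0] by simp
  have "((\<lambda>x. dderiv (hamiltonian M V) v x) has_derivative
      (\<lambda>w. 1/2 * 0 + snd v \<bullet> (matrix_inv (M 0) *v snd w) + D2 V 0 (fst v) (fst w))) (at 0)"
    unfolding eq by (intro has_derivative_add has_derivative_mult_right 1 2 3)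
  from frechet_derivative_at[OF this, symmetric]
  show ?thesis by (simp add: D2_def zero_prod_def)
qed

text \<open>At a local minimum the Hessian of \<open>V\<close> is positive semidefinite, and a semidefinite form that vanishes
  on a vector \<open>v\<close> has \<open>v\<close> in its kernel, since otherwise a small step from \<open>v\<close> would make it negative.
  Nondegeneracy thus amounts to definiteness.\<close>

lemma nondegenerate_local_min_hamiltonian:
  fixes M :: "real^'n \<Rightarrow> real^'n^'n" and V :: "real^'n \<Rightarrow> real"
  assumes M: "smooth_on UNIV M" "\<And>q. sym_pos_def (M q)" and V: "smooth_on UNIV V"
  shows "nondegenerate_local_min (hamiltonian M V) (0, 0) \<longleftrightarrow> grad V 0 = 0 \<and> sym_pos_def (hessian V 0)"
proof
  let ?H = "hamiltonian M V"
  note iM = sym_pos_def_matrix_inv[OF M(2)]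
  assume nd: "nondegenerate_local_min ?H (0, 0)"
  then have "\<forall>\<^sub>F y in nhds (0, 0). ?H (0, 0) \<le> ?H y" by (simp add: nondegenerate_local_min_def)
  moreover have "filterlim (\<lambda>q. (q, 0)) (nhds (0 :: real^'n, 0 :: real^'n)) (nhds 0)"
    by (intro tendsto_Pair filterlim_ident tendsto_const)
  ultimately have "\<forall>\<^sub>F q in nhds 0. ?H (0, 0) \<le> ?H (q, 0)" unfolding filterlim_iff by blast
  then have min: "\<forall>\<^sub>F q in nhds 0. V 0 \<le> V q" by (simp add: hamiltonian_def)
  have "grad V 0 = 0"
    by (rule vector_eq_rdot[THEN iffD1])
      (simp add: grad_inner_smooth[OF V] local_min_first_order[OF V UNIV_I min])
  have psd: "0 \<le> D2 V 0 v v" for v using local_min_second_order[OF V min] .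
  note l = D2_linear_left[OF open_UNIV V UNIV_I] and r = D2_linear_right[OF V UNIV_I]
  have "0 < D2 V 0 v v" if "v \<noteq> 0" for v
  proof (rule ccontr)
    assume "\<not> 0 < D2 V 0 v v"
    then have v0: "D2 V 0 v v = 0" using psd[of v] by simp
    have "D2 V 0 v w = 0" for w
    proof (rule ccontr)
      define b where "b = D2 V 0 v w"
      define c where "c = D2 V 0 w w"
      assume "D2 V 0 v w \<noteq> 0"
      then have b: "b \<noteq> 0" by (simp add: b_def)
      have c: "c \<ge> 0" using psd by (simp add: c_def)
      \<comment> \<open>A step that makes the linear term \<open>2 t b\<close> outweigh the quadratic term \<open>t\<^sup>2 c\<close>.\<close>
      define t where "t = - b / (c + 1)"
      have "D2 V 0 (v + t *\<^sub>R w) (v + t *\<^sub>R w) = 2 * t * b + t\<^sup>2 * c"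
        using D2_symmetric[OF open_UNIV V UNIV_I, of 0 w v]
        by (simp add: linear_add[OF l] linear_add[OF r] linear_scale[OF l] linear_scale[OF r] v0 b_def c_def
            power2_eq_square algebra_simps)
      then have "0 \<le> 2 * t * b + t\<^sup>2 * c" using psd by metis
      moreover have "2 * t * b + t\<^sup>2 * c = b\<^sup>2 * (- c - 2) / (c + 1)\<^sup>2"
        using c by (simp add: t_def power2_eq_square divide_simps) (simp add: algebra_simps)
      moreover have "b\<^sup>2 * (- c - 2) / (c + 1)\<^sup>2 < 0"
        using b c by (intro divide_neg_pos mult_pos_neg) auto
      ultimately show False by simp
    qed
    then have "D2 ?H (0, 0) (v, 0) w = 0" for w by (simp add: hamiltonian_D2[OF M V])
    then have "(v, 0) = (0 :: (real^'n) \<times> (real^'n))" using nd unfolding nondegenerate_local_min_def by blast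
    then show False using that by (simp add: zero_prod_def)
  qed
  then have "sym_pos_def (hessian V 0)"
    by (simp add: sym_pos_def_def hessian_symmetric[OF V] hessian_inner[OF V])
  then show "grad V 0 = 0 \<and> sym_pos_def (hessian V 0)" using \<open>grad V 0 = 0\<close> by blast
next
  let ?H = "hamiltonian M V"
  note iM = sym_pos_def_matrix_inv[OF M(2)]
  assume a: "grad V 0 = 0 \<and> sym_pos_def (hessian V 0)"
  have pos: "0 < D2 V 0 v v" if "v \<noteq> 0" for v
    using a that by (simp add: sym_pos_def_def flip: hessian_inner[OF V])
  have "\<forall>\<^sub>F q in nhds 0. V 0 \<le> V q"
    using second_order_sufficient[OF V _ pos] a by (simp flip: grad_inner_smooth[OF V])
  moreover have "filterlim fst (nhds 0) (nhds (0 :: real^'n, 0 :: real^'n))"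
    using tendsto_fst[OF filterlim_ident[of "nhds (0 :: real^'n, 0 :: real^'n)"]] by simp
  ultimately have "\<forall>\<^sub>F y in nhds (0 :: real^'n, 0 :: real^'n). V 0 \<le> V (fst y)"
    unfolding filterlim_iff by blast
  then have "\<forall>\<^sub>F y in nhds (0, 0). ?H (0, 0) \<le> ?H y"
  proof eventually_elim
    case (elim y)
    have "0 \<le> snd y \<bullet> (matrix_inv (M (fst y)) *v snd y)"
      using iM unfolding sym_pos_def_def by (cases "snd y = 0") (auto simp: less_imp_le)
    then show ?case using elim by (simp add: hamiltonian_def split_beta)
  qed
  moreover have "v = 0" if v: "\<forall>w. D2 ?H (0, 0) v w = 0" for v
  proof -
    have "D2 V 0 (fst v) (fst v) = 0" using v[rule_format, of "(fst v, 0)"] by (simp add: hamiltonian_D2[OF M V])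
    moreover have "snd v \<bullet> (matrix_inv (M 0) *v snd v) = 0"
      using v[rule_format, of "(0, snd v)"] linear_0[OF D2_linear_right[OF V UNIV_I]]
      by (simp add: hamiltonian_D2[OF M V])
    ultimately have "fst v = 0" "snd v = 0"
      using pos[of "fst v"] iM[of 0] unfolding sym_pos_def_def by auto
    then show ?thesis by (simp add: prod_eq_iff)
  qed
  ultimately show "nondegenerate_local_min ?H (0, 0)" unfolding nondegenerate_local_min_def by blast
qed

section \<open>The closed loop and its linearization\<close>

text \<open>The gyroscopic force is this matrix, which is linear in the momentum, applied to the velocity
  \<open>Mh\<^sup>-\<^sup>1 p\<close>; it is of second order at the origin.\<close>

definition gyroscopic_matrix ::
    "(real^'n \<Rightarrow> real^'n^'n) \<Rightarrow> (real^'n \<Rightarrow> real^'n^'n^'n) \<Rightarrow> (real^'n) \<times> (real^'n) \<Rightarrow> real^'n^'n" where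
  "gyroscopic_matrix Mh C x = (\<chi> k j. \<Sum>i\<in>UNIV. C (fst x) $ i $ j $ k * (matrix_inv (Mh (fst x)) *v snd x) $ i)"

lemma gyroscopic_force_eq:
  "gyroscopic_force Mh C x = gyroscopic_matrix Mh C x *v (matrix_inv (Mh (fst x)) *v snd x)"
proof -
  obtain q p where x: "x = (q, p)" by (cases x)
  let ?I = "matrix_inv (Mh q)"
  have "(\<Sum>i\<in>UNIV. \<Sum>j\<in>UNIV. \<Sum>l\<in>UNIV. \<Sum>r\<in>UNIV. C q $ i $ j $ k * ?I $ i $ l * ?I $ j $ r * p $ l * p $ r)
      = (\<Sum>i\<in>UNIV. \<Sum>j\<in>UNIV. C q $ i $ j $ k * (?I *v p) $ i * (?I *v p) $ j)" for k
    by (simp add: matrix_vector_mult_def sum_distrib_left sum_distrib_right mult_ac)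
  also have "\<dots> k = (\<Sum>j\<in>UNIV. (\<Sum>i\<in>UNIV. C q $ i $ j $ k * (?I *v p) $ i) * (?I *v p) $ j)" for k
    by (subst sum.swap) (simp add: sum_distrib_right)
  finally show ?thesis
    by (simp add: x gyroscopic_force_def gyroscopic_matrix_def Finite_Cartesian_Product.vec_eq_iff matrix_vector_mult_def)
qed

lemma smooth_gyroscopic_matrix:
  assumes "smooth_on UNIV Mh" "\<And>q. sym_pos_def (Mh q)" "smooth_on UNIV C"
  shows "smooth_on UNIV (gyroscopic_matrix Mh C)"
  unfolding gyroscopic_matrix_def
  by (intro smooth_on_vec_lambda smooth_on_sum smooth_on_mult smooth_on_vec_nth smooth_on_compose_fst[OF assms(3)]
      smooth_on_matrix_vector_mult smooth_on_compose_fst[OF smooth_inverse_mass[OF assms(1,2)]] smooth_on_snd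
      smooth_on_ident open_UNIV)

lemma closed_loop_field_eq:
  assumes Mh: "smooth_on UNIV Mh" "\<And>q. sym_pos_def (Mh q)" and Vh: "smooth_on UNIV Vh"
  shows "closed_loop_field M G Mh Vh Kd C x =
    (matrix_inv (M (fst x)) *v snd x,
     - ((Mh (fst x) ** matrix_inv (M (fst x))) *v grad_q (hamiltonian Mh Vh) x)
     - (G (fst x) ** Kd (fst x) ** Finite_Cartesian_Product.transpose (G (fst x))) *v (matrix_inv (Mh (fst x)) *v snd x)
     + gyroscopic_matrix Mh C x *v (matrix_inv (Mh (fst x)) *v snd x))"
proof -
  obtain q p where x: "x = (q, p)" by (cases x)
  have "(matrix_inv (M q) ** Mh q) *v (matrix_inv (Mh q) *v p) = matrix_inv (M q) *v p"
    by (simp add: matrix_vector_mul_assoc[symmetric] sym_pos_def_cancel[OF Mh(2)])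
  then show ?thesis
    using gyroscopic_force_eq[of Mh C "(q, p)"]
    by (simp add: x closed_loop_field_def Let_def grad_p_hamiltonian[OF Mh Vh])
qed

lemma smooth_closed_loop_field:
  assumes M: "smooth_on UNIV M" "\<And>q. sym_pos_def (M q)" and G: "smooth_on UNIV G"
    and Mh: "smooth_on UNIV Mh" "\<And>q. sym_pos_def (Mh q)" and Vh: "smooth_on UNIV Vh"
    and Kd: "smooth_on UNIV Kd" and C: "smooth_on UNIV C"
  shows "smooth_on UNIV (closed_loop_field M G Mh Vh Kd C)"
proof -
  note sf = smooth_on_compose_fst
  show ?thesis
    unfolding closed_loop_field_eq[OF Mh Vh, abs_def] grad_q_hamiltonian[OF Mh Vh]
    by (intro smooth_on_Pair smooth_on_add smooth_on_diff smooth_on_minus smooth_on_matrix_vector_mult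
        smooth_on_matrix_matrix_mult smooth_on_transpose smooth_kinetic_grad_matrix[OF Mh] smooth_gyroscopic_matrix[OF Mh C]
        sf[OF smooth_inverse_mass[OF M]] sf[OF smooth_inverse_mass[OF Mh]] sf[OF G] sf[OF Kd] sf[OF Mh(1)]
        sf[OF smooth_on_grad[OF open_UNIV Vh]] smooth_on_snd smooth_on_ident open_UNIV)
qed

definition closed_loop_lin ::
    "real^'n^'n \<Rightarrow> real^'n^'n \<Rightarrow> real^'n^'n \<Rightarrow> real^'m^'n \<Rightarrow> real^'m^'m \<Rightarrow> (real^'n) \<times> (real^'n) \<Rightarrow> (real^'n) \<times> (real^'n)" where
  "closed_loop_lin m mh Ph B K = (\<lambda>(a, b). (matrix_inv m *v b,
     - (mh *v (matrix_inv m *v (Ph *v a))) - B *v (K *v (matrix_inv mh *v b v* B))))"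

lemma closed_loop_field_has_derivative:
  fixes M Mh :: "real^'n \<Rightarrow> real^'n^'n" and Vh :: "real^'n \<Rightarrow> real"
  assumes M: "smooth_on UNIV M" "\<And>q. sym_pos_def (M q)" and G: "smooth_on UNIV G"
    and Mh: "smooth_on UNIV Mh" "\<And>q. sym_pos_def (Mh q)" and Vh: "smooth_on UNIV Vh" "grad Vh 0 = 0"
    and Kd: "smooth_on UNIV Kd" and C: "smooth_on UNIV C"
  shows "closed_loop_field M G Mh Vh Kd C 0 = 0"
    and "(closed_loop_field M G Mh Vh Kd C has_derivative
      closed_loop_lin (M 0) (Mh 0) (hessian Vh 0) (G 0) (Kd 0)) (at 0)"
proof -
  let ?H = "hamiltonian Mh Vh"
  note sf = smooth_on_compose_fst
  have gq0: "grad_q ?H 0 = 0"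
    by (simp add: grad_q_hamiltonian[OF Mh Vh(1)] Vh(2))
  show "closed_loop_field M G Mh Vh Kd C 0 = 0"
    unfolding closed_loop_field_eq[OF Mh Vh(1)] gq0 by (simp add: prod_eq_iff)
  have s: "(snd has_derivative snd) (at (0 :: (real^'n) \<times> (real^'n)))"
    by (auto intro!: derivative_eq_intros)
  note mv0 = has_derivative_matrix_vector_mult_zero
  have v: "((\<lambda>x. matrix_inv (Mh (fst x)) *v snd x) has_derivative (\<lambda>v. matrix_inv (Mh 0) *v snd v)) (at 0)"
    using mv0[OF sf[OF smooth_inverse_mass[OF Mh]] s] by simp
  have 1: "((\<lambda>x. matrix_inv (M (fst x)) *v snd x) has_derivative (\<lambda>v. matrix_inv (M 0) *v snd v)) (at 0)"
    using mv0[OF sf[OF smooth_inverse_mass[OF M]] s] by simp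
  have sA: "smooth_on UNIV (\<lambda>q. Mh q ** matrix_inv (M q))"
    by (intro smooth_on_matrix_matrix_mult smooth_inverse_mass M Mh open_UNIV)
  have 2: "((\<lambda>x. (Mh (fst x) ** matrix_inv (M (fst x))) *v grad_q ?H x) has_derivative
      (\<lambda>v. (Mh 0 ** matrix_inv (M 0)) *v (hessian Vh 0 *v fst v))) (at 0)"
    using mv0[OF sf[OF sA] grad_q_hamiltonian_has_derivative[OF Mh Vh(1)] gq0] by simp
  have sB: "smooth_on UNIV (\<lambda>q. G q ** Kd q ** Finite_Cartesian_Product.transpose (G q))"
    by (intro smooth_on_matrix_matrix_mult smooth_on_transpose G Kd open_UNIV)
  have 3: "((\<lambda>x. (G (fst x) ** Kd (fst x) ** Finite_Cartesian_Product.transpose (G (fst x))) *v (matrix_inv (Mh (fst x)) *v snd x))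
      has_derivative (\<lambda>v. (G 0 ** Kd 0 ** Finite_Cartesian_Product.transpose (G 0)) *v (matrix_inv (Mh 0) *v snd v))) (at 0)"
    using mv0[OF sf[OF sB] v] by simp
  have "gyroscopic_matrix Mh C 0 = 0"
    by (simp add: gyroscopic_matrix_def Finite_Cartesian_Product.vec_eq_iff)
  then have 4: "((\<lambda>x. gyroscopic_matrix Mh C x *v (matrix_inv (Mh (fst x)) *v snd x)) has_derivative (\<lambda>v. 0)) (at 0)"
    using mv0[OF smooth_gyroscopic_matrix[OF Mh C] v] by simp
  have "(closed_loop_field M G Mh Vh Kd C has_derivative (\<lambda>v. (matrix_inv (M 0) *v snd v,
      - ((Mh 0 ** matrix_inv (M 0)) *v (hessian Vh 0 *v fst v))
      - (G 0 ** Kd 0 ** Finite_Cartesian_Product.transpose (G 0)) *v (matrix_inv (Mh 0) *v snd v) + 0))) (at 0)"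
    unfolding closed_loop_field_eq[OF Mh Vh(1), abs_def]
    by (intro has_derivative_Pair has_derivative_add has_derivative_diff has_derivative_minus 1 2 3 4)
  moreover have "(\<lambda>v. (matrix_inv (M 0) *v snd v,
      - ((Mh 0 ** matrix_inv (M 0)) *v (hessian Vh 0 *v fst v))
      - (G 0 ** Kd 0 ** Finite_Cartesian_Product.transpose (G 0)) *v (matrix_inv (Mh 0) *v snd v) + 0)) =
      closed_loop_lin (M 0) (Mh 0) (hessian Vh 0) (G 0) (Kd 0)"
    by (simp add: closed_loop_lin_def fun_eq_iff matrix_vector_mul_assoc[symmetric])
  ultimately show "(closed_loop_field M G Mh Vh Kd C has_derivative
      closed_loop_lin (M 0) (Mh 0) (hessian Vh 0) (G 0) (Kd 0)) (at 0)"
    by (simp only:)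
qed

section \<open>Stability of the closed loop\<close>

lemma closed_loop_lin_linear: "linear (closed_loop_lin m mh Ph B K)"
  unfolding closed_loop_lin_def transpose_matrix_vector[symmetric]
  by (rule linearI)
    (simp_all add: split_beta matrix_vector_right_distrib matrix_vector_mult_scaleR scaleR_diff_right
      del: transpose_matrix_vector)

lemma pos_def_zero:
  "sym_pos_def A \<Longrightarrow> A *v x = 0 \<Longrightarrow> x = 0"
  using sym_pos_def_cancel(1)[of A x] by simp

text \<open>As long as the output vanishes, the momentum is a multiple of \<open>Mh g\<close>, and the configuration moves in the
  direction \<open>w = m\<^sup>-\<^sup>1 Mh g\<close>. The restoring force on such a motion is a multiple of \<open>Mh m\<^sup>-\<^sup>1 P g\<close>, which cannot
  be another multiple of \<open>Mh g\<close> unless \<open>P g\<close> is parallel to \<open>m g\<close>. Two steps of this kind make the momentum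
  and the force, hence the state, vanish.\<close>

lemma closed_loop_lin_observable:
  fixes m mh P Ph :: "real^'n^'n" and B :: "real^'m^'n" and K :: "real^'m^'m"
  assumes m: "sym_pos_def m" and mh: "sym_pos_def mh" and Ph: "sym_pos_def Ph" and g: "annihilates g B"
    and match: "P *v g = Ph *v (matrix_inv m *v (mh *v g))"
    and np: "\<not> (\<exists>\<mu>. P *v g = \<mu> *\<^sub>R (m *v g))"
    and zero: "\<And>i. i \<le> 3 \<Longrightarrow> (matrix_inv mh *v snd ((closed_loop_lin m mh Ph B K ^^ i) x)) v* B = 0"
  shows "x = 0"
proof -
  let ?A = "closed_loop_lin m mh Ph B K"
  define w where "w = matrix_inv m *v (mh *v g)"
  define F where "F a = - (mh *v (matrix_inv m *v (Ph *v a)))" for a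
  have step: "\<exists>\<alpha>. b = \<alpha> *\<^sub>R (mh *v g) \<and> ?A (a, b) = (\<alpha> *\<^sub>R w, F a)"
    if z: "(matrix_inv mh *v b) v* B = 0" for a b
  proof -
    have "(matrix_inv mh *v b) \<bullet> (B *v u) = 0" for u
      using z by (simp flip: dot_lmul_matrix)
    then obtain \<alpha> where "matrix_inv mh *v b = \<alpha> *\<^sub>R g" using annihilates_unique[OF g] by blast
    then have "b = \<alpha> *\<^sub>R (mh *v g)"
      using sym_pos_def_cancel(2)[OF mh, of b] by (simp add: matrix_vector_mult_scaleR)
    then show ?thesis using z by (auto simp: closed_loop_lin_def F_def w_def matrix_vector_mult_scaleR)
  qed
  have Fw: "F (c *\<^sub>R w) = - (c *\<^sub>R (mh *v (matrix_inv m *v (P *v g))))" for c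
    by (simp add: F_def matrix_vector_mult_scaleR match w_def)
  have nz: "c = 0" if "F (c *\<^sub>R w) = d *\<^sub>R (mh *v g)" for c d
  proof (rule ccontr)
    assume "c \<noteq> 0"
    have "c *\<^sub>R (mh *v (matrix_inv m *v (P *v g))) = (- d) *\<^sub>R (mh *v g)"
      using that unfolding Fw by (metis minus_minus scaleR_minus_left)
    then have "mh *v (c *\<^sub>R (matrix_inv m *v (P *v g))) = mh *v ((- d) *\<^sub>R g)"
      by (simp only: matrix_vector_mult_scaleR)
    then have "c *\<^sub>R (matrix_inv m *v (P *v g)) = (- d) *\<^sub>R g"
      using sym_pos_def_cancel(1)[OF mh] by metis
    then have "m *v (matrix_inv m *v (c *\<^sub>R (P *v g))) = (- d) *\<^sub>R (m *v g)"
      by (simp only: matrix_vector_mult_scaleR)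
    then have "c *\<^sub>R (P *v g) = (- d) *\<^sub>R (m *v g)" by (simp only: sym_pos_def_cancel(2)[OF m])
    then have "(1 / c) *\<^sub>R (c *\<^sub>R (P *v g)) = (1 / c) *\<^sub>R ((- d) *\<^sub>R (m *v g))" by (rule arg_cong)
    then have "P *v g = (1 / c * - d) *\<^sub>R (m *v g)"
      unfolding scaleR_scaleR using \<open>c \<noteq> 0\<close> by simp
    then show False using np by blast
  qed
  obtain a b where x: "x = (a, b)" by (cases x)
  obtain \<alpha> where \<alpha>: "b = \<alpha> *\<^sub>R (mh *v g)" "?A (a, b) = (\<alpha> *\<^sub>R w, F a)"
    using step[of b a] zero[of 0] by (auto simp: x)
  obtain \<beta> where \<beta>: "F a = \<beta> *\<^sub>R (mh *v g)" "?A (\<alpha> *\<^sub>R w, F a) = (\<beta> *\<^sub>R w, F (\<alpha> *\<^sub>R w))"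
  proof -
    have "(matrix_inv mh *v F a) v* B = 0" using zero[of 1] by (simp add: x \<alpha>(2))
    from step[OF this] show thesis using that by blast
  qed
  obtain \<gamma> where \<gamma>: "F (\<alpha> *\<^sub>R w) = \<gamma> *\<^sub>R (mh *v g)" "?A (\<beta> *\<^sub>R w, F (\<alpha> *\<^sub>R w)) = (\<gamma> *\<^sub>R w, F (\<beta> *\<^sub>R w))"
  proof -
    have "(matrix_inv mh *v F (\<alpha> *\<^sub>R w)) v* B = 0"
      using zero[of 2] by (simp add: x \<alpha>(2) \<beta>(2) numeral_2_eq_2)
    from step[OF this] show thesis using that by blast
  qed
  obtain \<epsilon> where \<epsilon>: "F (\<beta> *\<^sub>R w) = \<epsilon> *\<^sub>R (mh *v g)"
  proof -
    have "(matrix_inv mh *v F (\<beta> *\<^sub>R w)) v* B = 0"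
      using zero[of 3] by (simp add: x \<alpha>(2) \<beta>(2) \<gamma>(2) numeral_3_eq_3)
    from step[OF this] show thesis using that by blast
  qed
  have "\<alpha> = 0" "\<beta> = 0" using nz[OF \<gamma>(1)] nz[OF \<epsilon>] by auto
  then have "F a = 0" "b = 0" using \<alpha> \<beta> by auto
  then have "mh *v (matrix_inv m *v (Ph *v a)) = 0" by (simp add: F_def)
  then have "a = 0"
    using pos_def_zero[OF Ph] pos_def_zero[OF sym_pos_def_matrix_inv[OF m]] pos_def_zero[OF mh] by blast
  then show ?thesis using \<open>b = 0\<close> by (simp add: x zero_prod_def)
qed

lemma sym_pos_def_lower_bound:
  assumes "sym_pos_def A" obtains k where "k > 0" "\<And>x. k * (norm x)\<^sup>2 \<le> x \<bullet> (A *v x)"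
proof -
  have "continuous_on UNIV (\<lambda>x. x \<bullet> (A *v x))"
    by (intro continuous_on_inner continuous_on_id linear_continuous_on matrix_vector_mul_bounded_linear)
  moreover have "(c *\<^sub>R x) \<bullet> (A *v (c *\<^sub>R x)) = c\<^sup>2 * (x \<bullet> (A *v x))" for c x
    by (simp add: matrix_vector_mult_scaleR power2_eq_square)
  moreover have "0 < x \<bullet> (A *v x)" if "x \<noteq> 0" for x
    using assms that unfolding sym_pos_def_def by blast
  ultimately obtain k where "k > 0" "\<And>x. k * (norm x)\<^sup>2 \<le> x \<bullet> (A *v x)"
    by (rule positive_quadratic_lower_bound[of "\<lambda>x. x \<bullet> (A *v x)"]) (assumption | rule that)+
  then show thesis by (rule that)
qed

text \<open>The energy \<open>Q\<close> decreases along the linearized closed loop by the damping term only, and the damping is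
  bounded below by the square of the output \<open>B\<^sup>T mh\<^sup>-\<^sup>1 p\<close>, which observes the state.\<close>

lemma exponentially_stable_if_not_parallel:
  fixes f :: "(real^'n) \<times> (real^'n) \<Rightarrow> (real^'n) \<times> (real^'n)" and m mh P Ph :: "real^'n^'n" and B :: "real^'m^'n" and K :: "real^'m^'m"
  assumes m: "sym_pos_def m" and mh: "sym_pos_def mh" and Ph: "sym_pos_def Ph" and K: "sym_pos_def K" and g: "annihilates g B"
    and match: "P *v g = Ph *v (matrix_inv m *v (mh *v g))"
    and np: "\<not> (\<exists>\<mu>. P *v g = \<mu> *\<^sub>R (m *v g))"
    and f: "smooth_on UNIV f" "f 0 = 0" "(f has_derivative closed_loop_lin m mh Ph B K) (at 0)"
  shows "exponentially_stable f"
proof -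
  let ?A = "closed_loop_lin m mh Ph B K"
  let ?C = "\<lambda>x :: (real^'n) \<times> (real^'n). (matrix_inv mh *v snd x) v* B"
  let ?Q = "\<lambda>x y :: (real^'n) \<times> (real^'n). fst x \<bullet> (Ph *v fst y) + snd x \<bullet> (matrix_inv mh *v snd y)"
  note imh = sym_pos_def_matrix_inv[OF mh]
  obtain k where k: "k > 0" "\<And>y. k * (norm y)\<^sup>2 \<le> y \<bullet> (K *v y)" using sym_pos_def_lower_bound[OF K] by blast
  have C: "linear ?C"
    unfolding transpose_matrix_vector[symmetric]
    by (rule linearI) (simp_all add: matrix_vector_right_distrib matrix_vector_mult_scaleR del: transpose_matrix_vector)
  have Q: "bilinear ?Q"
    unfolding bilinear_def
    by (intro conjI allI linearI)
      (auto simp: matrix_vector_right_distrib matrix_vector_mult_scaleR inner_add_right inner_add_left algebra_simps)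
  have Qs: "?Q x y = ?Q y x" for x y
    unfolding sym_pos_def_inner[OF Ph, of "fst x"] sym_pos_def_inner[OF imh, of "snd x"]
    by (rule arg_cong2[of _ _ _ _ "(+)"]; rule inner_commute)
  have Qp: "0 < ?Q x x" if "x \<noteq> 0" for x
  proof (cases "fst x = 0")
    case True
    then have "snd x \<noteq> 0" using that by (simp add: prod_eq_iff)
    then show ?thesis using True imh by (simp add: sym_pos_def_def)
  next
    case False
    then have "0 < fst x \<bullet> (Ph *v fst x)" using Ph by (simp add: sym_pos_def_def)
    moreover have "0 \<le> snd x \<bullet> (matrix_inv mh *v snd x)"
      using imh unfolding sym_pos_def_def by (cases "snd x = 0") (auto simp: less_imp_le)
    ultimately show ?thesis by simp
  qed
  have diss: "?Q x (?A x) \<le> - k * (norm (?C x))\<^sup>2" for x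
  proof -
    obtain a b where x: "x = (a, b)" by (cases x)
    define y where "y = (matrix_inv mh *v b) v* B"
    have "b \<bullet> (matrix_inv mh *v (mh *v (matrix_inv m *v (Ph *v a)))) = (Ph *v a) \<bullet> (matrix_inv m *v b)"
      unfolding sym_pos_def_cancel(1)[OF mh] sym_pos_def_inner[OF sym_pos_def_matrix_inv[OF m], of b]
      by (rule inner_commute)
    moreover have "a \<bullet> (Ph *v (matrix_inv m *v b)) = (Ph *v a) \<bullet> (matrix_inv m *v b)" by (rule sym_pos_def_inner[OF Ph])
    moreover have "b \<bullet> (matrix_inv mh *v (B *v (K *v y))) = y \<bullet> (K *v y)"
      unfolding y_def dot_lmul_matrix by (rule sym_pos_def_inner[OF imh])
    ultimately have "?Q x (?A x) = - (y \<bullet> (K *v y))"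
      by (simp add: x closed_loop_lin_def y_def[symmetric] matrix_vector_mult_diff_distrib matrix_vector_mult_uminus inner_diff_right)
    then show ?thesis using k(2)[of y] by (simp add: x y_def)
  qed
  have obs: "x = 0" if "\<And>i. i \<le> 3 \<Longrightarrow> ?C ((?A ^^ i) x) = 0" for x
    by (rule closed_loop_lin_observable[OF m mh Ph g match np that])
  obtain W \<kappa> c where "bilinear W" "\<And>x y. W x y = W y x" "\<kappa> > 0" "\<And>x. \<kappa> * (norm x)\<^sup>2 \<le> W x x"
    "c > 0" "\<And>x. W x (?A x) \<le> - c * (norm x)\<^sup>2"
    using strict_lyapunov_function_exists[OF closed_loop_lin_linear C Q Qs Qp k(1) diss obs] by blast
  then show ?thesis by (rule lyapunov_exponentially_stable[OF f])
qed

text \<open>Damping acts in the range of \<open>B\<close> and is invisible in the coordinates \<open>(g \<bullet> m q, g \<bullet> p)\<close>, which form an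
  undamped oscillator; its energy is the conserved form.\<close>

lemma not_exponentially_stable_if_parallel:
  fixes f :: "(real^'n) \<times> (real^'n) \<Rightarrow> (real^'n) \<times> (real^'n)" and m mh P Ph :: "real^'n^'n" and B :: "real^'m^'n" and K :: "real^'m^'m"
  assumes m: "sym_pos_def m" and mh: "sym_pos_def mh" and Ph: "sym_pos_def Ph" and g: "annihilates g B"
    and match: "P *v g = Ph *v (matrix_inv m *v (mh *v g))"
    and par: "P *v g = \<mu> *\<^sub>R (m *v g)"
    and f: "f 0 = 0" "(f has_derivative closed_loop_lin m mh Ph B K) (at 0)"
  shows "\<not> exponentially_stable f"
proof -
  let ?A = "closed_loop_lin m mh Ph B K"
  let ?Q = "\<lambda>x y :: (real^'n) \<times> (real^'n). \<mu> * ((g \<bullet> (m *v fst x)) * (g \<bullet> (m *v fst y))) + (g \<bullet> snd x) * (g \<bullet> snd y)"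
  have Q: "bilinear ?Q"
    unfolding bilinear_def
    by (intro conjI allI linearI)
      (auto simp: matrix_vector_right_distrib matrix_vector_mult_scaleR inner_add_right inner_add_left algebra_simps)
  have Qs: "?Q x y = ?Q y x" for x y by (simp add: mult_ac)
  have cons: "?Q x (?A x) = 0" for x
  proof -
    obtain a b where x: "x = (a, b)" by (cases x)
    have "g \<bullet> (mh *v (matrix_inv m *v (Ph *v a))) = (P *v g) \<bullet> a"
      unfolding match sym_pos_def_inner[OF mh, of g] sym_pos_def_inner[OF sym_pos_def_matrix_inv[OF m], of "mh *v g"]
      by (rule sym_pos_def_inner[OF Ph])
    also have "\<dots> = \<mu> * (g \<bullet> (m *v a))" using sym_pos_def_inner[OF m, of g a] by (simp add: par)
    finally show ?thesis
      by (simp add: x closed_loop_lin_def inner_diff_right annihilates_range[OF g] sym_pos_def_cancel[OF m])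
  qed
  have "g \<bullet> g > 0" using g by (simp add: annihilates_def)
  then have "?Q (0, g) (0, g) > 0" by simp
  then show ?thesis
    using conserved_form_not_exponentially_stable[where Q = ?Q and A = ?A, OF f Q Qs cons] by blast
qed

section \<open>Matching at the origin is necessary\<close>

text \<open>The input enters the difference of the two vector fields only through the range of \<open>G\<close>. At \<open>p = 0\<close> it must
  satisfy \<open>G(q) u(q, 0) = grad V(q) - Mh(q) M(q)\<^sup>-\<^sup>1 grad Vh(q)\<close>; in particular \<open>u\<close> vanishes at the origin. So
  the derivative of the left-hand side at the origin takes values in the range of \<open>G(0)\<close>, and its inner product with
  \<open>g\<close> is zero.\<close>

lemma matching_at_origin:
  fixes M Mh :: "real^'n \<Rightarrow> real^'n^'n" and V Vh :: "real^'n \<Rightarrow> real" and G :: "real^'n \<Rightarrow> real^'m^'n"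
  assumes M: "smooth_on UNIV M" "\<And>q. sym_pos_def (M q)" and V: "smooth_on UNIV V" "grad V 0 = 0"
    and G: "smooth_on UNIV G" "rank (G 0) = CARD('m)" and g: "annihilates g (G 0)"
    and Mh: "smooth_on UNIV Mh" "\<And>q. sym_pos_def (Mh q)" and Vh: "smooth_on UNIV Vh" "grad Vh 0 = 0"
    and fb: "transformed_by_feedback (controlled_field M V G) (closed_loop_field M G Mh Vh Kd C)"
  shows "hessian V 0 *v g = hessian Vh 0 *v (matrix_inv (M 0) *v (Mh 0 *v g))"
proof -
  obtain U u where U: "open U" "0 \<in> U" "smooth_on U u"
    and eq: "\<And>x. x \<in> U \<Longrightarrow> controlled_field M V G x (u x) = closed_loop_field M G Mh Vh Kd C x"
    using fb unfolding transformed_by_feedback_def by blast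
  let ?y = "\<lambda>q. u (q, 0)" and ?A = "\<lambda>q. Mh q ** matrix_inv (M q)"
  let ?U = "(\<lambda>q :: real^'n. (q, 0 :: real^'n)) -` U"
  have oU: "open ?U" by (intro open_vimage U continuous_intros)
  have 0: "0 \<in> ?U" using U(2) by (simp add: zero_prod_def)
  have gq: "grad_q (hamiltonian M V) (q, 0) = grad V q" "grad_q (hamiltonian Mh Vh) (q, 0) = grad Vh q" for q
    by (simp_all add: grad_q_hamiltonian[OF M V(1)] grad_q_hamiltonian[OF Mh Vh(1)])
  have e: "G q *v ?y q = grad V q - ?A q *v grad Vh q" if "q \<in> ?U" for q
  proof -
    have "snd (controlled_field M V G (q, 0) (?y q)) = snd (closed_loop_field M G Mh Vh Kd C (q, 0))"
      using eq[of "(q, 0)"] that by simp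
    then show ?thesis
      by (simp add: controlled_field_def Let_def closed_loop_field_eq[OF Mh Vh(1)] gq algebra_simps)
  qed
  have "G 0 *v ?y 0 = 0" using e[OF 0] V(2) Vh(2) by simp
  moreover have "inj ((*v) (G 0))" using G(2) full_rank_injective by blast
  ultimately have y0: "?y 0 = 0" by (metis injD matrix_vector_mult_0_right)
  have "((\<lambda>q. (q, 0)) has_derivative (\<lambda>v. (v, 0))) (at (0 :: real^'n))" by (auto intro!: derivative_eq_intros)
  moreover have "(u has_derivative frechet_derivative u (at (0, 0))) (at (0, 0))"
    by (rule smooth_on_has_derivative[OF U(3)]) (use U(2) in \<open>simp add: zero_prod_def\<close>)
  ultimately have "(?y has_derivative (\<lambda>v. frechet_derivative u (at (0, 0)) (v, 0))) (at 0)"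
    by (rule has_derivative_compose)
  then obtain y' where y': "(?y has_derivative y') (at 0)" by blast
  have "((\<lambda>q. G q *v ?y q) has_derivative (\<lambda>v. G 0 *v y' v)) (at 0)"
    by (rule has_derivative_matrix_vector_mult_zero[OF G(1) y' y0])
  then have d1: "((\<lambda>q. grad V q - ?A q *v grad Vh q) has_derivative (\<lambda>v. G 0 *v y' v)) (at 0)"
    by (rule has_derivative_transform_within_open[OF _ oU 0 e])
  have sA: "smooth_on UNIV ?A"
    by (intro smooth_on_matrix_matrix_mult smooth_inverse_mass M Mh open_UNIV)
  have dg: "(grad V has_derivative (\<lambda>v. hessian V 0 *v v)) (at 0)" "(grad Vh has_derivative (\<lambda>v. hessian Vh 0 *v v)) (at 0)"
    unfolding hessian_mult[OF V(1)] hessian_mult[OF Vh(1)]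
    by (rule smooth_on_has_derivative[OF smooth_on_grad[OF open_UNIV] UNIV_I], rule V Vh)+
  have "((\<lambda>q. grad V q - ?A q *v grad Vh q) has_derivative (\<lambda>v. hessian V 0 *v v - ?A 0 *v (hessian Vh 0 *v v))) (at 0)"
    by (intro has_derivative_diff dg has_derivative_matrix_vector_mult_zero[OF sA] Vh(2))
  then have "(\<lambda>v. hessian V 0 *v v - ?A 0 *v (hessian Vh 0 *v v)) = (\<lambda>v. G 0 *v y' v)"
    using d1 by (rule has_derivative_unique)
  then have v: "hessian V 0 *v v - ?A 0 *v (hessian Vh 0 *v v) = G 0 *v y' v" for v by metis
  show ?thesis
  proof (rule vector_eq_rdot[THEN iffD1], rule allI)
    fix v
    have "g \<bullet> (hessian V 0 *v v) - g \<bullet> (?A 0 *v (hessian Vh 0 *v v)) = 0"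
      using annihilates_range[OF g, of "y' v"] by (simp flip: v add: inner_diff_right)
    moreover have "g \<bullet> (hessian V 0 *v v) = (hessian V 0 *v g) \<bullet> v"
      by (rule symmetric_matrix_inner[OF hessian_symmetric[OF V(1)]])
    moreover have "g \<bullet> (?A 0 *v (hessian Vh 0 *v v)) = (hessian Vh 0 *v (matrix_inv (M 0) *v (Mh 0 *v g))) \<bullet> v"
    proof -
      have 1: "x \<bullet> (Mh 0 *v y) = (Mh 0 *v x) \<bullet> y" for x y by (rule sym_pos_def_inner[OF Mh(2)])
      have 2: "x \<bullet> (matrix_inv (M 0) *v y) = (matrix_inv (M 0) *v x) \<bullet> y" for x y
        by (rule sym_pos_def_inner[OF sym_pos_def_matrix_inv[OF M(2)]])
      have 3: "x \<bullet> (hessian Vh 0 *v y) = (hessian Vh 0 *v x) \<bullet> y" for x y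
        by (rule symmetric_matrix_inner[OF hessian_symmetric[OF Vh(1)]])
      show ?thesis unfolding matrix_vector_mul_assoc[symmetric] 1 2 3 ..
    qed
    ultimately show "(hessian V 0 *v g) \<bullet> v = (hessian Vh 0 *v (matrix_inv (M 0) *v (Mh 0 *v g))) \<bullet> v" by simp
  qed
qed

section \<open>Normalizing the annihilator\<close>

lemma dderiv_eqI: "(f has_derivative f') (at x) \<Longrightarrow> dderiv f v x = f' v"
  using frechet_derivative_at by metis

lemma dderiv_matrix_vector_mult:
  fixes A :: "'a::real_normed_vector \<Rightarrow> real^'n^'m"
  assumes "smooth_on UNIV A" "smooth_on UNIV y"
  shows "dderiv (\<lambda>q. A q *v y q) v q = A q *v dderiv y v q + dderiv A v q *v y q"
  by (rule dderiv_eqI[OF has_derivative_matrix_vector_mult])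
    (rule smooth_on_has_derivative[OF assms(1) UNIV_I] smooth_on_has_derivative[OF assms(2) UNIV_I])+

lemma dderiv_scaleR:
  assumes "smooth_on UNIV l" "smooth_on UNIV y"
  shows "dderiv (\<lambda>q. l q *\<^sub>R y q) v q = l q *\<^sub>R dderiv y v q + dderiv l v q *\<^sub>R y q"
  by (rule dderiv_eqI[OF has_derivative_scaleR])
    (rule smooth_on_has_derivative[OF assms(1) UNIV_I] smooth_on_has_derivative[OF assms(2) UNIV_I])+

lemma dderiv_exp:
  fixes l :: "'a::real_normed_vector \<Rightarrow> real"
  assumes "smooth_on UNIV l"
  shows "dderiv (\<lambda>q. exp (l q)) v q = exp (l q) * dderiv l v q"
  by (rule dderiv_eqI, rule has_derivative_eq_rhs[OF has_derivative_exp[OF smooth_on_has_derivative[OF assms UNIV_I]]])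
    (simp add: mult.commute)

lemma smooth_on_dderiv_field:
  fixes f :: "'a::euclidean_space \<Rightarrow> 'b::real_normed_vector"
  assumes "smooth_on UNIV f" "smooth_on UNIV v"
  shows "smooth_on UNIV (\<lambda>q. dderiv f (v q) q)"
proof -
  have "dderiv f (v q) q = (\<Sum>b\<in>Basis. (v q \<bullet> b) *\<^sub>R dderiv f b q)" for q
  proof -
    note l = dderiv_linear[OF assms(1) UNIV_I, of q]
    have "dderiv f (v q) q = dderiv f (\<Sum>b\<in>Basis. (v q \<bullet> b) *\<^sub>R b) q" by (simp add: euclidean_representation)
    then show ?thesis by (simp add: linear_sum[OF l] linear_scale[OF l])
  qed
  moreover have "smooth_on UNIV (\<lambda>q. \<Sum>b\<in>Basis. (v q \<bullet> b) *\<^sub>R dderiv f b q)"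
    by (intro smooth_on_sum smooth_on_scaleR smooth_on_inner smooth_on_const smooth_on_dderiv assms open_UNIV)
  ultimately show ?thesis by simp
qed

text \<open>For full column rank this is the Moore-Penrose inverse; \<open>B ** pseudo_inverse B\<close> is the orthogonal projection
  to the range of \<open>B\<close>.\<close>

definition pseudo_inverse :: "real^'m^'n \<Rightarrow> real^'n^'m" where
  "pseudo_inverse B = matrix_inv (Finite_Cartesian_Product.transpose B ** B) ** Finite_Cartesian_Product.transpose B"

lemma gram_invertible:
  fixes B :: "real^'m^'n"
  assumes "rank B = CARD('m)"
  shows "invertible (Finite_Cartesian_Product.transpose B ** B)"
proof -
  have "x = 0" if "(Finite_Cartesian_Product.transpose B ** B) *v x = 0" for x
  proof -
    have "(B *v x) v* B = 0" using that by (simp add: matrix_vector_mul_assoc[symmetric])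
    then have "(B *v x) \<bullet> (B *v x) = 0" by (simp flip: dot_lmul_matrix)
    then have "B *v x = B *v 0" by simp
    then show "x = 0" using assms full_rank_injective[of B] by (meson injD)
  qed
  then have "inj ((*v) (Finite_Cartesian_Product.transpose B ** B))"
    by (metis matrix_left_invertible_ker matrix_left_invertible_injective)
  then show ?thesis by (simp add: invertible_left_inverse matrix_left_invertible_injective)
qed

lemma pseudo_inverse_left:
  fixes B :: "real^'m^'n"
  assumes "rank B = CARD('m)" shows "pseudo_inverse B *v (B *v u) = u"
proof -
  have "pseudo_inverse B *v (B *v u) =
      matrix_inv (Finite_Cartesian_Product.transpose B ** B) *v ((Finite_Cartesian_Product.transpose B ** B) *v u)"
    unfolding pseudo_inverse_def by (simp only: matrix_vector_mul_assoc matrix_mul_assoc)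
  then show ?thesis by (simp only: matrix_inv_cancel(1)[OF gram_invertible[OF assms]])
qed

lemma pseudo_inverse_projection:
  fixes B :: "real^'m^'n"
  assumes "rank B = CARD('m)" shows "(B *v (pseudo_inverse B *v x)) \<bullet> (B *v u) = x \<bullet> (B *v u)"
proof -
  let ?T = "Finite_Cartesian_Product.transpose B"
  have "?T *v (B *v (pseudo_inverse B *v x)) = (?T ** B) *v (matrix_inv (?T ** B) *v (?T *v x))"
    unfolding pseudo_inverse_def by (simp only: matrix_vector_mul_assoc matrix_mul_assoc)
  also have "\<dots> = ?T *v x" by (simp only: matrix_inv_cancel(2)[OF gram_invertible[OF assms]])
  finally show ?thesis by (simp flip: dot_lmul_matrix)
qed

lemma smooth_pseudo_inverse:
  fixes G :: "'a::real_normed_vector \<Rightarrow> real^'m^'n"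
  assumes "smooth_on UNIV G" "\<And>q. rank (G q) = CARD('m)"
  shows "smooth_on UNIV (\<lambda>q. pseudo_inverse (G q))"
  unfolding pseudo_inverse_def
  by (intro smooth_on_matrix_matrix_mult smooth_on_matrix_inv smooth_on_transpose assms(1) open_UNIV gram_invertible assms(2))

text \<open>Project the fixed vector \<open>g0\<close> orthogonally to the complement of the range of \<open>G q\<close>.\<close>

lemma smooth_annihilator_field:
  fixes G :: "real^'n \<Rightarrow> real^'m^'n"
  assumes G: "smooth_on UNIV G" "\<And>q. rank (G q) = CARD('m)" and g0: "annihilates g0 (G 0)"
  obtains g where "smooth_on UNIV g" "g 0 = g0" "\<And>q u. g q \<bullet> (G q *v u) = 0"
proof
  let ?g = "\<lambda>q. g0 - G q *v (pseudo_inverse (G q) *v g0)"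
  show "smooth_on UNIV ?g"
    by (intro smooth_on_diff smooth_on_const smooth_on_matrix_vector_mult smooth_pseudo_inverse G open_UNIV)
  show "?g q \<bullet> (G q *v u) = 0" for q u
    by (simp add: inner_diff_left pseudo_inverse_projection[OF G(2)])
  have "(G 0 *v (pseudo_inverse (G 0) *v g0)) \<bullet> (G 0 *v (pseudo_inverse (G 0) *v g0)) = 0"
    unfolding pseudo_inverse_projection[OF G(2)] by (rule annihilates_range[OF g0])
  then show "?g 0 = g0" by simp
qed

text \<open>The kinetic matching condition in the direction of the annihilator \<open>g\<close> and at the velocity \<open>g\<close>. The
  relation \<open>Mh g = M w\<close> has been used to eliminate \<open>Mh\<close> (see \<open>kinetic_mismatch_annihilator\<close>), so this is a
  condition on the field \<open>g\<close> alone.\<close>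

definition kinetic_defect ::
    "(real^'n \<Rightarrow> real^'n^'n) \<Rightarrow> real^'n \<Rightarrow> (real^'n \<Rightarrow> real^'n) \<Rightarrow> real^'n \<Rightarrow> real" where
  "kinetic_defect M w g q = g q \<bullet> (dderiv M w q *v w) - w \<bullet> (M q *v dderiv g w q) - w \<bullet> (dderiv M (g q) q *v w)"

lemma smooth_kinetic_defect:
  assumes "smooth_on UNIV M" "smooth_on UNIV g" shows "smooth_on UNIV (kinetic_defect M w g)"
  unfolding kinetic_defect_def
  by (intro smooth_on_diff smooth_on_inner smooth_on_const smooth_on_matrix_vector_mult smooth_on_dderiv
      smooth_on_dderiv_field assms open_UNIV)

text \<open>Besides scaling the defect, a factor of \<open>g\<close> adds a multiple of its derivative along \<open>w\<close>. Where
  \<open>g \<bullet> M w > 0\<close> this multiple is nonzero, so a suitable factor can remove the defect.\<close>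

lemma kinetic_defect_scaled:
  fixes M :: "real^'n \<Rightarrow> real^'n^'n"
  assumes M: "smooth_on UNIV M" "\<And>q. sym_pos_def (M q)" and g: "smooth_on UNIV g" and l: "smooth_on UNIV l"
  shows "kinetic_defect M w (\<lambda>q. l q *\<^sub>R g q) q = l q * kinetic_defect M w g q - dderiv l w q * (g q \<bullet> (M q *v w))"
proof -
  have "w \<bullet> (M q *v g q) = g q \<bullet> (M q *v w)"
    using sym_pos_def_inner[OF M(2), of w q "g q"] by (simp add: inner_commute)
  then show ?thesis
    by (simp add: kinetic_defect_def dderiv_scaleR[OF l g] linear_scale[OF dderiv_linear[OF M(1) UNIV_I]]
        matrix_vector_right_distrib matrix_vector_mult_scaleR inner_add_right
        scaleR_matrix_vector_assoc[symmetric] algebra_simps)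
qed

text \<open>By \<open>kinetic_defect_scaled\<close> the logarithm of the scaling factor has to have a prescribed derivative along
  the constant field \<open>w\<close>. The prescribed function is a quotient, which is cut off where its denominator
  might vanish.\<close>

lemma annihilator_without_kinetic_defect:
  fixes M :: "real^'n \<Rightarrow> real^'n^'n" and G :: "real^'n \<Rightarrow> real^'m^'n"
  assumes M: "smooth_on UNIV M" "\<And>q. sym_pos_def (M q)"
    and G: "smooth_on UNIV G" "\<And>q. rank (G q) = CARD('m)" and g0: "annihilates g0 (G 0)"
    and w: "g0 \<bullet> (M 0 *v w) > 0"
  obtains g U where "smooth_on UNIV g" "g 0 = g0" "\<And>q u. g q \<bullet> (G q *v u) = 0"
    "open U" "0 \<in> U" "\<And>q. q \<in> U \<Longrightarrow> kinetic_defect M w g q = 0"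
proof -
  obtain h where h: "smooth_on UNIV h" "h 0 = g0" "\<And>q u. h q \<bullet> (G q *v u) = 0"
    using smooth_annihilator_field[OF G g0] by blast
  let ?d = "\<lambda>q. h q \<bullet> (M q *v w)"
  have sd: "smooth_on UNIV ?d"
    by (intro smooth_on_inner smooth_on_matrix_vector_mult smooth_on_const h M open_UNIV)
  let ?U = "{q. 0 < ?d q}"
  have U: "open ?U" "0 \<in> ?U"
    using w h(2) by (auto intro!: open_Collect_less continuous_on_const smooth_on_imp_continuous_on[OF sd])
  obtain \<rho> :: "real^'n \<Rightarrow> real" and K W where r: "smooth_on UNIV \<rho>" "open W" "0 \<in> W" "W \<subseteq> ?U" "\<And>q. q \<in> W \<Longrightarrow> \<rho> q = 1"
    "closed K" "K \<subseteq> ?U" "\<And>y. y \<notin> K \<Longrightarrow> \<rho> y = 0"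
    by (rule bump_function_exists[OF U]) (assumption | rule that)+
  let ?b = "\<lambda>q. \<rho> q *\<^sub>R (kinetic_defect M w h q / ?d q)"
  have sb: "smooth_on UNIV ?b"
  proof (rule smooth_on_cutoff[OF U(1) _ r(1,6,7,8)])
    show "smooth_on ?U (\<lambda>q. kinetic_defect M w h q / ?d q)"
      using smooth_on_mono[OF smooth_kinetic_defect[OF M(1) h(1)], of ?U w] smooth_on_mono[OF sd, of ?U] U(1)
      by (intro smooth_on_divide) auto
  qed
  define l where "l q = exp (line_integral w ?b q)" for q
  note sj = smooth_on_line_integral[OF sb, of w]
  have sl: "smooth_on UNIV l" unfolding l_def by (intro smooth_on_exp sj open_UNIV)
  have w0: "w \<noteq> 0" using w by auto
  have dl: "dderiv l w q = l q * ?b q" for q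
    unfolding l_def dderiv_exp[OF sj] dderiv_line_integral[OF sb w0] ..
  show thesis
  proof
    show "smooth_on UNIV (\<lambda>q. l q *\<^sub>R h q)" by (intro smooth_on_scaleR sl h open_UNIV)
    show "l 0 *\<^sub>R h 0 = g0" by (simp add: l_def line_integral_transversal h)
    show "(l q *\<^sub>R h q) \<bullet> (G q *v u) = 0" for q u by (simp add: h)
    show "open W" "0 \<in> W" by fact+
    fix q assume q: "q \<in> W"
    then have "?d q > 0" using r(4) by auto
    then show "kinetic_defect M w (\<lambda>q. l q *\<^sub>R h q) q = 0"
      unfolding kinetic_defect_scaled[OF M h(1) sl] dl using r(5)[OF q] by simp
  qed
qed

section \<open>Shaping the kinetic energy\<close>

definition outer :: "real^'n \<Rightarrow> real^'n \<Rightarrow> real^'n^'n" where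
  "outer x y = (\<chi> i j. x $ i * y $ j)"

lemma outer_mult: "outer x y *v z = (y \<bullet> z) *\<^sub>R x"
  by (simp add: outer_def matrix_vector_mult_def inner_vec_def Finite_Cartesian_Product.vec_eq_iff sum_distrib_left
      mult_ac)

lemma smooth_outer:
  "open S \<Longrightarrow> smooth_on S f \<Longrightarrow> smooth_on S g \<Longrightarrow> smooth_on S (\<lambda>q. outer (f q) (g q))"
  unfolding outer_def by (intro smooth_on_vec_lambda smooth_on_mult smooth_on_vec_nth)

text \<open>The second summand is the orthogonal projection with kernel \<open>g\<close>; the first one maps \<open>g\<close> to \<open>y\<close> and is
  positive on \<open>g\<close> if \<open>g \<bullet> y > 0\<close>.\<close>

definition shaped_mass :: "real^'n \<Rightarrow> real^'n \<Rightarrow> real^'n^'n" where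
  "shaped_mass g y = (1 / (g \<bullet> y)) *\<^sub>R outer y y + (Finite_Cartesian_Product.mat 1 - (1 / (g \<bullet> g)) *\<^sub>R outer g g)"

lemma shaped_mass_mult:
  "shaped_mass g y *v x = ((y \<bullet> x) / (g \<bullet> y)) *\<^sub>R y + (x - ((g \<bullet> x) / (g \<bullet> g)) *\<^sub>R g)"
  by (simp add: shaped_mass_def matrix_vector_mult_add_rdistrib matrix_vector_mult_diff_rdistrib
      scaleR_matrix_vector_assoc[symmetric] outer_mult)

lemma shaped_mass_annihilator:
  assumes "g \<bullet> y > 0" shows "shaped_mass g y *v g = y"
proof -
  have "g \<bullet> g \<noteq> 0" using assms by auto
  then show ?thesis using assms by (simp add: shaped_mass_mult inner_commute)
qed

lemma shaped_mass_form:
  "x \<bullet> (shaped_mass g y *v z) = (x \<bullet> y) * (z \<bullet> y) / (g \<bullet> y) + (x \<bullet> z - (x \<bullet> g) * (z \<bullet> g) / (g \<bullet> g))"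
  by (simp add: shaped_mass_mult inner_add_right inner_diff_right inner_commute mult.commute)

lemma shaped_mass_positive:
  assumes "g \<bullet> y > 0" "x \<noteq> 0" shows "0 < x \<bullet> (shaped_mass g y *v x)"
proof -
  have gg: "g \<bullet> g > 0" using assms by (metis inner_gt_zero_iff inner_zero_left less_irrefl)
  define z where "z = x - ((x \<bullet> g) / (g \<bullet> g)) *\<^sub>R g"
  have zz: "x \<bullet> x - (x \<bullet> g) * (x \<bullet> g) / (g \<bullet> g) = z \<bullet> z"
    using gg by (simp add: z_def inner_diff_left inner_diff_right inner_commute field_simps)
  have eq: "x \<bullet> (shaped_mass g y *v x) = (x \<bullet> y)\<^sup>2 / (g \<bullet> y) + z \<bullet> z"
    by (simp add: shaped_mass_form zz power2_eq_square)
  show ?thesis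
  proof (cases "z = 0")
    case True
    then have x: "x = ((x \<bullet> g) / (g \<bullet> g)) *\<^sub>R g" by (simp add: z_def)
    then have "(x \<bullet> g) / (g \<bullet> g) \<noteq> 0" using assms(2) by (metis scaleR_zero_left)
    moreover have "x \<bullet> y = ((x \<bullet> g) / (g \<bullet> g)) * (g \<bullet> y)" by (subst x) simp
    ultimately have "x \<bullet> y \<noteq> 0" using assms(1) by simp
    then show ?thesis unfolding eq using assms(1) True by simp
  next
    case False
    then show ?thesis unfolding eq using assms(1) by (intro add_nonneg_pos) auto
  qed
qed

lemma sym_pos_defI:
  fixes A :: "real^'n^'n"
  assumes "\<And>x y. x \<bullet> (A *v y) = y \<bullet> (A *v x)" "\<And>x. x \<noteq> 0 \<Longrightarrow> 0 < x \<bullet> (A *v x)"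
  shows "sym_pos_def A"
proof -
  have "Finite_Cartesian_Product.transpose A *v x = A *v x" for x
  proof (rule vector_eq_rdot[THEN iffD1], rule allI)
    fix y
    have "(Finite_Cartesian_Product.transpose A *v x) \<bullet> y = x \<bullet> (A *v y)" by (simp add: dot_lmul_matrix)
    then show "(Finite_Cartesian_Product.transpose A *v x) \<bullet> y = (A *v x) \<bullet> y"
      using assms(1)[of x y] by (simp add: inner_commute)
  qed
  then have "Finite_Cartesian_Product.transpose A = A" by (simp add: matrix_eq)
  then show ?thesis using assms(2) by (simp add: sym_pos_def_def)
qed

text \<open>Positive definite matrices form a convex set, so the local solution can be blended with the identity.\<close>

lemma shaped_mass_exists:
  fixes g y :: "real^'n \<Rightarrow> real^'n"
  assumes g: "smooth_on UNIV g" and y: "smooth_on UNIV y" and pos: "g 0 \<bullet> y 0 > 0"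
  obtains Mh U where "smooth_on UNIV Mh" "\<And>q. sym_pos_def (Mh q)" "open U" "0 \<in> U"
    "\<And>q. q \<in> U \<Longrightarrow> Mh q *v g q = y q"
proof -
  let ?I = "Finite_Cartesian_Product.mat 1 :: real^'n^'n"
  have sd: "smooth_on UNIV (\<lambda>q. g q \<bullet> y q)" by (intro smooth_on_inner g y open_UNIV)
  let ?U = "{q. 0 < g q \<bullet> y q}"
  have U: "open ?U" "0 \<in> ?U"
    using pos by (auto intro!: open_Collect_less continuous_on_const smooth_on_imp_continuous_on[OF sd])
  obtain \<rho> :: "real^'n \<Rightarrow> real" and K W where r: "smooth_on UNIV \<rho>" "\<And>q. 0 \<le> \<rho> q" "\<And>q. \<rho> q \<le> 1"
    "open W" "0 \<in> W" "W \<subseteq> ?U" "\<And>q. q \<in> W \<Longrightarrow> \<rho> q = 1"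
    "closed K" "K \<subseteq> ?U" "\<And>y. y \<notin> K \<Longrightarrow> \<rho> y = 0"
    by (rule bump_function_exists[OF U]) (assumption | rule that)+
  define Mh where "Mh q = \<rho> q *\<^sub>R shaped_mass (g q) (y q) + (1 - \<rho> q) *\<^sub>R ?I" for q
  have gU: "smooth_on ?U g" "smooth_on ?U y" using smooth_on_mono g y by blast+
  have "smooth_on ?U (\<lambda>q. shaped_mass (g q) (y q))"
    unfolding shaped_mass_def
    by (intro smooth_on_add smooth_on_diff smooth_on_scaleR smooth_on_divide smooth_outer smooth_on_inner smooth_on_const U gU)
      auto
  then have "smooth_on UNIV (\<lambda>q. \<rho> q *\<^sub>R shaped_mass (g q) (y q))"
    by (rule smooth_on_cutoff[OF U(1) _ r(1,8,9)]) (rule r(10))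
  moreover have "smooth_on UNIV (\<lambda>q. (1 - \<rho> q) *\<^sub>R ?I)"
    by (intro smooth_on_scaleR smooth_on_diff smooth_on_const r(1) open_UNIV)
  ultimately have "smooth_on UNIV Mh"
    unfolding Mh_def by (rule smooth_on_add[OF open_UNIV])
  moreover have "sym_pos_def (Mh q)" for q
  proof (rule sym_pos_defI)
    have form: "x \<bullet> (Mh q *v z) = \<rho> q * (x \<bullet> (shaped_mass (g q) (y q) *v z)) + (1 - \<rho> q) * (x \<bullet> z)" for x z
      by (simp add: Mh_def matrix_vector_mult_add_rdistrib scaleR_matrix_vector_assoc[symmetric] inner_add_right)
    show "x \<bullet> (Mh q *v z) = z \<bullet> (Mh q *v x)" for x z
      unfolding form by (simp add: shaped_mass_form inner_commute mult.commute)
    fix x :: "real^'n" assume x: "x \<noteq> 0"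
    show "0 < x \<bullet> (Mh q *v x)"
    proof (cases "\<rho> q = 0")
      case True
      then show ?thesis using x by (simp add: form)
    next
      case False
      then have "q \<in> ?U" using r(9,10) by blast
      then have "0 < \<rho> q * (x \<bullet> (shaped_mass (g q) (y q) *v x))"
        using shaped_mass_positive[of "g q" "y q" x] x False r(2)[of q] by simp
      moreover have "0 \<le> (1 - \<rho> q) * (x \<bullet> x)" using r(3)[of q] by simp
      ultimately show ?thesis unfolding form by simp
    qed
  qed
  moreover have "Mh q *v g q = y q" if "q \<in> W" for q
    using shaped_mass_annihilator[of "g q" "y q"] r(6,7) that by (auto simp: Mh_def)
  ultimately show thesis using that r(4,5) by blast
qed

section \<open>Shaping the potential energy\<close>

text \<open>The derivative along \<open>w\<close> leaves a function on the hyperplane orthogonal to \<open>w\<close> free, and a large multiple of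
  the squared distance from the line through \<open>w\<close> is chosen. In the decomposition \<open>v = z + c w\<close> the Hessian is then
  \<open>K |z|\<^sup>2 + 2 c (grad f \<bullet> z) + c\<^sup>2 h\<close>, where \<open>h > 0\<close> is the derivative of \<open>f\<close> along \<open>w\<close>; completing the square
  shows that every \<open>K > |grad f|\<^sup>2 / h\<close> makes it positive.\<close>

lemma shaped_potential_exists:
  fixes f :: "real^'n \<Rightarrow> real"
  assumes f: "smooth_on UNIV f" "f 0 = 0" and pos: "dderiv f w 0 > 0"
  obtains Vh where "smooth_on UNIV Vh" "\<And>q. dderiv Vh w q = f q" "grad Vh 0 = 0" "sym_pos_def (hessian Vh 0)"
proof -
  define h where "h = dderiv f w 0"
  have h: "h > 0" using pos by (simp add: h_def)
  note lf = dderiv_linear[OF f(1) UNIV_I, of 0]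
  have w0: "w \<noteq> 0" using pos linear_0[OF lf] by auto
  then have ww: "w \<bullet> w > 0" by simp
  define a where "a = norm (grad f 0)"
  have fa: "\<bar>dderiv f v 0\<bar> \<le> a * norm v" for v
    unfolding a_def grad_inner_smooth[OF f(1), symmetric] by (rule Cauchy_Schwarz_ineq2)
  \<comment> \<open>The excess 1 leaves the term \<open>|z|\<^sup>2\<close> after completing the square.\<close>
  define K where "K = (a\<^sup>2 + 1) / h"
  define \<pi> where "\<pi> q = q - ((q \<bullet> w) / (w \<bullet> w)) *\<^sub>R w" for q
  have bl\<pi>: "bounded_linear \<pi>"
    unfolding \<pi>_def
    by (intro bounded_linear_sub bounded_linear_ident bounded_linear_scaleR_const
        bounded_linear_compose[OF bounded_linear_divide bounded_linear_inner_left])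
  have \<pi>w: "\<pi> w = 0" using ww by (simp add: \<pi>_def)
  have \<pi>z: "\<pi> z = z" if "z \<bullet> w = 0" for z using that by (simp add: \<pi>_def)
  define Vh where "Vh q = line_integral w f q + (K / 2) * (\<pi> q \<bullet> \<pi> q)" for q
  have s\<pi>: "smooth_on UNIV \<pi>" by (rule smooth_on_bounded_linear[OF bl\<pi> open_UNIV smooth_on_ident[OF open_UNIV]])
  have sV: "smooth_on UNIV Vh"
    unfolding Vh_def
    by (intro smooth_on_add smooth_on_mult smooth_on_const smooth_on_inner s\<pi> smooth_on_line_integral f open_UNIV)
  have "(Vh has_derivative (\<lambda>v. dderiv (line_integral w f) v q + (K / 2) * (\<pi> q \<bullet> \<pi> v + \<pi> v \<bullet> \<pi> q))) (at q)" for q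
    unfolding Vh_def
    by (intro has_derivative_add has_derivative_mult_right has_derivative_inner
        smooth_on_has_derivative[OF smooth_on_line_integral[OF f(1)] UNIV_I] bounded_linear_imp_has_derivative[OF bl\<pi>])
  from dderiv_eqI[OF this]
  have dw: "dderiv Vh w q = f q" for q by (simp add: \<pi>w dderiv_line_integral[OF f(1) w0])
  have Vz: "Vh (0 + t *\<^sub>R z) = (K / 2) * (z \<bullet> z) * t\<^sup>2" if "z \<bullet> w = 0" for z t
    using that by (simp add: Vh_def line_integral_transversal \<pi>z power2_eq_square)
  have dz: "dderiv Vh z (0 + t *\<^sub>R z) = K * (z \<bullet> z) * t" if "z \<bullet> w = 0" for z t
  proof -
    have "((\<lambda>t. Vh (0 + t *\<^sub>R z)) has_real_derivative K * (z \<bullet> z) * t) (at t)"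
      unfolding Vz[OF that] by (auto intro!: derivative_eq_intros)
    then show ?thesis
      using smooth_on_derivative_along_line[OF sV UNIV_I, of 0 z t] DERIV_unique by blast
  qed
  have dec: "\<exists>z c. v = z + c *\<^sub>R w \<and> z \<bullet> w = 0" for v
    using ww by (intro exI[of _ "\<pi> v"] exI[of _ "(v \<bullet> w) / (w \<bullet> w)"]) (auto simp: \<pi>_def inner_diff_left)
  have "grad Vh 0 \<bullet> v = 0" for v
  proof -
    obtain z c where v: "v = z + c *\<^sub>R w" "z \<bullet> w = 0" using dec by blast
    note l = dderiv_linear[OF sV UNIV_I, of 0]
    show ?thesis
      using dz[OF v(2), of 0] by (simp add: grad_inner_smooth[OF sV] v(1) linear_add[OF l] linear_scale[OF l] dw f(2))
  qed
  then have "grad Vh 0 \<bullet> grad Vh 0 = 0" by blast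
  then have g0: "grad Vh 0 = 0" by simp
  have "0 < D2 Vh 0 v v" if "v \<noteq> 0" for v
  proof -
    obtain z c where v: "v = z + c *\<^sub>R w" "z \<bullet> w = 0" using dec by blast
    note l = D2_linear_left[OF open_UNIV sV UNIV_I, of 0] and r = D2_linear_right[OF sV UNIV_I, of 0]
    have Dw: "D2 Vh 0 w x = dderiv f x 0" for x unfolding D2_def dw ..
    have Dw': "D2 Vh 0 x w = dderiv f x 0" for x using D2_symmetric[OF open_UNIV sV UNIV_I, of 0 x w] Dw by simp
    have "((\<lambda>t. K * (z \<bullet> z) * t) has_real_derivative K * (z \<bullet> z)) (at 0)"
      by (auto intro!: derivative_eq_intros)
    then have "((\<lambda>t. dderiv Vh z (0 + t *\<^sub>R z)) has_real_derivative K * (z \<bullet> z)) (at 0)"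
      unfolding dz[OF v(2)] .
    moreover have "((\<lambda>t. dderiv Vh z (0 + t *\<^sub>R z)) has_real_derivative D2 Vh 0 z z) (at 0)"
      using smooth_on_derivative_along_line[where f = "\<lambda>q. dderiv Vh z q" and S = UNIV and a = 0 and s = 0 and v = z,
          OF smooth_on_dderiv[OF sV]]
      by (simp add: D2_def)
    ultimately have Dz: "D2 Vh 0 z z = K * (z \<bullet> z)" using DERIV_unique by blast
    have e: "D2 Vh 0 v v = K * (z \<bullet> z) + 2 * (c * dderiv f z 0) + c\<^sup>2 * h"
      unfolding v(1) by (simp add: linear_add[OF l] linear_add[OF r] linear_scale[OF l] linear_scale[OF r] Dw Dw' Dz h_def
          linear_add[OF lf] linear_scale[OF lf]
          power2_eq_square algebra_simps)
    have "- (\<bar>c\<bar> * (a * norm z)) \<le> c * dderiv f z 0"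
    proof -
      have "\<bar>c * dderiv f z 0\<bar> \<le> \<bar>c\<bar> * (a * norm z)" unfolding abs_mult using fa by (intro mult_left_mono) auto
      then show ?thesis by linarith
    qed
    then have "- 2 * (\<bar>c\<bar> * (a * norm z)) \<le> 2 * (c * dderiv f z 0)" by linarith
    then have "h * (- 2 * (\<bar>c\<bar> * (a * norm z))) \<le> h * (2 * (c * dderiv f z 0))"
      by (rule mult_left_mono) (use h in simp)
    moreover have "h * (K * (z \<bullet> z)) = (a * norm z)\<^sup>2 + (norm z)\<^sup>2"
    proof -
      have hK: "h * K = a\<^sup>2 + 1" using h by (simp add: K_def)
      show ?thesis unfolding mult.assoc[symmetric] hK
        by (simp add: power_mult_distrib power2_norm_eq_inner algebra_simps)
    qed
    moreover have "(a * norm z)\<^sup>2 + h * (- 2 * (\<bar>c\<bar> * (a * norm z))) + (\<bar>c\<bar> * h)\<^sup>2 = (a * norm z - \<bar>c\<bar> * h)\<^sup>2"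
      by (simp add: power2_eq_square algebra_simps)
    moreover have "(\<bar>c\<bar> * h)\<^sup>2 = h * (c\<^sup>2 * h)" by (simp add: power2_eq_square)
    ultimately have lb: "(norm z)\<^sup>2 + (a * norm z - \<bar>c\<bar> * h)\<^sup>2 \<le> h * D2 Vh 0 v v"
      unfolding e distrib_left by linarith
    have "0 < (norm z)\<^sup>2 + (a * norm z - \<bar>c\<bar> * h)\<^sup>2"
    proof (cases "z = 0")
      case True
      then have "c \<noteq> 0" using that v(1) by auto
      then show ?thesis using True h by simp
    next
      case False
      then show ?thesis by (intro add_pos_nonneg) auto
    qed
    then show ?thesis using lb h by (metis less_le_trans zero_less_mult_pos)
  qed
  then have "sym_pos_def (hessian Vh 0)"
    by (simp add: sym_pos_def_def hessian_symmetric[OF sV] hessian_inner[OF sV])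
  then show thesis using that sV dw g0 by blast
qed

section \<open>Gyroscopic forces with a prescribed quadratic form\<close>

text \<open>To be used with \<open>n \<bullet> g = 1\<close> and \<open>s = S g\<close>. The terms with \<open>S\<close> are the simplest gyroscopic tensor whose contraction
  with \<open>g\<close> contains \<open>S\<close>; the terms with \<open>s\<close> remove what else this contraction contains, without
  destroying the cyclic identity.\<close>

definition gyro_tensor :: "real^'n \<Rightarrow> real^'n^'n \<Rightarrow> real^'n \<Rightarrow> real^'n^'n^'n" where
  "gyro_tensor n S s = (1/2) *\<^sub>R (\<chi> i j k. 2 * (S $ i $ j * n $ k) - (n $ i * S $ j $ k + n $ j * S $ i $ k)
     + (n $ i * s $ j + s $ i * n $ j) * n $ k - 2 * (n $ i * n $ j * s $ k))"

lemma gyro_tensor_symmetric: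
  assumes "\<And>i j. S $ i $ j = S $ j $ i"
  shows "gyro_tensor n S s $ i $ j $ k = gyro_tensor n S s $ j $ i $ k"
  using assms[of i j] by (simp add: gyro_tensor_def mult.commute add.commute)

lemma gyro_tensor_cyclic:
  assumes "\<And>i j. S $ i $ j = S $ j $ i"
  shows "gyro_tensor n S s $ i $ j $ k + gyro_tensor n S s $ j $ k $ i + gyro_tensor n S s $ k $ i $ j = 0"
  using assms[of j i] assms[of k i] assms[of k j] by (simp add: gyro_tensor_def algebra_simps)

lemma gyro_tensor_force:
  fixes n s v :: "real^'n"
  assumes S: "\<And>i j. S $ i $ j = S $ j $ i"
  shows "(\<chi> k j. \<Sum>i\<in>UNIV. gyro_tensor n S s $ i $ j $ k * v $ i) *v v =
    (v \<bullet> (S *v v) + (n \<bullet> v) * (s \<bullet> v)) *\<^sub>R n - (n \<bullet> v) *\<^sub>R (S *v v) - ((n \<bullet> v) * (n \<bullet> v)) *\<^sub>R s"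
proof -
  have Sv: "(\<Sum>i\<in>UNIV. S $ i $ j * v $ i) = (S *v v) $ j" for j
    using S by (simp add: matrix_vector_mult_def)
  have nv: "(\<Sum>i\<in>UNIV. n $ i * v $ i) = n \<bullet> v" "(\<Sum>i\<in>UNIV. s $ i * v $ i) = s \<bullet> v"
    "(\<Sum>j\<in>UNIV. (S *v v) $ j * v $ j) = v \<bullet> (S *v v)"
    by (simp_all add: inner_vec_def mult.commute)
  have inner: "(\<Sum>i\<in>UNIV. gyro_tensor n S s $ i $ j $ k * v $ i) =
      (S *v v) $ j * n $ k - 1/2 * ((n \<bullet> v) * S $ j $ k + n $ j * (S *v v) $ k)
      + 1/2 * (((n \<bullet> v) * s $ j + (s \<bullet> v) * n $ j) * n $ k) - (n \<bullet> v) * n $ j * s $ k" for j k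
  proof -
    have "(\<Sum>i\<in>UNIV. gyro_tensor n S s $ i $ j $ k * v $ i) =
      (\<Sum>i\<in>UNIV. n $ k * (S $ i $ j * v $ i) - (1/2 * S $ j $ k) * (n $ i * v $ i) - (1/2 * n $ j) * (S $ i $ k * v $ i)
        + (1/2 * s $ j * n $ k) * (n $ i * v $ i) + (1/2 * n $ j * n $ k) * (s $ i * v $ i) - (n $ j * s $ k) * (n $ i * v $ i))"
      by (intro sum.cong refl) (simp add: gyro_tensor_def field_simps)
    also have "\<dots> = n $ k * (S *v v) $ j - (1/2 * S $ j $ k) * (n \<bullet> v) - (1/2 * n $ j) * (S *v v) $ k
        + (1/2 * s $ j * n $ k) * (n \<bullet> v) + (1/2 * n $ j * n $ k) * (s \<bullet> v) - (n $ j * s $ k) * (n \<bullet> v)"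
      unfolding sum_subtractf sum.distrib sum_distrib_left[symmetric] Sv nv ..
    finally show ?thesis by (simp add: field_simps)
  qed
  have "((\<chi> k j. \<Sum>i\<in>UNIV. gyro_tensor n S s $ i $ j $ k * v $ i) *v v) $ k =
    ((v \<bullet> (S *v v) + (n \<bullet> v) * (s \<bullet> v)) *\<^sub>R n - (n \<bullet> v) *\<^sub>R (S *v v) - ((n \<bullet> v) * (n \<bullet> v)) *\<^sub>R s) $ k" for k
  proof -
    have "((\<chi> k j. \<Sum>i\<in>UNIV. gyro_tensor n S s $ i $ j $ k * v $ i) *v v) $ k =
      (\<Sum>j\<in>UNIV. n $ k * ((S *v v) $ j * v $ j) - (1/2 * (n \<bullet> v)) * (S $ j $ k * v $ j) - (1/2 * (S *v v) $ k) * (n $ j * v $ j)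
        + (1/2 * (n \<bullet> v) * n $ k) * (s $ j * v $ j) + (1/2 * (s \<bullet> v) * n $ k) * (n $ j * v $ j) - ((n \<bullet> v) * s $ k) * (n $ j * v $ j))"
      unfolding matrix_vector_mult_def vec_lambda_beta inner
      by (intro sum.cong refl) (simp add: matrix_vector_mult_def field_simps)
    also have "\<dots> = n $ k * (v \<bullet> (S *v v)) - (1/2 * (n \<bullet> v)) * (S *v v) $ k - (1/2 * (S *v v) $ k) * (n \<bullet> v)
        + (1/2 * (n \<bullet> v) * n $ k) * (s \<bullet> v) + (1/2 * (s \<bullet> v) * n $ k) * (n \<bullet> v) - ((n \<bullet> v) * s $ k) * (n \<bullet> v)"
      unfolding sum_subtractf sum.distrib sum_distrib_left[symmetric] Sv nv ..
    finally show ?thesis by (simp add: field_simps)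
  qed
  then show ?thesis by (simp add: Finite_Cartesian_Product.vec_eq_iff)
qed

lemma matrix_entry: "(A :: real^'n^'m) $ i $ j = axis i 1 \<bullet> (A *v axis j 1)"
  by (simp add: matrix_vector_mult_basis Finite_Cartesian_Product.column_def inner_axis')

text \<open>A gyroscopic force does no work, so its \<open>g\<close>-component vanishes at the velocity \<open>g\<close>. Apart from this, the
  quadratic form of the \<open>g\<close>-component can be prescribed.\<close>

lemma gyroscopic_field_exists:
  fixes S :: "real^'n \<Rightarrow> real^'n^'n" and g :: "real^'n \<Rightarrow> real^'n"
  assumes S: "smooth_on UNIV S" "\<And>q x y. x \<bullet> (S q *v y) = y \<bullet> (S q *v x)" and g: "smooth_on UNIV g" "g 0 \<noteq> 0"
  obtains C U where "C \<in> gyroscopic_tensor_fields" "open U" "0 \<in> U" "\<And>q. q \<in> U \<Longrightarrow> g q \<noteq> 0"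
    "\<And>Mh q p. q \<in> U \<Longrightarrow> g q \<bullet> (S q *v g q) = 0 \<Longrightarrow> g q \<bullet> gyroscopic_force Mh C (q, p)
        = (matrix_inv (Mh q) *v p) \<bullet> (S q *v (matrix_inv (Mh q) *v p))"
proof -
  have sg: "smooth_on UNIV (\<lambda>q. g q \<bullet> g q)" by (intro smooth_on_inner g open_UNIV)
  let ?U = "{q. 0 < g q \<bullet> g q}"
  have U: "open ?U" "0 \<in> ?U"
    using g(2) open_Collect_less[OF continuous_on_const smooth_on_imp_continuous_on[OF sg], of 0] by auto
  obtain \<rho> :: "real^'n \<Rightarrow> real" and K W where r: "smooth_on UNIV \<rho>"
    "open W" "0 \<in> W" "W \<subseteq> ?U" "\<And>q. q \<in> W \<Longrightarrow> \<rho> q = 1"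
    "closed K" "K \<subseteq> ?U" "\<And>y. y \<notin> K \<Longrightarrow> \<rho> y = 0"
    by (rule bump_function_exists[OF U]) (assumption | rule that)+
  let ?n = "\<lambda>q. (1 / (g q \<bullet> g q)) *\<^sub>R g q"
  define C where "C q = \<rho> q *\<^sub>R gyro_tensor (?n q) (S q) (S q *v g q)" for q
  have Ss: "S q $ i $ j = S q $ j $ i" for q i j
    unfolding matrix_entry[of "S q"] by (rule S(2))
  have gU: "smooth_on ?U g" "smooth_on ?U S" using smooth_on_mono g S by blast+
  have nU: "smooth_on ?U ?n"
    by (intro smooth_on_scaleR smooth_on_divide smooth_on_inner smooth_on_const U gU) auto
  have "smooth_on ?U (\<lambda>q. gyro_tensor (?n q) (S q) (S q *v g q))"
    unfolding gyro_tensor_def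
    by (intro smooth_on_scaleR[OF _ smooth_on_const] smooth_on_vec_lambda smooth_on_add smooth_on_diff smooth_on_mult smooth_on_const
        smooth_on_vec_nth smooth_on_matrix_vector_mult U(1) gU nU)
  then have "smooth_on UNIV C"
    unfolding C_def by (rule smooth_on_cutoff[OF U(1) _ r(1,6,7)]) (rule r(8))
  then have "C \<in> gyroscopic_tensor_fields"
    unfolding gyroscopic_tensor_fields_def
    using gyro_tensor_symmetric[OF Ss] gyro_tensor_cyclic[OF Ss]
    by (simp add: C_def flip: distrib_left)
  moreover have "g q \<noteq> 0" if "q \<in> W" for q using r(4) that by auto
  moreover have "g q \<bullet> gyroscopic_force Mh C (q, p) = (matrix_inv (Mh q) *v p) \<bullet> (S q *v (matrix_inv (Mh q) *v p))"
    if q: "q \<in> W" and z: "g q \<bullet> (S q *v g q) = 0" for Mh q p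
  proof -
    define v where "v = matrix_inv (Mh q) *v p"
    have "gyroscopic_matrix Mh C (q, p) = (\<chi> k j. \<Sum>i\<in>UNIV. gyro_tensor (?n q) (S q) (S q *v g q) $ i $ j $ k * v $ i)"
      using r(5)[OF q] by (simp add: gyroscopic_matrix_def C_def v_def)
    then have F: "gyroscopic_force Mh C (q, p) =
      (v \<bullet> (S q *v v) + (?n q \<bullet> v) * ((S q *v g q) \<bullet> v)) *\<^sub>R ?n q - (?n q \<bullet> v) *\<^sub>R (S q *v v) - ((?n q \<bullet> v) * (?n q \<bullet> v)) *\<^sub>R (S q *v g q)"
      using gyro_tensor_force[OF Ss, of "?n q" q "S q *v g q" v] by (simp add: gyroscopic_force_eq v_def)
    have gn: "g q \<bullet> ?n q = 1" using r(4) q by auto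
    have gS: "g q \<bullet> (S q *v v) = (S q *v g q) \<bullet> v" using S(2)[of "g q" q v] by (simp add: inner_commute)
    have "g q \<bullet> gyroscopic_force Mh C (q, p) = v \<bullet> (S q *v v)"
      unfolding F inner_diff_right inner_scaleR_right[of "g q" _ "?n q"] inner_scaleR_right[of "g q" _ "S q *v v"]
        inner_scaleR_right[of "g q" _ "S q *v g q"] gn gS z by simp
    then show ?thesis by (simp add: v_def)
  qed
  ultimately show thesis using that r(2,3) by blast
qed

section \<open>Matching the kinetic energies\<close>

lemma dderiv_matrix_vector_const:
  fixes A :: "'a::real_normed_vector \<Rightarrow> real^'n^'m"
  assumes "smooth_on UNIV A" shows "dderiv (\<lambda>q. A q *v x) v q = dderiv A v q *v x"
  using dderiv_eqI[OF has_derivative_matrix_vector_mult[OF smooth_on_has_derivative[OF assms UNIV_I] has_derivative_const]]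
  by simp

lemma dderiv_const: "dderiv (\<lambda>q. c) v q = 0"
  by (rule dderiv_eqI[OF has_derivative_const])

text \<open>Differentiate the constant vector \<open>M (M\<^sup>-\<^sup>1 p)\<close>.\<close>

lemma dderiv_matrix_inv:
  fixes M :: "real^'n \<Rightarrow> real^'n^'n"
  assumes M: "smooth_on UNIV M" "\<And>q. sym_pos_def (M q)"
  shows "dderiv (\<lambda>q. matrix_inv (M q)) a q *v p = - (matrix_inv (M q) *v (dderiv M a q *v (matrix_inv (M q) *v p)))"
proof -
  note sI = smooth_inverse_mass[OF M]
  have sy: "smooth_on UNIV (\<lambda>q. matrix_inv (M q) *v p)"
    by (intro smooth_on_matrix_vector_mult sI smooth_on_const open_UNIV)
  have "0 = dderiv (\<lambda>q. M q *v (matrix_inv (M q) *v p)) a q"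
    by (simp add: sym_pos_def_cancel[OF M(2)] dderiv_const)
  also have "\<dots> = M q *v (dderiv (\<lambda>q. matrix_inv (M q)) a q *v p) + dderiv M a q *v (matrix_inv (M q) *v p)"
    unfolding dderiv_matrix_vector_mult[OF M(1) sy] dderiv_matrix_vector_const[OF sI] ..
  finally have "M q *v (dderiv (\<lambda>q. matrix_inv (M q)) a q *v p) = - (dderiv M a q *v (matrix_inv (M q) *v p))"
    by (metis add.commute eq_neg_iff_add_eq_0)
  then show ?thesis
    using sym_pos_def_cancel(1)[OF M(2), of q "dderiv (\<lambda>q. matrix_inv (M q)) a q *v p"]
    by (simp add: matrix_vector_mult_uminus)
qed

lemma dderiv_symmetric_form:
  fixes M :: "real^'n \<Rightarrow> real^'n^'n"
  assumes M: "smooth_on UNIV M" "\<And>q. sym_pos_def (M q)"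
  shows "x \<bullet> (dderiv M a q *v y) = y \<bullet> (dderiv M a q *v x)"
proof -
  have d: "((\<lambda>q. x \<bullet> (M q *v y)) has_derivative (\<lambda>a. x \<bullet> (dderiv M a q *v y))) (at q)" for x y
    using has_derivative_inner_right[OF has_derivative_matrix_vector_mult[OF smooth_on_has_derivative[OF M(1) UNIV_I] has_derivative_const]]
    by simp
  have "(\<lambda>q. x \<bullet> (M q *v y)) = (\<lambda>q. y \<bullet> (M q *v x))"
    by (rule ext) (metis sym_pos_def_inner[OF M(2)] inner_commute)
  then have "((\<lambda>q. x \<bullet> (M q *v y)) has_derivative (\<lambda>a. y \<bullet> (dderiv M a q *v x))) (at q)"
    using d[of y x] by simp
  from has_derivative_unique[OF d[of x y] this] show ?thesis by metis
qed

text \<open>The quadratic form, in the velocity \<open>v = Mh\<^sup>-\<^sup>1 p\<close>, that the \<open>g\<close>-component of the gyroscopic force has to supply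
  (see \<open>kinetic_matching\<close>).\<close>

definition kinetic_mismatch ::
    "(real^'n \<Rightarrow> real^'n^'n) \<Rightarrow> (real^'n \<Rightarrow> real^'n^'n) \<Rightarrow> real^'n \<Rightarrow> (real^'n \<Rightarrow> real^'n) \<Rightarrow> real^'n \<Rightarrow> real^'n^'n" where
  "kinetic_mismatch M Mh w g q = (1/2) *\<^sub>R
     (Mh q ** matrix_inv (M q) ** dderiv M (g q) q ** matrix_inv (M q) ** Mh q - dderiv Mh w q)"

lemma kinetic_mismatch_form:
  fixes M Mh :: "real^'n \<Rightarrow> real^'n^'n"
  assumes M: "\<And>q. sym_pos_def (M q)" and Mh: "\<And>q. sym_pos_def (Mh q)"
  shows "x \<bullet> (kinetic_mismatch M Mh w g q *v y) =
    1/2 * ((matrix_inv (M q) *v (Mh q *v x)) \<bullet> (dderiv M (g q) q *v (matrix_inv (M q) *v (Mh q *v y))) - x \<bullet> (dderiv Mh w q *v y))"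
proof -
  have "x \<bullet> (Mh q *v (matrix_inv (M q) *v z)) = (matrix_inv (M q) *v (Mh q *v x)) \<bullet> z" for z
    unfolding sym_pos_def_inner[OF Mh, of x] by (rule sym_pos_def_inner[OF sym_pos_def_matrix_inv[OF M]])
  then show ?thesis
    by (simp add: kinetic_mismatch_def scaleR_matrix_vector_assoc[symmetric] matrix_vector_mult_diff_rdistrib
        matrix_vector_mul_assoc[symmetric] inner_diff_right)
qed

lemma smooth_kinetic_mismatch:
  fixes M Mh :: "real^'n \<Rightarrow> real^'n^'n"
  assumes M: "smooth_on UNIV M" "\<And>q. sym_pos_def (M q)" and Mh: "smooth_on UNIV Mh" and g: "smooth_on UNIV g"
  shows "smooth_on UNIV (kinetic_mismatch M Mh w g)"
  unfolding kinetic_mismatch_def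
  by (intro smooth_on_scaleR smooth_on_const smooth_on_diff smooth_on_matrix_matrix_mult smooth_on_dderiv
      smooth_on_dderiv_field[OF M(1) g] smooth_inverse_mass[OF M] Mh open_UNIV)

text \<open>The only derivative of \<open>Mh\<close> that occurs is that of \<open>Mh g\<close> along \<open>w\<close>, and it can be computed from
  \<open>Mh g = M w\<close>.\<close>

lemma kinetic_mismatch_annihilator:
  fixes M Mh :: "real^'n \<Rightarrow> real^'n^'n"
  assumes M: "smooth_on UNIV M" "\<And>q. sym_pos_def (M q)" and Mh: "smooth_on UNIV Mh" "\<And>q. sym_pos_def (Mh q)"
    and g: "smooth_on UNIV g" and U: "open U" "q \<in> U" and eq: "\<And>q. q \<in> U \<Longrightarrow> Mh q *v g q = M q *v w"
    and nd: "kinetic_defect M w g q = 0"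
  shows "g q \<bullet> (kinetic_mismatch M Mh w g q *v g q) = 0"
proof -
  have w: "matrix_inv (M q) *v (Mh q *v g q) = w"
    using eq[OF U(2)] sym_pos_def_cancel(1)[OF M(2)] by simp
  have "smooth_on UNIV (\<lambda>q. Mh q *v g q)" by (intro smooth_on_matrix_vector_mult Mh g open_UNIV)
  then have "(\<lambda>q. Mh q *v g q) differentiable (at q)"
    unfolding differentiable_def using smooth_on_has_derivative[OF _ UNIV_I] by blast
  then have "frechet_derivative (\<lambda>q. Mh q *v g q) (at q) = frechet_derivative (\<lambda>q. M q *v w) (at q)"
    by (rule frechet_derivative_transform_within_open[OF _ U eq])
  then have "dderiv (\<lambda>q. Mh q *v g q) w q = dderiv (\<lambda>q. M q *v w) w q" by simp
  then have d: "Mh q *v dderiv g w q + dderiv Mh w q *v g q = dderiv M w q *v w"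
    unfolding dderiv_matrix_vector_mult[OF Mh(1) g] dderiv_matrix_vector_const[OF M(1)] .
  have "g q \<bullet> (Mh q *v dderiv g w q) = w \<bullet> (M q *v dderiv g w q)"
    unfolding sym_pos_def_inner[OF Mh(2), of "g q"] sym_pos_def_inner[OF M(2), of w] eq[OF U(2)] ..
  then have "g q \<bullet> (dderiv Mh w q *v g q) = g q \<bullet> (dderiv M w q *v w) - w \<bullet> (M q *v dderiv g w q)"
    using arg_cong[OF d, of "\<lambda>x. g q \<bullet> x"] by (simp add: inner_add_right)
  then show ?thesis
    using nd unfolding kinetic_mismatch_form[OF M(2) Mh(2)] w kinetic_defect_def by simp
qed

text \<open>The two potential forces cancel by the choice of \<open>Vh\<close>, since \<open>M\<^sup>-\<^sup>1 Mh g = w\<close> turns the shaped force along \<open>g\<close>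
  into a derivative along \<open>w\<close>. Only the terms quadratic in \<open>p\<close> are left.\<close>

lemma kinetic_matching:
  fixes M Mh :: "real^'n \<Rightarrow> real^'n^'n" and V Vh :: "real^'n \<Rightarrow> real"
  assumes M: "smooth_on UNIV M" "\<And>q. sym_pos_def (M q)" and Mh: "smooth_on UNIV Mh" "\<And>q. sym_pos_def (Mh q)"
    and V: "smooth_on UNIV V" and Vh: "smooth_on UNIV Vh"
    and w: "Mh q *v g q = M q *v w" and pot: "dderiv Vh w q = g q \<bullet> grad V q"
  shows "g q \<bullet> (grad_q (hamiltonian M V) (q, p) - (Mh q ** matrix_inv (M q)) *v grad_q (hamiltonian Mh Vh) (q, p))
    = - ((matrix_inv (Mh q) *v p) \<bullet> (kinetic_mismatch M Mh w g q *v (matrix_inv (Mh q) *v p)))"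
proof -
  define v where "v = matrix_inv (Mh q) *v p"
  have p: "p = Mh q *v v" by (simp add: v_def sym_pos_def_cancel[OF Mh(2)])
  have "g q \<bullet> ((Mh q ** matrix_inv (M q)) *v z) = z \<bullet> w" for z
  proof -
    have "g q \<bullet> (Mh q *v (matrix_inv (M q) *v z)) = (matrix_inv (M q) *v (Mh q *v g q)) \<bullet> z"
      unfolding sym_pos_def_inner[OF Mh(2), of "g q"] by (rule sym_pos_def_inner[OF sym_pos_def_matrix_inv[OF M(2)]])
    then show ?thesis unfolding w sym_pos_def_cancel(1)[OF M(2)] by (simp add: matrix_vector_mul_assoc inner_commute)
  qed
  then have "g q \<bullet> (grad_q (hamiltonian M V) (q, p) - (Mh q ** matrix_inv (M q)) *v grad_q (hamiltonian Mh Vh) (q, p))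
      = grad_q (hamiltonian M V) (q, p) \<bullet> g q - grad_q (hamiltonian Mh Vh) (q, p) \<bullet> w"
    by (simp add: inner_diff_right inner_commute)
  also have "\<dots> = 1/2 * (p \<bullet> (dderiv (\<lambda>q. matrix_inv (M q)) (g q) q *v p)) - 1/2 * (p \<bullet> (dderiv (\<lambda>q. matrix_inv (Mh q)) w q *v p))"
    unfolding grad_q_hamiltonian_inner[OF M V] grad_q_hamiltonian_inner[OF Mh Vh] grad_inner_smooth[OF Vh] pot
    by (simp add: inner_commute)
  also have "p \<bullet> (dderiv (\<lambda>q. matrix_inv (Mh q)) w q *v p) = - (v \<bullet> (dderiv Mh w q *v v))"
    unfolding dderiv_matrix_inv[OF Mh] v_def[symmetric] inner_minus_right
      sym_pos_def_inner[OF sym_pos_def_matrix_inv[OF Mh(2)], of p] ..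
  also have "p \<bullet> (dderiv (\<lambda>q. matrix_inv (M q)) (g q) q *v p) =
      - ((matrix_inv (M q) *v (Mh q *v v)) \<bullet> (dderiv M (g q) q *v (matrix_inv (M q) *v (Mh q *v v))))"
    unfolding dderiv_matrix_inv[OF M] inner_minus_right
      sym_pos_def_inner[OF sym_pos_def_matrix_inv[OF M(2)], of p] p[symmetric] ..
  finally show ?thesis
    unfolding v_def[symmetric] kinetic_mismatch_form[OF M(2) Mh(2)] by (simp add: diff_divide_distrib)
qed

section \<open>Energy shaping is possible\<close>

text \<open>With one degree of underactuation the annihilator is a line.\<close>

lemma annihilates_of_nonzero:
  fixes B :: "real^'m^'n"
  assumes n: "CARD('n) = CARD('m) + 1" "rank B = CARD('m)" and g: "g \<noteq> 0" "\<And>u. g \<bullet> (B *v u) = 0"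
  shows "annihilates g B"
proof -
  obtain h where h: "annihilates h B" using annihilator_exists[OF n] .
  obtain c where c: "g = c *\<^sub>R h" using annihilates_unique[OF h g(2)] .
  then have "c \<noteq> 0" using g(1) by auto
  then show ?thesis using h g(1) unfolding annihilates_def c by simp
qed

text \<open>The annihilator field, \<open>Mh\<close>, \<open>Vh\<close> and \<open>C\<close> are constructed in this order, and \<open>Kd\<close> is the identity. Near the
  origin the force \<open>R\<close> that the input has to produce has no component along the annihilator, so it lies in
  the range of \<open>G\<close>, and the pseudo-inverse of \<open>G\<close> yields the feedback.\<close>

lemma energy_shaping_exists:
  fixes M :: "real^'n \<Rightarrow> real^'n^'n" and V :: "real^'n \<Rightarrow> real" and G :: "real^'n \<Rightarrow> real^'m^'n"
  assumes n: "CARD('n) = CARD('m) + 1"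
    and M: "smooth_on UNIV M" "\<And>q. sym_pos_def (M q)" and V: "smooth_on UNIV V" "grad V 0 = 0"
    and G: "smooth_on UNIV G" "\<And>q. rank (G q) = CARD('m)" and g0: "annihilates g0 (G 0)"
    and w: "g0 \<bullet> (M 0 *v w) > 0" "g0 \<bullet> (hessian V 0 *v w) > 0"
  shows "\<exists>Mh Vh Kd C. energy_shaping M V G Mh Vh Kd C"
proof -
  obtain g U1 where g: "smooth_on UNIV g" "g 0 = g0" "\<And>q u. g q \<bullet> (G q *v u) = 0"
    and U1: "open U1" "0 \<in> U1" "\<And>q. q \<in> U1 \<Longrightarrow> kinetic_defect M w g q = 0"
    using annihilator_without_kinetic_defect[OF M G g0 w(1)] by blast
  have sy: "smooth_on UNIV (\<lambda>q. M q *v w)" by (intro smooth_on_matrix_vector_mult smooth_on_const M open_UNIV)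
  have "g 0 \<bullet> (M 0 *v w) > 0" using w(1) g(2) by simp
  from shaped_mass_exists[OF g(1) sy this]
  obtain Mh U2 where Mh: "smooth_on UNIV Mh" "\<And>q. sym_pos_def (Mh q)"
    and U2: "open U2" "0 \<in> U2" "\<And>q. q \<in> U2 \<Longrightarrow> Mh q *v g q = M q *v w" by blast
  let ?f = "\<lambda>q. g q \<bullet> grad V q"
  have sgV: "smooth_on UNIV (grad V)" by (rule smooth_on_grad[OF open_UNIV V(1)])
  have sf: "smooth_on UNIV ?f" by (intro smooth_on_inner g sgV open_UNIV)
  have "dderiv ?f w 0 = g 0 \<bullet> dderiv (grad V) w 0 + dderiv g w 0 \<bullet> grad V 0"
    by (rule dderiv_eqI[OF has_derivative_inner[OF smooth_on_has_derivative[OF g(1) UNIV_I] smooth_on_has_derivative[OF sgV UNIV_I]]])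
  then have f: "?f 0 = 0" "dderiv ?f w 0 > 0"
    using w(2) by (simp_all add: V(2) g(2) hessian_mult[OF V(1)])
  obtain Vh where Vh: "smooth_on UNIV Vh" "\<And>q. dderiv Vh w q = ?f q" "grad Vh 0 = 0" "sym_pos_def (hessian Vh 0)"
    using shaped_potential_exists[OF sf f] by blast
  let ?S = "kinetic_mismatch M Mh w g"
  have S: "smooth_on UNIV ?S" by (rule smooth_kinetic_mismatch[OF M Mh(1) g(1)])
  have Ss: "x \<bullet> (?S q *v y) = y \<bullet> (?S q *v x)" for q x y
    unfolding kinetic_mismatch_form[OF M(2) Mh(2)]
    by (simp only: dderiv_symmetric_form[OF M, of "matrix_inv (M q) *v (Mh q *v x)"] dderiv_symmetric_form[OF Mh, of x])
  have "g 0 \<noteq> 0" using g0 by (simp add: g(2) annihilates_def)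
  from gyroscopic_field_exists[OF S Ss g(1) this]
  obtain C U3 where C: "C \<in> gyroscopic_tensor_fields" and U3: "open U3" "0 \<in> U3" "\<And>q. q \<in> U3 \<Longrightarrow> g q \<noteq> 0"
    and F: "\<And>q p. q \<in> U3 \<Longrightarrow> g q \<bullet> (?S q *v g q) = 0 \<Longrightarrow> g q \<bullet> gyroscopic_force Mh C (q, p)
        = (matrix_inv (Mh q) *v p) \<bullet> (?S q *v (matrix_inv (Mh q) *v p))" by metis
  have sC: "smooth_on UNIV C" using C by (simp add: gyroscopic_tensor_fields_def)
  let ?Kd = "\<lambda>q :: real^'n. Finite_Cartesian_Product.mat 1 :: real^'m^'m"
  have sK: "smooth_on UNIV ?Kd" by (rule smooth_on_const[OF open_UNIV])
  let ?R = "\<lambda>x. snd (closed_loop_field M G Mh Vh ?Kd C x) + grad_q (hamiltonian M V) x"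
  let ?u = "\<lambda>x :: (real^'n) \<times> (real^'n). pseudo_inverse (G (fst x)) *v ?R x"
  have sR: "smooth_on UNIV ?R"
    unfolding grad_q_hamiltonian[OF M V(1)]
    by (intro smooth_on_add smooth_on_snd smooth_closed_loop_field[OF M G(1) Mh Vh(1) sK sC] smooth_on_matrix_vector_mult
        smooth_kinetic_grad_matrix[OF M] smooth_on_compose_fst[OF sgV] smooth_on_ident open_UNIV)
  have su: "smooth_on UNIV ?u"
    by (intro smooth_on_matrix_vector_mult smooth_on_compose_fst[OF smooth_pseudo_inverse[OF G]] sR open_UNIV)
  let ?U = "fst -` (U1 \<inter> U2 \<inter> U3) :: ((real^'n) \<times> (real^'n)) set"
  have U: "open ?U" "0 \<in> ?U"
    using U1 U2 U3 by (auto intro!: open_vimage continuous_intros)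
  have match: "controlled_field M V G x (?u x) = closed_loop_field M G Mh Vh ?Kd C x" if "x \<in> ?U" for x
  proof -
    obtain q p where x: "x = (q, p)" by (cases x)
    then have q: "q \<in> U1" "q \<in> U2" "q \<in> U3" using that by auto
    have "g q \<bullet> (?S q *v g q) = 0"
      by (rule kinetic_mismatch_annihilator[OF M Mh g(1) U2(1) q(2) U2(3) U1(3)[OF q(1)]])
    note force = F[OF q(3) this]
    let ?D = "G q *v (?Kd q *v ((matrix_inv (Mh q) *v p) v* G q))"
    have cl: "closed_loop_field M G Mh Vh ?Kd C (q, p) = (matrix_inv (M q) *v p,
        - ((Mh q ** matrix_inv (M q)) *v grad_q (hamiltonian Mh Vh) (q, p)) - ?D + gyroscopic_force Mh C (q, p))"
      unfolding closed_loop_field_eq[OF Mh Vh(1)] gyroscopic_force_eq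
      by (simp add: matrix_vector_mul_assoc[symmetric])
    have "g q \<bullet> ?R (q, p) = g q \<bullet> (grad_q (hamiltonian M V) (q, p) - (Mh q ** matrix_inv (M q)) *v grad_q (hamiltonian Mh Vh) (q, p))
        - g q \<bullet> ?D + g q \<bullet> gyroscopic_force Mh C (q, p)"
      unfolding cl by (simp add: inner_add_right inner_diff_right)
    also have "\<dots> = 0"
      unfolding kinetic_matching[where g = g, OF M Mh V(1) Vh(1) U2(3)[OF q(2)] Vh(2)] force g(3) by simp
    finally have "g q \<bullet> ?R (q, p) = 0" .
    then obtain v where v: "?R (q, p) = G q *v v"
      using annihilates_solve[OF annihilates_of_nonzero[OF n G(2) U3(3)[OF q(3)] g(3)]] by blast
    have "G q *v ?u (q, p) = ?R (q, p)" by (simp only: fst_conv v pseudo_inverse_left[OF G(2)])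
    then have "snd (controlled_field M V G (q, p) (?u (q, p))) = snd (closed_loop_field M G Mh Vh ?Kd C (q, p))"
      by (simp add: controlled_field_def Let_def)
    moreover have "fst (controlled_field M V G (q, p) (?u (q, p))) = fst (closed_loop_field M G Mh Vh ?Kd C (q, p))"
      by (simp add: controlled_field_def Let_def grad_p_hamiltonian[OF M V(1)] cl)
    ultimately show ?thesis unfolding x by (simp only: prod_eq_iff)
  qed
  have "transformed_by_feedback (controlled_field M V G) (closed_loop_field M G Mh Vh ?Kd C)"
    unfolding transformed_by_feedback_def
    using U match smooth_on_mono[OF su subset_UNIV] by blast
  moreover have "nondegenerate_local_min (hamiltonian Mh Vh) (0, 0)"
    using nondegenerate_local_min_hamiltonian[OF Mh Vh(1)] Vh(3,4) by blast
  moreover have "sym_pos_def (?Kd q)" for q by (simp add: sym_pos_def_def transpose_mat)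
  ultimately show ?thesis
    unfolding energy_shaping_def using Mh Vh(1) sK C by blast
qed

text \<open>The bisector \<open>|b| a + |a| b\<close> works; both inner products are positive by the Cauchy-Schwarz inequality, which
  is strict because \<open>b\<close> is not a nonpositive multiple of \<open>a\<close>.\<close>

lemma common_direction_exists:
  fixes a b :: "'a::real_inner"
  assumes a: "a \<noteq> 0" and b: "\<And>\<mu>. \<mu> \<le> 0 \<Longrightarrow> b \<noteq> \<mu> *\<^sub>R a"
  obtains w where "a \<bullet> w > 0" "b \<bullet> w > 0"
proof -
  have b0: "b \<noteq> 0" using b[of 0] by simp
  have ne: "a \<bullet> b \<noteq> - (norm a * norm b)"
  proof
    assume eq: "a \<bullet> b = - (norm a * norm b)"
    define v where "v = norm a *\<^sub>R b + norm b *\<^sub>R a"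
    have "v \<bullet> v = (norm a)\<^sup>2 * (b \<bullet> b) + 2 * (norm a * norm b) * (a \<bullet> b) + (norm b)\<^sup>2 * (a \<bullet> a)"
      by (simp add: v_def inner_add_left inner_add_right inner_commute[of b a] power2_eq_square algebra_simps)
    also have "\<dots> = 0"
      unfolding eq power2_norm_eq_inner[symmetric] by (simp add: power2_eq_square)
    finally have "norm a *\<^sub>R b + norm b *\<^sub>R a = 0" by (simp add: v_def)
    then have "norm a *\<^sub>R b = - (norm b *\<^sub>R a)" by (simp add: eq_neg_iff_add_eq_0)
    then have "(1 / norm a) *\<^sub>R (norm a *\<^sub>R b) = (1 / norm a) *\<^sub>R (- (norm b *\<^sub>R a))" by (rule arg_cong)
    then have "b = (- (norm b / norm a)) *\<^sub>R a" using a by simp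
    moreover have "- (norm b / norm a) \<le> 0" by simp
    ultimately show False using b by blast
  qed
  moreover have "- (norm a * norm b) \<le> a \<bullet> b" using Cauchy_Schwarz_ineq2[of a b] by linarith
  ultimately have gt: "- (norm a * norm b) < a \<bullet> b" by linarith
  let ?w = "norm b *\<^sub>R a + norm a *\<^sub>R b"
  have "a \<bullet> ?w = norm a * (norm a * norm b + a \<bullet> b)"
    by (simp add: inner_add_right algebra_simps power2_norm_eq_inner[symmetric] power2_eq_square)
  moreover have "b \<bullet> ?w = norm b * (norm a * norm b + a \<bullet> b)"
    by (simp add: inner_add_right inner_commute[of b a] algebra_simps power2_norm_eq_inner[symmetric] power2_eq_square)
  moreover have "norm a > 0" "norm b > 0" using a b0 by auto
  ultimately show thesis using that[of ?w] gt by simp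
qed

theorem theorem2:
  fixes M :: "real^'n \<Rightarrow> real^'n^'n"
    and V :: "real^'n \<Rightarrow> real"
    and G :: "real^'n \<Rightarrow> real^'m^'n"
  assumes "CARD('n) = CARD('m) + 1"
    and "smooth_on UNIV M" and "\<And>q. sym_pos_def (M q)"
    and "smooth_on UNIV V"
    and "smooth_on UNIV G" and "\<And>q. rank (G q) = CARD('m)"
    and "grad V 0 = 0"
  shows "((\<exists>Mh Vh Kd C. energy_shaping M V G Mh Vh Kd C) \<longleftrightarrow>
            controllable (linearization_A M V) (linearization_B G) \<or>
            uncontrollable_part_oscillatory (linearization_A M V) (linearization_B G))
       \<and> (\<forall>Mh Vh Kd C. energy_shaping M V G Mh Vh Kd C \<longrightarrow>
            (exponentially_stable (closed_loop_field M G Mh Vh Kd C) \<longleftrightarrow>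
             controllable (linearization_A M V) (linearization_B G)))"
proof -
  note n = assms(1) and M = assms(2,3) and V = assms(4) and G = assms(5,6) and V0 = assms(7)
  let ?m = "M 0" and ?P = "hessian V 0"
  have lin: "linearization_A M V = lin_A ?m ?P" "linearization_B G = lin_B (G 0)"
    by (simp_all add: linearization_A_def lin_A_def linearization_B_def lin_B_def)
  note sP = hessian_symmetric[OF V, of 0]
  obtain g where g: "annihilates g (G 0)" using annihilator_exists[OF n G(2)] .
  note ctrl = controllable_iff_not_parallel[OF n M(2) sP g]
    and osc = oscillatory_iff_positive[OF n M(2) sP g]
  have facts: "sym_pos_def (Mh 0) \<and> sym_pos_def (hessian Vh 0) \<and> sym_pos_def (Kd 0) \<and>
      ?P *v g = hessian Vh 0 *v (matrix_inv ?m *v (Mh 0 *v g)) \<and>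
      smooth_on UNIV (closed_loop_field M G Mh Vh Kd C) \<and> closed_loop_field M G Mh Vh Kd C 0 = 0 \<and>
      (closed_loop_field M G Mh Vh Kd C has_derivative closed_loop_lin ?m (Mh 0) (hessian Vh 0) (G 0) (Kd 0)) (at 0)"
    if es: "energy_shaping M V G Mh Vh Kd C" for Mh Vh Kd C
  proof -
    have Mh: "smooth_on UNIV Mh" "\<And>q. sym_pos_def (Mh q)" and Vh: "smooth_on UNIV Vh"
      and Kd: "smooth_on UNIV Kd" "\<And>q. sym_pos_def (Kd q)" and C: "smooth_on UNIV C"
      and fb: "transformed_by_feedback (controlled_field M V G) (closed_loop_field M G Mh Vh Kd C)"
      and nd: "nondegenerate_local_min (hamiltonian Mh Vh) (0, 0)"
      using es unfolding energy_shaping_def gyroscopic_tensor_fields_def by auto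
    have Vh0: "grad Vh 0 = 0" and Ph: "sym_pos_def (hessian Vh 0)"
      using nondegenerate_local_min_hamiltonian[OF Mh Vh] nd by auto
    show ?thesis
      using Mh(2) Ph Kd(2) matching_at_origin[OF M V V0 G(1) G(2) g Mh Vh Vh0 fb]
        smooth_closed_loop_field[OF M G(1) Mh Vh Kd(1) C] closed_loop_field_has_derivative[OF M G(1) Mh Vh Vh0 Kd(1) C]
      by blast
  qed
  have necessary: "\<mu> > 0" if es: "energy_shaping M V G Mh Vh Kd C" and par: "?P *v g = \<mu> *\<^sub>R (?m *v g)" for Mh Vh Kd C \<mu>
  proof -
    note f = facts[OF es]
    define w where "w = matrix_inv ?m *v (Mh 0 *v g)"
    have mw: "?m *v w = Mh 0 *v g" by (simp add: w_def sym_pos_def_cancel[OF M(2)])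
    have pos: "0 < g \<bullet> (Mh 0 *v g)" using f g by (auto simp: sym_pos_def_def annihilates_def)
    then have "w \<noteq> 0" using mw by auto
    then have "0 < w \<bullet> (hessian Vh 0 *v w)" using f by (auto simp: sym_pos_def_def)
    also have "\<dots> = w \<bullet> (?P *v g)" using f by (simp add: w_def)
    also have "\<dots> = \<mu> * (g \<bullet> (Mh 0 *v g))"
      unfolding par inner_scaleR_right sym_pos_def_inner[OF M(2), of w] mw by (simp add: inner_commute)
    finally show ?thesis using pos by (simp add: zero_less_mult_iff)
  qed
  have sufficient: "\<exists>Mh Vh Kd C. energy_shaping M V G Mh Vh Kd C"
    if np: "\<And>\<mu>. \<mu> \<le> 0 \<Longrightarrow> ?P *v g \<noteq> \<mu> *\<^sub>R (?m *v g)"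
  proof -
    have "?m *v g \<noteq> 0" using pos_def_zero[OF M(2), of 0 g] g by (auto simp: annihilates_def)
    then obtain w where w: "(?m *v g) \<bullet> w > 0" "(?P *v g) \<bullet> w > 0"
      using common_direction_exists[of "?m *v g" "?P *v g"] np by blast
    have "g \<bullet> (?m *v w) > 0" "g \<bullet> (?P *v w) > 0"
      using w unfolding sym_pos_def_inner[OF M(2), of g] symmetric_matrix_inner[OF sP, of g] by auto
    then show ?thesis by (rule energy_shaping_exists[OF n M V V0 G g])
  qed
  have "(\<exists>Mh Vh Kd C. energy_shaping M V G Mh Vh Kd C) \<longleftrightarrow>
      controllable (lin_A ?m ?P) (lin_B (G 0)) \<or> uncontrollable_part_oscillatory (lin_A ?m ?P) (lin_B (G 0))"
  proof
    assume "\<exists>Mh Vh Kd C. energy_shaping M V G Mh Vh Kd C"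
    then show "controllable (lin_A ?m ?P) (lin_B (G 0)) \<or> uncontrollable_part_oscillatory (lin_A ?m ?P) (lin_B (G 0))"
      using necessary osc unfolding ctrl by blast
  next
    assume c: "controllable (lin_A ?m ?P) (lin_B (G 0)) \<or> uncontrollable_part_oscillatory (lin_A ?m ?P) (lin_B (G 0))"
    show "\<exists>Mh Vh Kd C. energy_shaping M V G Mh Vh Kd C"
    proof (rule sufficient)
      fix \<mu> :: real assume "\<mu> \<le> 0"
      then show "?P *v g \<noteq> \<mu> *\<^sub>R (?m *v g)" using c osc[of \<mu>] unfolding ctrl by auto
    qed
  qed
  moreover have "exponentially_stable (closed_loop_field M G Mh Vh Kd C) \<longleftrightarrow> controllable (lin_A ?m ?P) (lin_B (G 0))"
    if es: "energy_shaping M V G Mh Vh Kd C" for Mh Vh Kd C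
  proof -
    from facts[OF es] have f: "sym_pos_def (Mh 0)" "sym_pos_def (hessian Vh 0)" "sym_pos_def (Kd 0)"
      "?P *v g = hessian Vh 0 *v (matrix_inv ?m *v (Mh 0 *v g))"
      "smooth_on UNIV (closed_loop_field M G Mh Vh Kd C)" "closed_loop_field M G Mh Vh Kd C 0 = 0"
      "(closed_loop_field M G Mh Vh Kd C has_derivative closed_loop_lin ?m (Mh 0) (hessian Vh 0) (G 0) (Kd 0)) (at 0)" by blast+
    show ?thesis
      unfolding ctrl
      using exponentially_stable_if_not_parallel[OF M(2) f(1,2,3) g f(4) _ f(5,6,7)]
        not_exponentially_stable_if_parallel[OF M(2) f(1,2) g f(4) _ f(6,7)] by blast
  qed
  ultimately show ?thesis unfolding lin by blast
qed

end
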